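(* Assume that the interference graph $G$ is complete, that $$\max_{c\in\mathcal{C}}\frac{\lambda_c}{\nu_c}<1-\sum_{d\in\mathcal{C}}\frac{\lambda_d}{\mu_d},$$ and that $\lim_{N\to\infty}p_{c,N}=p_c>0$ for every $c\in\mathcal{C}$. Put $\xi_c=\frac{\lambda_c}{\nu_c(1-\sum_{d\in\mathcal{C}}\lambda_d/\mu_d)}$. Let $Q_c^{(N)}$ be the stationary queue length at a class-$c$ node, and $W_c^{(N)}$, $S_c^{(N)}$ the stationary waiting time and sojourn time of a packet at a class-$c$ node. Then for every class $c\in\mathcal{C}$, as $N\to\infty$, $$\mathbb{E}[Q_c^{(N)}]\to\mathbb{E}[\bar Q_c],\qquad \frac{\lambda_c}{N_c}\mathbb{E}[W_c^{(N)}]\to\mathbb{E}[\bar W_c],\qquad \frac{\lambda_c}{N_c}\mathbb{E}[S_c^{(N)}]\to\mathbb{E}[\bar S_c],$$ where $\mathbb{P}\{\bar Q_c=k\}=(1-\xi_c)\xi_c^k$ for $k\in\mathbb{N}_0$, and $\bar W_c$, $\bar S_c$ are both exponentially distributed with rate parameter $\frac{1-\xi_c}{\xi_c}$.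
   Context: Network. There are $N$ nodes partitioned into classes $\mathcal{C}=\{1,\dots,C\}$; class $c$ has $N_c=N_c^{(N)}\ge1$ nodes, $\sum_c N_c=N$, $p_{c,N}=N_c/N$. The class interference graph is complete, so at most one node can transmit at any time. Parameters $\lambda_c,\mu_c,\nu_c$ are positive constants. Dynamics. Packets arrive at each class-$c$ node as independent Poisson processes of rate $\lambda_c/N_c$. A class-$c$ node with nonempty buffer backs off for an exponential time of rate $\nu_c/N_c$ before transmitting one packet; back-offs are frozen whenever some node is transmitting, and nodes with empty buffers do not back off. Transmission of a class-$c$ packet takes an exponential time of rate $\mu_c$. Packets at each node are transmitted in order of arrival. The queue lengths together with the activity state (idle, or the class of the active node) form a Markov process, which is positive recurrent for every $N$ under the displayed condition. Quantities. The queue length of a node is the number of packets in its buffer, excluding any packet in transmission; by symmetry its stationary law is the same for all nodes of a class. The waiting time of a packet is the time it spends in the buffer, from its arrival until the start of its transmission; its sojourn time is the waiting time plus its transmission time. *)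

theory Defs
  imports "HOL-Probability.Probability"
begin

section \<open>Continuous-time Markov chains on a discrete state space\<close>

text \<open>A chain is given by its rates \<open>q s s'\<close> for \<open>s \<noteq> s'\<close>, with \<open>q s s = 0\<close> on the diagonal.
  The chains below have finitely many nonzero rates into and out of each state.\<close>

definition exit_rate :: "('s \<Rightarrow> 's \<Rightarrow> real) \<Rightarrow> 's \<Rightarrow> real" where
  "exit_rate q s = (\<Sum>\<^sub>\<infinity>s'. q s s')"

definition stationary_pmf :: "('s \<Rightarrow> 's \<Rightarrow> real) \<Rightarrow> 's pmf \<Rightarrow> bool" where
  "stationary_pmf q \<pi> \<longleftrightarrow>
     (\<forall>s. (\<Sum>\<^sub>\<infinity>s'. pmf \<pi> s' * q s' s) = pmf \<pi> s * exit_rate q s)"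

text \<open>The chain with initial law \<open>\<pi>\<close>, by its jump chain \<open>Y\<close> and holding times \<open>H\<close>: the chain is in
  state \<open>Y k\<close> for a time \<open>H k\<close> and then jumps to \<open>Y (Suc k)\<close>. Given the jump chain, which has
  transition probabilities \<open>q s s' / exit_rate q s\<close>, the holding times are independent and
  \<open>H k\<close> is exponential with rate \<open>exit_rate q (Y k)\<close>. The events below are stable under
  intersection and determine the joint law. There must be no absorbing states.\<close>

definition markov_jump_process ::
  "('s \<Rightarrow> 's \<Rightarrow> real) \<Rightarrow> 's pmf \<Rightarrow> 'w measure \<Rightarrow> (nat \<Rightarrow> 'w \<Rightarrow> 's) \<Rightarrow> (nat \<Rightarrow> 'w \<Rightarrow> real) \<Rightarrow> bool"
where
  "markov_jump_process q \<pi> M Y H \<longleftrightarrow>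
     prob_space M \<and>
     (\<forall>k. Y k \<in> measurable M (count_space UNIV)) \<and>
     (\<forall>k. H k \<in> borel_measurable M) \<and>
     (\<forall>m s t. (\<forall>k<m. 0 \<le> t k) \<longrightarrow>
        measure M {\<omega> \<in> space M. (\<forall>k\<le>m. Y k \<omega> = s k) \<and> (\<forall>k<m. t k < H k \<omega>)} =
          pmf \<pi> (s 0) *
          (\<Prod>k<m. q (s k) (s (Suc k)) / exit_rate q (s k) * exp (- exit_rate q (s k) * t k)))"

definition jump_time :: "(nat \<Rightarrow> real) \<Rightarrow> nat \<Rightarrow> real" where
  "jump_time h k = (\<Sum>j\<le>k. h j)" \<comment> \<open>time of the jump from \<open>Y k\<close> to \<open>Y (Suc k)\<close>\<close>


section \<open>The random-access network with complete interference graph\<close>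

text \<open>Node \<open>(c, j)\<close> is the \<open>j\<close>-th node of class \<open>c\<close>, where \<open>j < n c\<close>. A state consists of the
  queue lengths (packets in the buffer, without the one in transmission) and the activity:
  \<open>None\<close> if idle, \<open>Some c\<close> if a class-\<open>c\<close> node is transmitting. At most one node can be active.\<close>

type_synonym 'c node = "'c \<times> nat"
type_synonym 'c state = "('c node \<Rightarrow> nat) \<times> 'c option"

definition nodes :: "('c \<Rightarrow> nat) \<Rightarrow> 'c node set" where
  "nodes n = {(c, j). j < n c}"

definition network_states :: "('c \<Rightarrow> nat) \<Rightarrow> 'c state set" where
  "network_states n = {(x, a). \<forall>v. v \<notin> nodes n \<longrightarrow> x v = 0}"

text \<open>The three sums are packet arrivals, back-off completions (whereupon a packet leaves the buffer
  and its transmission starts), and transmission completions.\<close>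

definition network_rate ::
  "('c::finite \<Rightarrow> nat) \<Rightarrow> ('c \<Rightarrow> real) \<Rightarrow> ('c \<Rightarrow> real) \<Rightarrow> ('c \<Rightarrow> real) \<Rightarrow> 'c state \<Rightarrow> 'c state \<Rightarrow> real"
where
  "network_rate n lam mu nu = (\<lambda>(x, a) (x', a').
     (\<Sum>v\<in>nodes n. if x' = x(v := x v + 1) \<and> a' = a
                     then lam (fst v) / real (n (fst v)) else 0) +
     (\<Sum>v\<in>nodes n. if a = None \<and> 0 < x v \<and> x' = x(v := x v - 1) \<and> a' = Some (fst v)
                     then nu (fst v) / real (n (fst v)) else 0) +
     (\<Sum>c\<in>UNIV. if a = Some c \<and> x' = x \<and> a' = None then mu c else 0))"

definition queue_law :: "'c state pmf \<Rightarrow> 'c node \<Rightarrow> nat pmf" where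
  "queue_law \<pi> v = map_pmf (\<lambda>(x, a). x v) \<pi>"


subsection \<open>Waiting and sojourn times of packets\<close>

text \<open>These are functions of a path, i.e. of the sequences \<open>y\<close> of states and \<open>h\<close> of holding times.
  A packet at node \<open>v\<close> is identified by the index \<open>k\<close> of the jump at which it arrives.\<close>

definition arrival_at :: "'c node \<Rightarrow> (nat \<Rightarrow> 'c state) \<Rightarrow> nat \<Rightarrow> bool" where
  "arrival_at v y k \<longleftrightarrow> fst (y (Suc k)) v = fst (y k) v + 1"

definition start_at :: "'c node \<Rightarrow> (nat \<Rightarrow> 'c state) \<Rightarrow> nat \<Rightarrow> bool" where
  "start_at v y m \<longleftrightarrow> fst (y m) v = fst (y (Suc m)) v + 1"

definition completion :: "(nat \<Rightarrow> 'c state) \<Rightarrow> nat \<Rightarrow> bool" where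
  "completion y e \<longleftrightarrow> snd (y e) \<noteq> None \<and> snd (y (Suc e)) = None"

text \<open>Packets are transmitted in order of arrival: a packet that arrives at jump \<open>k\<close> and brings the
  queue to length \<open>r\<close> is the \<open>r\<close>-th whose transmission starts at the node after jump \<open>k\<close>.\<close>

definition packet_start :: "'c node \<Rightarrow> (nat \<Rightarrow> 'c state) \<Rightarrow> nat \<Rightarrow> nat \<Rightarrow> bool" where
  "packet_start v y k m \<longleftrightarrow>
     k < m \<and> start_at v y m \<and> card {l \<in> {k<..m}. start_at v y l} = fst (y (Suc k)) v"

text \<open>There is at most one \<open>m\<close> with \<open>packet_start v y k m\<close>. If there is none, the time is \<open>\<infinity>\<close>.\<close>

definition waiting_time ::
  "'c node \<Rightarrow> (nat \<Rightarrow> 'c state) \<Rightarrow> (nat \<Rightarrow> real) \<Rightarrow> nat \<Rightarrow> ennreal" where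
  "waiting_time v y h k =
     (INF m\<in>{m. packet_start v y k m}. ennreal (jump_time h m - jump_time h k))"

definition transmission_time ::
  "'c node \<Rightarrow> (nat \<Rightarrow> 'c state) \<Rightarrow> (nat \<Rightarrow> real) \<Rightarrow> nat \<Rightarrow> ennreal" where
  "transmission_time v y h k =
     (INF (m, e)\<in>{(m, e). packet_start v y k m \<and> m < e \<and> completion y e}.
        ennreal (jump_time h e - jump_time h m))"

definition sojourn_time ::
  "'c node \<Rightarrow> (nat \<Rightarrow> 'c state) \<Rightarrow> (nat \<Rightarrow> real) \<Rightarrow> nat \<Rightarrow> ennreal" where
  "sojourn_time v y h k = waiting_time v y h k + transmission_time v y h k"

text \<open>Expectation of a nonnegative quantity \<open>f\<close> attached to the packets of node \<open>v\<close>, under the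
  stationary (Palm) law of a packet, when \<open>Y\<close>, \<open>H\<close> is the stationary process: the expected sum of
  \<open>f\<close> over the packets that arrive in the time interval \<open>(0, 1]\<close>, divided by the expected number of
  such packets.\<close>

definition packet_expectation ::
  "'w measure \<Rightarrow> (nat \<Rightarrow> 'w \<Rightarrow> 'c state) \<Rightarrow> (nat \<Rightarrow> 'w \<Rightarrow> real) \<Rightarrow> 'c node \<Rightarrow>
   ('c node \<Rightarrow> (nat \<Rightarrow> 'c state) \<Rightarrow> (nat \<Rightarrow> real) \<Rightarrow> nat \<Rightarrow> ennreal) \<Rightarrow> ennreal"
where
  "packet_expectation M Y H v f =
     (\<integral>\<^sup>+\<omega>. (\<Sum>k. if arrival_at v (\<lambda>i. Y i \<omega>) k \<and> jump_time (\<lambda>i. H i \<omega>) k \<le> 1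
                 then f v (\<lambda>i. Y i \<omega>) (\<lambda>i. H i \<omega>) k else 0) \<partial>M) /
     (\<integral>\<^sup>+\<omega>. (\<Sum>k. if arrival_at v (\<lambda>i. Y i \<omega>) k \<and> jump_time (\<lambda>i. H i \<omega>) k \<le> 1
                 then 1 else 0) \<partial>M)"

end

theory Submission
  imports Defs
begin

text \<open>
  \<^emph>\<open>Queue lengths.\<close> Given the queues, which change slowly, the network is idle for a fraction
  \<open>1 / (1 + s)\<close> of the time, where \<open>s = start_load\<close> is the work started per unit of idle time. Since it
  is idle for a fraction \<open>1 - rho\<close> altogether, \<open>s\<close> equals \<open>rho / (1 - rho) = limit_load\<close> on average
  over the idle time. Smoothed positive parts of \<open>xi c ^ k - tail c k\<close>, where \<open>tail c k\<close> is the fraction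
  of class-\<open>c\<close> nodes holding at least \<open>k\<close> packets, add up to a Lyapunov function whose drift shows that
  \<open>s\<close> is asymptotically not below that value, so it concentrates there. A single queue is therefore
  asymptotically independent of the idle state and behaves as a birth-death chain with ratio \<open>xi c\<close>, which
  gives the geometric limit law and lower bounds for the means. A quadratic Lyapunov function bounds a
  weighted sum of the means, over all classes, by the same weighted sum of the limits; hence all means
  converge. Nodes of one class have equal means because the stationary law is unique.

  \<^emph>\<open>Little's law.\<close> By Campbell's formula the expected number of arrivals during \<open>[0, 1]\<close> made by each
  transition is its stationary flow. Following these packets along the jump chain, the expected number of
  visits to a state with the packet at position \<open>r\<close> is the minimal solution of the flow balance
  equations, which are also solved by the stationary flow restricted to states with at least \<open>r\<close> packets
  queued. The difference of the two solutions has no source and finite total mass, so nothing leaves it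
  and it vanishes; summing over \<open>r\<close> identifies the total waiting time with the mean queue length. The
  transmission adds a sojourn of order \<open>1 / N\<close>, which disappears in the limit.
\<close>

section \<open>Stationary laws\<close>

text \<open>Two obstacles shape the queue part. The mean is an unbounded functional, so the limit
  law alone gives only lower bounds for the means; in place of uniform integrability there is an
  upper bound that is sharp to first order. In the quadratic drift a class-\<open>c\<close> queue
  has coefficient \<open>slack c\<close>, and \<open>slack c * (xi c / (1 - xi c))\<close> equals
  the cost \<open>lam c / (nu c * mu c)\<close> per node, so no class can stay above its limit
  unless another falls below its own. Moreover, the stationarity identity is available for bounded
  test functions only, hence the truncations. For the concentration, an exact identity fixes the
  idle average of the load, so a one-sided bound already controls the absolute deviation. In the
  packet part the process is given only by its joint law of states and holding times. Time is dealt
  with once, by a renewal equation with a factorially small remainder; afterwards packets are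
  followed by the number of jumps since arrival, which turns waiting into linear equations for the
  jump chain, and holding times enter only through their means.\<close>

lemma ennreal_infsum_eq_nn_integral:
  fixes f :: "'a \<Rightarrow> real"
  assumes "\<And>x. 0 \<le> f x" and "(\<integral>\<^sup>+x. ennreal (f x) \<partial>count_space UNIV) < \<infinity>"
  shows "ennreal (\<Sum>\<^sub>\<infinity>x. f x) = (\<integral>\<^sup>+x. ennreal (f x) \<partial>count_space UNIV)"
proof -
  have i: "integrable (count_space UNIV) f"
    using assms by (intro integrableI_nonneg) auto
  then have a: "Infinite_Set_Sum.abs_summable_on f UNIV"
    by (simp add: Infinite_Set_Sum.abs_summable_on_def)
  then have "infsetsum f UNIV = infsum f UNIV"
    by (rule infsetsum_infsum)
  then show ?thesis
    using nn_integral_conv_infsetsum[OF a] assms(1) by auto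
qed

text \<open>The uniform bound \<open>L\<close> makes the total stationary flow finite and gives the
  factorial bound on the renewal remainder.\<close>

locale rate_matrix =
  fixes q :: "'s \<Rightarrow> 's \<Rightarrow> real" and L :: real
  assumes rate_nonneg: "0 \<le> q s s'"
    and finite_rates: "finite {s'. q s s' \<noteq> 0}"
    and exit_rate_pos: "0 < exit_rate q s"
    and exit_rate_le: "exit_rate q s \<le> L"
begin

lemma exit_rate_nonneg [simp]: "0 \<le> exit_rate q s"
  using exit_rate_pos[of s] by simp

lemma L_pos: "0 < L"
  using exit_rate_pos exit_rate_le less_le_trans by blast

lemma nn_integral_rate: "(\<integral>\<^sup>+s'. ennreal (q s s') \<partial>count_space UNIV) = ennreal (exit_rate q s)"
proof -
  have "(\<integral>\<^sup>+s'. ennreal (q s s') \<partial>count_space UNIV)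
      = (\<Sum>s'\<in>{s'. q s s' \<noteq> 0}. ennreal (q s s'))"
    using finite_rates rate_nonneg
    by (subst nn_integral_count_space'[where A="{s'. q s s' \<noteq> 0}"]) auto
  then have "(\<integral>\<^sup>+s'. ennreal (q s s') \<partial>count_space UNIV) < \<infinity>"
    using finite_rates by (simp add: sum_ennreal rate_nonneg)
  then show ?thesis
    unfolding exit_rate_def by (simp add: ennreal_infsum_eq_nn_integral rate_nonneg)
qed

lemma rate_le_exit_rate: "q s s' \<le> exit_rate q s"
proof -
  have "ennreal (q s s') = (\<integral>\<^sup>+t. ennreal (q s t) * indicator {s'} t \<partial>count_space UNIV)"
    by (simp add: nn_integral_indicator_singleton)
  also have "\<dots> \<le> (\<integral>\<^sup>+s'. ennreal (q s s') \<partial>count_space UNIV)"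
    by (intro nn_integral_mono) (auto split: split_indicator)
  finally show ?thesis
    unfolding nn_integral_rate by (simp add: ennreal_le_iff)
qed

lemma nn_integral_pmf_rate_finite:
  "(\<integral>\<^sup>+s. ennreal (pmf \<pi> s * q s s') \<partial>count_space UNIV) < \<infinity>"
proof -
  have "(\<integral>\<^sup>+s. ennreal (pmf \<pi> s * q s s') \<partial>count_space UNIV)
      \<le> (\<integral>\<^sup>+s. ennreal L * ennreal (pmf \<pi> s) \<partial>count_space UNIV)"
    using rate_nonneg rate_le_exit_rate exit_rate_le L_pos
    by (intro nn_integral_mono) (metis ennreal_leI ennreal_mult less_imp_le mult.commute mult_left_mono order_trans pmf_nonneg)
  also have "\<dots> = ennreal L"
    by (simp add: nn_integral_cmult nn_integral_pmf measure_pmf.emeasure_space_1[simplified])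
  also have "\<dots> < \<infinity>" by simp
  finally show ?thesis .
qed

text \<open>Balance is restated in \<open>ennreal\<close>, where Tonelli applies without summability
  conditions; bounded rates make the two forms equivalent.\<close>

lemma stationary_pmf_iff:
  "stationary_pmf q \<pi> \<longleftrightarrow>
     (\<forall>s'. (\<integral>\<^sup>+s. ennreal (pmf \<pi> s * q s s') \<partial>count_space UNIV) = ennreal (pmf \<pi> s' * exit_rate q s'))"
proof -
  have "(\<Sum>\<^sub>\<infinity>s. pmf \<pi> s * q s s') = pmf \<pi> s' * exit_rate q s' \<longleftrightarrow>
     (\<integral>\<^sup>+s. ennreal (pmf \<pi> s * q s s') \<partial>count_space UNIV) = ennreal (pmf \<pi> s' * exit_rate q s')" for s'
    using ennreal_infsum_eq_nn_integral[OF _ nn_integral_pmf_rate_finite[of \<pi> s']]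
    by (metis (no_types, lifting) ennreal_inj infsum_nonneg mult_nonneg_nonneg exit_rate_nonneg pmf_nonneg rate_nonneg)
  then show ?thesis
    unfolding stationary_pmf_def by auto
qed

text \<open>Tonelli exchanges the sums over source and target, so balance may be weighted by any
  nonnegative \<open>f\<close>, even one of infinite mean.\<close>

lemma stationary_nn_integral:
  fixes f :: "'s \<Rightarrow> ennreal"
  assumes "stationary_pmf q \<pi>"
  shows "(\<integral>\<^sup>+s. (\<integral>\<^sup>+s'. ennreal (q s s') * f s' \<partial>count_space UNIV) \<partial>measure_pmf \<pi>)
       = (\<integral>\<^sup>+s. ennreal (exit_rate q s) * f s \<partial>measure_pmf \<pi>)"
proof -
  have "(\<integral>\<^sup>+s. (\<integral>\<^sup>+s'. ennreal (q s s') * f s' \<partial>count_space UNIV) \<partial>measure_pmf \<pi>)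
     = (\<integral>\<^sup>+s. \<integral>\<^sup>+s'. ennreal (pmf \<pi> s * q s s') * f s' \<partial>count_space UNIV \<partial>count_space UNIV)"
    by (subst nn_integral_measure_pmf)
       (simp add: nn_integral_cmult[symmetric] ennreal_mult rate_nonneg mult.assoc)
  also have "\<dots> = (\<integral>\<^sup>+s'. \<integral>\<^sup>+s. ennreal (pmf \<pi> s * q s s') * f s' \<partial>count_space UNIV \<partial>count_space UNIV)"
    using nn_integral_fst_count_space[of "\<lambda>(s, s'). ennreal (pmf \<pi> s * q s s') * f s'"]
      nn_integral_snd_count_space[of "\<lambda>(s, s'). ennreal (pmf \<pi> s * q s s') * f s'"] by simp
  also have "\<dots> = (\<integral>\<^sup>+s'. ennreal (pmf \<pi> s' * exit_rate q s') * f s' \<partial>count_space UNIV)"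
    using assms by (simp add: nn_integral_multc stationary_pmf_iff)
  also have "\<dots> = (\<integral>\<^sup>+s. ennreal (exit_rate q s) * f s \<partial>measure_pmf \<pi>)"
    by (subst nn_integral_measure_pmf) (simp add: ennreal_mult mult.assoc)
  finally show ?thesis .
qed

text \<open>The pointwise minimum of two stationary laws is subinvariant, hence invariant because the total
  flows agree; so the excess of one law over the other is invariant as well, and the support of an
  invariant measure is closed under transitions.\<close>

lemma stationary_excess_closed:
  assumes \<pi>: "stationary_pmf q \<pi>" and \<pi>': "stationary_pmf q \<pi>'"
    and less: "pmf \<pi>' s < pmf \<pi> s" and q: "0 < q s s'"
  shows "pmf \<pi>' s' < pmf \<pi> s'"
proof -
  let ?w = "\<lambda>s. min (pmf \<pi> s) (pmf \<pi>' s)" and ?E = "exit_rate q"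
  define F where "F s' = (\<integral>\<^sup>+s. ennreal (?w s * q s s') \<partial>count_space UNIV)" for s'
  define G where "G s' = ennreal (?w s' * ?E s')" for s'
  have *: "F s' \<le> ennreal (pmf p s' * ?E s')"
    if "p = \<pi> \<or> p = \<pi>'" for p s'
  proof -
    have "F s' \<le> (\<integral>\<^sup>+s. ennreal (pmf p s * q s s') \<partial>count_space UNIV)"
      unfolding F_def using that by (intro nn_integral_mono ennreal_leI mult_right_mono rate_nonneg) auto
    then show ?thesis using that \<pi> \<pi>' by (auto simp: stationary_pmf_iff)
  qed
  have FG: "F s' \<le> G s'" for s'
    using *[of \<pi> s'] *[of \<pi>' s'] by (auto simp: G_def min_def)
  have "integral\<^sup>N (count_space UNIV) F
      = (\<integral>\<^sup>+s. \<integral>\<^sup>+s'. ennreal (?w s * q s s') \<partial>count_space UNIV \<partial>count_space UNIV)"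
    unfolding F_def
    using nn_integral_fst_count_space[of "\<lambda>(s, s'). ennreal (?w s * q s s')"]
      nn_integral_snd_count_space[of "\<lambda>(s, s'). ennreal (?w s * q s s')"] by simp
  also have "\<dots> = integral\<^sup>N (count_space UNIV) G"
    by (intro nn_integral_cong) (simp add: G_def ennreal_mult rate_nonneg nn_integral_cmult nn_integral_rate)
  finally have eq: "integral\<^sup>N (count_space UNIV) F = integral\<^sup>N (count_space UNIV) G" .
  have "integral\<^sup>N (count_space UNIV) G \<le> (\<integral>\<^sup>+s. ennreal L * ennreal (pmf \<pi> s) \<partial>count_space UNIV)"
    unfolding G_def
  proof (intro nn_integral_mono)
    fix s
    have "?w s * ?E s \<le> pmf \<pi> s * L"
      using exit_rate_le by (intro mult_mono) auto
    then show "ennreal (?w s * ?E s) \<le> ennreal L * ennreal (pmf \<pi> s)"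
      using L_pos by (simp add: ennreal_mult[symmetric] mult.commute ennreal_leI)
  qed
  also have "\<dots> = ennreal L"
    by (simp add: nn_integral_cmult nn_integral_pmf measure_pmf.emeasure_space_1[simplified])
  finally have fin: "integral\<^sup>N (count_space UNIV) F \<noteq> \<infinity>"
    using eq by (auto simp: top_unique)
  have "AE s in count_space UNIV. G s \<le> F s"
    using nn_integral_less[OF _ _ fin, of G] FG eq by auto
  then have GF: "G s = F s" for s
    using FG by (auto simp: AE_count_space intro: antisym)
  \<comment> \<open>The flow into \<open>s'\<close> under the minimum misses a positive part of the
    flow from \<open>s\<close>, and no other term is larger. Invariance of the minimum then makes it
    strictly smaller than \<open>pmf \<pi>\<close> at \<open>s'\<close>.\<close>
  have "F s' < ennreal (pmf \<pi> s' * ?E s')"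
  proof -
    have "F s' < (\<integral>\<^sup>+s. ennreal (pmf \<pi> s * q s s') \<partial>count_space UNIV)"
      unfolding F_def
    proof (rule nn_integral_less)
      show "(\<integral>\<^sup>+s. ennreal (?w s * q s s') \<partial>count_space UNIV) \<noteq> \<infinity>"
        using FG[of s'] by (auto simp: F_def[symmetric] G_def top_unique)
      show "AE x in count_space UNIV. ennreal (?w x * q x s') \<le> ennreal (pmf \<pi> x * q x s')"
        by (auto simp: AE_count_space intro!: ennreal_leI mult_right_mono rate_nonneg)
      have "\<not> ennreal (pmf \<pi> s * q s s') \<le> ennreal (?w s * q s s')"
        using less q by (simp add: ennreal_le_iff)
      then show "\<not> (AE x in count_space UNIV. ennreal (pmf \<pi> x * q x s') \<le> ennreal (?w x * q x s'))"
        by (auto simp: AE_count_space)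
    qed auto
    then show ?thesis using \<pi> by (simp add: stationary_pmf_iff)
  qed
  then have "?w s' * ?E s' < pmf \<pi> s' * ?E s'"
    by (simp add: GF[symmetric] G_def ennreal_less_iff)
  then have "?w s' < pmf \<pi> s'" using exit_rate_pos[of s'] by simp
  then show ?thesis by (auto simp: min_def split: if_splits)
qed

text \<open>A strict excess of one law over the other travels along positive rates to the common
  state \<open>s0\<close>. Excesses in both directions would contradict each other there, so one law
  dominates, and equal total mass forces equality.\<close>

lemma stationary_pmf_unique:
  assumes \<pi>: "stationary_pmf q \<pi>" "set_pmf \<pi> \<subseteq> S" and \<pi>': "stationary_pmf q \<pi>'" "set_pmf \<pi>' \<subseteq> S"
    and reach: "\<And>s. s \<in> S \<Longrightarrow> (\<lambda>s s'. 0 < q s s')\<^sup>*\<^sup>* s s0"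
  shows "\<pi> = \<pi>'"
proof -
  have reaches: "pmf b s0 < pmf a s0"
    if a: "stationary_pmf q a" "set_pmf a \<subseteq> S" and b: "stationary_pmf q b" and less: "pmf b s < pmf a s"
    for a b s
  proof -
    have "0 < pmf a s" by (rule le_less_trans[OF _ less]) simp
    then have "s \<in> S" using a(2) by (auto simp: pmf_positive_iff)
    from reach[OF this] show ?thesis
      using less
    proof (induction rule: rtranclp_induct)
      case (step y z)
      then show ?case using stationary_excess_closed[OF a(1) b] by blast
    qed
  qed
  have "\<not> (pmf \<pi>' s < pmf \<pi> s \<and> pmf \<pi> t < pmf \<pi>' t)" for s t
    using reaches[of \<pi> \<pi>' s] reaches[of \<pi>' \<pi> t] assms by force
  then consider "\<forall>s. pmf \<pi> s \<le> pmf \<pi>' s" | "\<forall>s. pmf \<pi>' s \<le> pmf \<pi> s"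
    by (meson not_le)
  moreover have dom: "a = b" if le: "\<forall>s. pmf a s \<le> pmf b s" for a b :: "'s pmf"
  proof -
    have "AE s in count_space UNIV. ennreal (pmf b s) \<le> ennreal (pmf a s)"
    proof (rule ccontr)
      assume "\<not> ?thesis"
      then have "(\<integral>\<^sup>+s. ennreal (pmf a s) \<partial>count_space UNIV) < (\<integral>\<^sup>+s. ennreal (pmf b s) \<partial>count_space UNIV)"
        using le by (intro nn_integral_less) (auto simp: nn_integral_pmf)
      then show False
        by (simp add: nn_integral_pmf measure_pmf.emeasure_space_1[simplified])
    qed
    then show ?thesis using le by (intro pmf_eqI antisym) (auto simp: AE_count_space)
  qed
  ultimately show ?thesis by (metis dom)
qed

end

section \<open>The network at stationarity\<close>

lemma nodes_eq_Sigma: "nodes n = (SIGMA c:UNIV. {..<n c})"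
  by (auto simp: nodes_def)

lemma finite_nodes [simp]: "finite (nodes (n :: 'c::finite \<Rightarrow> nat))"
  by (simp add: nodes_eq_Sigma)

lemma sum_nodes: "(\<Sum>v\<in>nodes (n :: 'c::finite \<Rightarrow> nat). g v) = (\<Sum>c\<in>UNIV. \<Sum>j<n c. g (c, j))"
  by (simp add: nodes_eq_Sigma sum.Sigma split_def)

locale network_rates =
  fixes n :: "'c::finite \<Rightarrow> nat" and lam mu nu :: "'c \<Rightarrow> real"
  assumes lam_pos: "0 < lam d" and mu_pos: "0 < mu d" and nu_pos: "0 < nu d"
    and n_ge_1: "1 \<le> n d"
begin

abbreviation q :: "'c state \<Rightarrow> 'c state \<Rightarrow> real" where
  "q \<equiv> network_rate n lam mu nu"

definition arr :: "'c node \<Rightarrow> real" where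
  "arr v = lam (fst v) / real (n (fst v))"

definition bk :: "'c node \<Rightarrow> real" where
  "bk v = nu (fst v) / real (n (fst v))"

lemma n_pos: "0 < n d"
  using n_ge_1[of d] by linarith

lemma arr_pos: "0 < arr v" and bk_pos: "0 < bk v"
  using lam_pos nu_pos n_pos by (auto simp: arr_def bk_def)

lemmas rates_ge_0 = less_imp_le[OF lam_pos] less_imp_le[OF mu_pos] less_imp_le[OF nu_pos]
  less_imp_le[OF arr_pos] less_imp_le[OF bk_pos]

lemma sum_arr: "(\<Sum>v\<in>nodes n. arr v * g (fst v)) = (\<Sum>c\<in>UNIV. lam c * g c)"
  unfolding sum_nodes using n_pos by (simp add: arr_def)

lemma sum_bk: "(\<Sum>v\<in>nodes n. bk v * g (fst v)) = (\<Sum>c\<in>UNIV. nu c * g c)"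
  unfolding sum_nodes using n_pos by (simp add: bk_def)

lemma sum_arr_1: "(\<Sum>v\<in>nodes n. arr v) = (\<Sum>c\<in>UNIV. lam c)"
  using sum_arr[of "\<lambda>_. 1"] by simp

lemma sum_bk_1: "(\<Sum>v\<in>nodes n. bk v) = (\<Sum>c\<in>UNIV. nu c)"
  using sum_bk[of "\<lambda>_. 1"] by simp

text \<open>The scalar action \<open>m\<close> is a parameter so that one formula serves in
  \<open>ennreal\<close>, where integrals commute freely, and in \<open>real\<close>, where
  differences and hence the generator make sense.\<close>

definition kernel_sum :: "('c state \<Rightarrow> 'd::comm_monoid_add) \<Rightarrow> (real \<Rightarrow> 'd \<Rightarrow> 'd) \<Rightarrow> 'c state \<Rightarrow> 'd" where
  "kernel_sum F m = (\<lambda>(x, a).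
     (\<Sum>v\<in>nodes n. m (arr v) (F (x(v := x v + 1), a))) +
     (\<Sum>v\<in>nodes n. if a = None \<and> 0 < x v then m (bk v) (F (x(v := x v - 1), Some (fst v))) else 0) +
     (\<Sum>c\<in>UNIV. if a = Some c then m (mu c) (F (x, None)) else 0))"

lemma network_rate_eq:
  "q (x, a) s' =
     (\<Sum>v\<in>nodes n. arr v * indicator {(x(v := x v + 1), a)} s') +
     (\<Sum>v\<in>nodes n. (if a = None \<and> 0 < x v then bk v else 0) * indicator {(x(v := x v - 1), Some (fst v))} s') +
     (\<Sum>c\<in>UNIV. (if a = Some c then mu c else 0) * indicator {(x, None)} s')"
proof (cases s')
  case (Pair x' a')
  show ?thesis
    unfolding network_rate_def arr_def bk_def Pair prod.case
    by (intro arg_cong2[where f="(+)"] sum.cong refl) (auto simp: indicator_def)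
qed

lemma q_nonneg: "0 \<le> q s s'"
  by (cases s; cases s') (auto simp: network_rate_def intro!: add_nonneg_nonneg sum_nonneg rates_ge_0 divide_nonneg_nonneg)

lemma ennreal_sum_indicator_mult:
  assumes "\<And>v. v \<in> A \<Longrightarrow> 0 \<le> r v"
  shows "ennreal (\<Sum>v\<in>A. r v * indicator {t v} s) * F s = (\<Sum>v\<in>A. ennreal (r v) * F s * indicator {t v} s)"
proof -
  have "ennreal (\<Sum>v\<in>A. r v * indicator {t v} s) = (\<Sum>v\<in>A. ennreal (r v * indicator {t v} s))"
    using assms by (intro sum_ennreal[symmetric]) auto
  also have "\<dots> = (\<Sum>v\<in>A. ennreal (r v) * indicator {t v} s)"
    using assms by (intro sum.cong refl) (auto simp: indicator_def)
  finally show ?thesis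
    by (simp only: sum_distrib_right) (auto intro!: sum.cong simp: ac_simps)
qed

lemma nn_integral_rate_mult:
  "(\<integral>\<^sup>+s'. ennreal (q s s') * F s' \<partial>count_space UNIV) = kernel_sum F (\<lambda>r. (*) (ennreal r)) s"
proof (cases s)
  case (Pair x a)
  have "ennreal (q s s') * F s' =
     (\<Sum>v\<in>nodes n. (ennreal (arr v) * F s') * indicator {(x(v := x v + 1), a)} s') +
     (\<Sum>v\<in>nodes n. (ennreal (if a = None \<and> 0 < x v then bk v else 0) * F s') * indicator {(x(v := x v - 1), Some (fst v))} s') +
     (\<Sum>c\<in>UNIV. (ennreal (if a = Some c then mu c else 0) * F s') * indicator {(x, None)} s')" for s'
    unfolding Pair network_rate_eq
    by (subst ennreal_plus ennreal_plus, (auto intro!: add_nonneg_nonneg sum_nonneg mult_nonneg_nonneg simp: rates_ge_0)[2])+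
       (simp only: distrib_right, intro arg_cong2[where f="(+)"] ennreal_sum_indicator_mult; simp add: rates_ge_0)
  then have "(\<integral>\<^sup>+s'. ennreal (q s s') * F s' \<partial>count_space UNIV) = 
     (\<Sum>v\<in>nodes n. ennreal (arr v) * F (x(v := x v + 1), a)) +
     (\<Sum>v\<in>nodes n. ennreal (if a = None \<and> 0 < x v then bk v else 0) * F (x(v := x v - 1), Some (fst v))) +
     (\<Sum>c\<in>UNIV. ennreal (if a = Some c then mu c else 0) * F (x, None))"
    by (simp add: nn_integral_add nn_integral_sum nn_integral_indicator_singleton
        del: sum_mult_indicator sum_indicator_mult)
  also have "\<dots> = kernel_sum F (\<lambda>r. (*) (ennreal r)) s"
    unfolding Pair kernel_sum_def by (auto intro!: arg_cong2[where f="(+)"] sum.cong)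
  finally show ?thesis .
qed

definition total_rate :: real where
  "total_rate = (\<Sum>c\<in>UNIV. lam c) + (\<Sum>c\<in>UNIV. nu c) + (\<Sum>c\<in>UNIV. mu c)"

lemma kernel_sum_ennreal:
  assumes "\<And>s. 0 \<le> f s"
  shows "kernel_sum (\<lambda>s. ennreal (f s)) (\<lambda>r. (*) (ennreal r)) s = ennreal (kernel_sum f (*) s)"
  using assms unfolding kernel_sum_def
  by (cases s) (auto simp: ennreal_mult rates_ge_0 sum_nonneg ennreal_plus sum_ennreal[symmetric] 
      simp del: sum_ennreal intro!: arg_cong2[where f="(+)"] sum.cong)

lemma kernel_sum_nonneg: "(\<And>s. 0 \<le> f s) \<Longrightarrow> 0 \<le> kernel_sum f (*) s"
  unfolding kernel_sum_def by (cases s) (auto intro!: add_nonneg_nonneg sum_nonneg mult_nonneg_nonneg rates_ge_0)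

lemma kernel_sum_mono:
  assumes "\<And>s. f s \<le> g s"
  shows "kernel_sum f (*) s \<le> kernel_sum g (*) s"
  unfolding kernel_sum_def by (cases s) (auto intro!: add_mono sum_mono mult_left_mono rates_ge_0 assms)

lemma kernel_sum_1_le: "kernel_sum (\<lambda>_. 1) (*) s \<le> total_rate"
  unfolding kernel_sum_def total_rate_def sum_arr_1[symmetric] sum_bk_1[symmetric]
  by (cases s) (auto intro!: add_mono sum_mono rates_ge_0)

lemma kernel_sum_1_pos: "0 < kernel_sum (\<lambda>_. 1) (*) s"
proof -
  have "0 < (\<Sum>v\<in>nodes n. arr v)"
    unfolding sum_arr_1 by (intro sum_pos lam_pos) auto
  then show ?thesis
    unfolding kernel_sum_def
    by (cases s) (auto intro!: add_pos_nonneg sum_nonneg rates_ge_0)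
qed

lemma exit_rate_q: "exit_rate q s = kernel_sum (\<lambda>_. 1) (*) s"
proof -
  have "(\<integral>\<^sup>+s'. ennreal (q s s') \<partial>count_space UNIV) = ennreal (kernel_sum (\<lambda>_. 1) (*) s)"
    using nn_integral_rate_mult[of s "\<lambda>_. 1"] kernel_sum_ennreal[of "\<lambda>_. 1" s] by simp
  then show ?thesis
    using ennreal_infsum_eq_nn_integral[of "q s"] q_nonneg kernel_sum_nonneg[of "\<lambda>_. 1" s]
    unfolding exit_rate_def by (simp add: infsum_nonneg)
qed

sublocale rate_matrix q total_rate
proof
  show "finite {s'. q s s' \<noteq> 0}" for s
  proof (cases s)
    case (Pair x a)
    have "{s'. q s s' \<noteq> 0} \<subseteq> (\<lambda>v. (x(v := x v + 1), a)) ` nodes n \<union>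
       (\<lambda>v. (x(v := x v - 1), Some (fst v))) ` nodes n \<union> {(x, None)}"
    proof
      fix s' assume "s' \<in> {s'. q s s' \<noteq> 0}"
      then have "q s s' \<noteq> 0" by simp
      show "s' \<in> (\<lambda>v. (x(v := x v + 1), a)) ` nodes n \<union>
       (\<lambda>v. (x(v := x v - 1), Some (fst v))) ` nodes n \<union> {(x, None)}" (is "_ \<in> ?A")
      proof (rule ccontr)
        assume "s' \<notin> ?A"
        then have "(\<Sum>v\<in>nodes n. arr v * indicator {(x(v := x v + 1), a)} s') = 0 \<and>
          (\<Sum>v\<in>nodes n. (if a = None \<and> 0 < x v then bk v else 0) * indicator {(x(v := x v - 1), Some (fst v))} s') = 0 \<and>
          (\<Sum>c\<in>UNIV. (if a = Some c then mu c else 0) * indicator {(x, None)} s') = 0"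
          by (intro conjI sum.neutral) (auto simp: indicator_def)
        then have "q s s' = 0" unfolding Pair network_rate_eq by linarith
        then show False using \<open>q s s' \<noteq> 0\<close> by simp
      qed
    qed
    then show ?thesis by (rule finite_subset) auto
  qed
qed (auto simp: q_nonneg exit_rate_q kernel_sum_1_pos kernel_sum_1_le)

section \<open>Generator of the network and test functions\<close>

definition gen :: "('c state \<Rightarrow> real) \<Rightarrow> 'c state \<Rightarrow> real" where
  "gen f s = kernel_sum (\<lambda>s'. f s' - f s) (*) s"

lemma gen_eq: "gen f s = kernel_sum f (*) s - exit_rate q s * f s"
proof -
  obtain x a where s: "s = (x, a)" by fastforce
  have *: "(if P then m * (u - w) else 0) = (if P then m * u else 0) - (if P then m * 1 else 0) * w" for P and m u w :: real
    by (simp add: algebra_simps)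
  show ?thesis
    unfolding gen_def exit_rate_q kernel_sum_def s prod.case * sum_subtractf sum_distrib_right[symmetric]
    by (simp add: algebra_simps sum_subtractf sum_distrib_left)
qed

lemma abs_kernel_sum_le:
  assumes "\<And>s. \<bar>f s\<bar> \<le> B"
  shows "\<bar>kernel_sum f (*) s\<bar> \<le> total_rate * B"
proof -
  have B: "0 \<le> B" using assms[of undefined] by linarith
  have c: "kernel_sum (\<lambda>_. b) (*) s = b * kernel_sum (\<lambda>_. 1) (*) s" for b
    unfolding kernel_sum_def by (cases s) (simp add: algebra_simps sum_distrib_left if_distrib cong: if_cong)
  have "kernel_sum f (*) s \<le> B * kernel_sum (\<lambda>_. 1) (*) s"
    unfolding c[symmetric] using assms by (intro kernel_sum_mono) (meson abs_le_D1)
  moreover have "- B * kernel_sum (\<lambda>_. 1) (*) s \<le> kernel_sum f (*) s"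
    unfolding c[symmetric] using assms by (intro kernel_sum_mono) (meson abs_le_iff minus_le_iff)
  moreover have "B * kernel_sum (\<lambda>_. 1) (*) s \<le> B * total_rate"
    using B kernel_sum_1_le by (intro mult_left_mono)
  ultimately show ?thesis by (simp add: abs_le_iff mult.commute)
qed

lemma abs_gen_le:
  assumes "\<And>s. \<bar>f s\<bar> \<le> B"
  shows "\<bar>gen f s\<bar> \<le> 2 * total_rate * B"
proof -
  have "\<bar>exit_rate q s * f s\<bar> \<le> total_rate * B"
    using assms[of s] exit_rate_le[of s] L_pos by (auto simp: abs_mult intro!: mult_mono)
  then show ?thesis using abs_kernel_sum_le[of f B s, OF assms] unfolding gen_eq by linarith
qed

text \<open>Adding the bound \<open>B\<close> makes the test function nonnegative without changing
  its generator. Both sides of the integrated balance equation are then finite, and their difference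
  is the expected generator.\<close>

lemma expectation_gen:
  assumes \<pi>: "stationary_pmf q \<pi>" and B: "\<And>s. \<bar>f s\<bar> \<le> B"
  shows "measure_pmf.expectation \<pi> (gen f) = 0"
proof -
  let ?f = "\<lambda>s. f s + B"
  have f: "0 \<le> ?f s" "?f s \<le> 2 * B" for s using B[of s] by linarith+
  have [simp]: "integrable (measure_pmf \<pi>) (kernel_sum ?f (*))"
    using abs_kernel_sum_le[of ?f "2 * B"] f
    by (intro measure_pmf.integrable_const_bound[where B="total_rate * (2 * B)"]) auto
  have [simp]: "integrable (measure_pmf \<pi>) (\<lambda>s. exit_rate q s * ?f s)"
  proof (intro measure_pmf.integrable_const_bound[where B="total_rate * (2 * B)"] AE_pmfI)
    fix s show "norm (exit_rate q s * ?f s) \<le> total_rate * (2 * B)"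
      using f[of s] exit_rate_le[of s] L_pos by (auto simp: abs_mult intro!: mult_mono)
  qed auto
  have "ennreal (measure_pmf.expectation \<pi> (kernel_sum ?f (*))) = (\<integral>\<^sup>+s. ennreal (kernel_sum ?f (*) s) \<partial>measure_pmf \<pi>)"
    using f by (intro nn_integral_eq_integral[symmetric]) (auto intro!: kernel_sum_nonneg)
  also have "\<dots> = (\<integral>\<^sup>+s. (\<integral>\<^sup>+s'. ennreal (q s s') * ennreal (?f s') \<partial>count_space UNIV) \<partial>measure_pmf \<pi>)"
    using f by (simp add: nn_integral_rate_mult kernel_sum_ennreal)
  also have "\<dots> = (\<integral>\<^sup>+s. ennreal (exit_rate q s * ?f s) \<partial>measure_pmf \<pi>)"
    using f unfolding stationary_nn_integral[OF \<pi>] by (simp add: ennreal_mult)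
  also have "\<dots> = ennreal (measure_pmf.expectation \<pi> (\<lambda>s. exit_rate q s * ?f s))"
    using f by (intro nn_integral_eq_integral) auto
  finally have "measure_pmf.expectation \<pi> (kernel_sum ?f (*)) = measure_pmf.expectation \<pi> (\<lambda>s. exit_rate q s * ?f s)"
    using f by (subst (asm) ennreal_inj) (auto intro!: Bochner_Integration.integral_nonneg kernel_sum_nonneg)
  moreover have "gen f = gen ?f" unfolding gen_def by simp
  ultimately show ?thesis by (simp add: gen_eq[abs_def])
qed

end

locale stationary_network = network_rates n lam mu nu
  for n :: "'c::finite \<Rightarrow> nat" and lam mu nu :: "'c \<Rightarrow> real" +
  fixes \<pi> :: "'c state pmf"
  assumes stationary: "stationary_pmf q \<pi>"
    and support: "set_pmf \<pi> \<subseteq> network_states n"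
    and stability: "Max (range (\<lambda>d. lam d / nu d)) < 1 - (\<Sum>d\<in>UNIV. lam d / mu d)"

context network_rates
begin

lemmas [simp del] = sum_of_bool_eq sum_mult_of_bool_eq sum_of_bool_mult_eq

lemma gen_apply:
  "gen f (x, a) =
     (\<Sum>v\<in>nodes n. arr v * (f (x(v := x v + 1), a) - f (x, a))) +
     (\<Sum>v\<in>nodes n. if a = None \<and> 0 < x v then bk v * (f (x(v := x v - 1), Some (fst v)) - f (x, a)) else 0) +
     (\<Sum>c\<in>UNIV. if a = Some c then mu c * (f (x, None) - f (x, a)) else 0)"
  unfolding gen_def kernel_sum_def by simp

text \<open>Where \<open>f\<close> exceeds \<open>M\<close>, the truncated function sits at its
  maximum and no jump can raise it; elsewhere truncation only reduces increments. This transfers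
  drift bounds of unbounded functions to bounded ones.\<close>

lemma gen_min_le: "gen (\<lambda>s. min (f s) M) s \<le> of_bool (f s \<le> M) * gen f s"
proof (cases "f s \<le> M")
  case True
  then show ?thesis unfolding gen_def by (auto intro!: kernel_sum_mono)
next
  case False
  then have "gen (\<lambda>s. min (f s) M) s \<le> kernel_sum (\<lambda>_. 0) (*) s"
    unfolding gen_def by (intro kernel_sum_mono) auto
  also have "\<dots> = 0" unfolding kernel_sum_def by (cases s) (simp cong: if_cong)
  finally show ?thesis using False by simp
qed

lemma rate_start: "v \<in> nodes n \<Longrightarrow> 0 < x v \<Longrightarrow> 0 < q (x, None) (x(v := x v - 1), Some (fst v))"
  unfolding network_rate_eq
  by (intro add_pos_nonneg add_nonneg_pos sum_nonneg sum_pos2[where i=v and I="nodes n"]) (auto simp: rates_ge_0 bk_pos)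

lemma rate_completion: "0 < q (x, Some c) (x, None)"
  unfolding network_rate_eq
  by (intro add_nonneg_pos add_nonneg_nonneg sum_nonneg sum_pos2[where i=c and I=UNIV]) (auto simp: rates_ge_0 mu_pos)

text \<open>Finishing the current transmission and then repeatedly starting and finishing one drains
  all queues at positive rates. The idle empty state is thus the common target needed for
  uniqueness.\<close>

lemma reaches_empty:
  assumes "s \<in> network_states n"
  shows "(\<lambda>s s'. 0 < q s s')\<^sup>*\<^sup>* s (\<lambda>_. 0, None)"
proof -
  have *: "(\<lambda>s s'. 0 < q s s')\<^sup>*\<^sup>* (x, None) (\<lambda>_. 0, None)"
    if "\<forall>v. v \<notin> nodes n \<longrightarrow> x v = 0" "(\<Sum>v\<in>nodes n. x v) = N" for x N
    using that
  proof (induction N arbitrary: x)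
    case 0
    then have "x v = 0" for v by (metis finite_nodes sum_eq_0_iff)
    then have "x = (\<lambda>_. 0)" by (simp add: fun_eq_iff)
    then show ?case by simp
  next
    case (Suc N)
    then obtain v where v: "v \<in> nodes n" "0 < x v"
      by (metis nat.discI neq0_conv sum.neutral)
    let ?x = "x(v := x v - 1)"
    have "(\<Sum>u\<in>nodes n. ?x u) = N"
      using Suc.prems(2) v by (simp add: sum.remove[of _ v])
    then have "(\<lambda>s s'. 0 < q s s')\<^sup>*\<^sup>* (?x, None) (\<lambda>_. 0, None)"
      using Suc v by auto
    then show ?case
      using rate_start[of v x, OF v] rate_completion[of ?x "fst v"]
      by (meson converse_rtranclp_into_rtranclp)
  qed
  obtain x a where s: "s = (x, a)" by fastforce
  then have x: "\<forall>v. v \<notin> nodes n \<longrightarrow> x v = 0" using assms by (auto simp: network_states_def)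
  show ?thesis
  proof (cases a)
    case None
    then show ?thesis using * x s by blast
  next
    case (Some c)
    then show ?thesis using rate_completion[of x c] *[OF x refl] s
      by (metis converse_rtranclp_into_rtranclp)
  qed
qed

lemma rate_permute:
  assumes \<tau>: "bij_betw \<tau> (nodes n) (nodes n)" "bij \<tau>" "\<And>v. fst (\<tau> v) = fst v"
  shows "q (x \<circ> \<tau>, a) (x' \<circ> \<tau>, a') = q (x, a) (x', a')"
proof -
  have upd: "(x' \<circ> \<tau> = (x \<circ> \<tau>)(v := y)) = (x' = x(\<tau> v := y))" for v y
  proof -
    have "(x \<circ> \<tau>)(v := y) = x(\<tau> v := y) \<circ> \<tau>"
      using \<tau>(2) by (auto simp: fun_eq_iff bij_def inj_eq)
    moreover have "(x' \<circ> \<tau> = x(\<tau> v := y) \<circ> \<tau>) = (x' = x(\<tau> v := y))"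
      using \<tau>(2) by (metis bij_is_surj surj_fun_eq fun.map_cong surj_def comp_apply ext)
    ultimately show ?thesis by simp
  qed
  have re: "(\<Sum>v\<in>nodes n. g (\<tau> v)) = (\<Sum>v\<in>nodes n. g v)" for g :: "'c node \<Rightarrow> real"
    using \<tau>(1) by (rule sum.reindex_bij_betw)
  have c: "(x' \<circ> \<tau> = x \<circ> \<tau>) = (x' = x)"
    using \<tau>(2) by (metis bij_is_surj comp_apply ext surj_def)
  show ?thesis
    unfolding network_rate_def prod.case upd c
    using re[of "\<lambda>v. if x' = x(v := x v + 1) \<and> a' = a then lam (fst v) / real (n (fst v)) else 0"]
     re[of "\<lambda>v. if a = None \<and> 0 < x v \<and> x' = x(v := x v - 1) \<and> a' = Some (fst v)
                     then nu (fst v) / real (n (fst v)) else 0"]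
    by (simp add: \<tau>(3) cong: if_cong)
qed

end

section \<open>Exact stationary identities and averaging of the activity\<close>

context stationary_network
begin

lemmas [simp del] = sum_of_bool_eq sum_mult_of_bool_eq sum_of_bool_mult_eq

abbreviation E :: "('c state \<Rightarrow> real) \<Rightarrow> real" where
  "E \<equiv> measure_pmf.expectation \<pi>"

definition rho :: real where "rho = (\<Sum>d\<in>UNIV. lam d / mu d)"

lemma integrable_bounded: "(\<And>s. \<bar>f s\<bar> \<le> B) \<Longrightarrow> integrable (measure_pmf \<pi>) f" for f :: "'c state \<Rightarrow> real"
  by (intro measure_pmf.integrable_const_bound[where B=B]) auto

lemma integrable_of_bool [simp]: "integrable (measure_pmf \<pi>) (\<lambda>s. of_bool (P s) :: real)"
  by (intro integrable_bounded[where B=1]) auto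

lemma integrable_of_bool_mult: "(\<And>s. \<bar>f s\<bar> \<le> B) \<Longrightarrow> integrable (measure_pmf \<pi>) (\<lambda>s. of_bool (P s) * f s)"
  for f :: "'c state \<Rightarrow> real"
  by (intro integrable_bounded[where B=B]) (auto simp: abs_mult intro: order_trans[OF abs_ge_zero])

lemma load_less: "lam d / nu d < 1 - rho"
proof -
  have "lam d / nu d \<le> Max (range (\<lambda>d. lam d / nu d))" by (intro Max_ge) auto
  then show ?thesis using stability by (simp add: rho_def)
qed

lemma rho_pos: "0 < rho"
  unfolding rho_def by (intro sum_pos) (auto simp: lam_pos mu_pos)

lemma rho_less_1: "rho < 1"
  using load_less[of undefined] lam_pos[of undefined] nu_pos[of undefined]
  by (smt (verit) divide_nonneg_pos)

text \<open>Cut equation between queue lengths \<open>k\<close> and \<open>Suc k\<close>: the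
  indicator of \<open>Suc k \<le> fst s v\<close> rises only by an arrival and falls only by a
  start, which needs an idle network.\<close>

lemma expectation_queue_Suc_idle:
  assumes v: "v \<in> nodes n"
  shows "nu (fst v) * E (\<lambda>s. of_bool (fst s v = Suc k \<and> snd s = None)) = lam (fst v) * E (\<lambda>s. of_bool (fst s v = k))"
proof -
  let ?f = "\<lambda>s. of_bool (Suc k \<le> fst s v) :: real"
  have g: "gen ?f s = arr v * of_bool (fst s v = k) - bk v * of_bool (fst s v = Suc k \<and> snd s = None)" for s
  proof -
    obtain x a where s: "s = (x, a)" by fastforce
    have "gen ?f (x, a) = (\<Sum>u\<in>nodes n. if u = v then arr v * of_bool (x v = k) else 0)
       + (\<Sum>u\<in>nodes n. if u = v then - bk v * of_bool (x v = Suc k \<and> a = None) else 0) + 0"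
      unfolding gen_apply by (intro arg_cong2[where f="(+)"] sum.cong sum.neutral) auto
    then show ?thesis using v by (simp add: s)
  qed
  have "E (\<lambda>s. arr v * of_bool (fst s v = k) - bk v * of_bool (fst s v = Suc k \<and> snd s = None)) = 0"
    using expectation_gen[OF stationary, of ?f 1] by (simp add: g[abs_def])
  then have "arr v * E (\<lambda>s. of_bool (fst s v = k)) = bk v * E (\<lambda>s. of_bool (fst s v = Suc k \<and> snd s = None))"
    by simp
  then show ?thesis using n_pos[of "fst v"] by (simp add: arr_def bk_def field_simps)
qed

text \<open>Throughput balance, from the queue length cut off at \<open>K\<close> so that the test
  function is bounded. Dominated convergence of probabilities removes the cutoff without any moment
  of the queue.\<close>

lemma expectation_nonempty_idle:
  assumes v: "v \<in> nodes n"
  shows "E (\<lambda>s. of_bool (0 < fst s v \<and> snd s = None)) = lam (fst v) / nu (fst v)"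
proof -
  let ?f = "\<lambda>K s. real (min (fst s v) K)"
  have g: "gen (?f K) s = arr v * of_bool (fst s v < K) - bk v * of_bool (0 < fst s v \<and> fst s v \<le> K \<and> snd s = None)" for K s
  proof -
    obtain x a where s: "s = (x, a)" by fastforce
    have "gen (?f K) (x, a) = (\<Sum>u\<in>nodes n. if u = v then arr v * of_bool (x v < K) else 0)
       + (\<Sum>u\<in>nodes n. if u = v then - bk v * of_bool (0 < x v \<and> x v \<le> K \<and> a = None) else 0) + 0"
      unfolding gen_apply by (intro arg_cong2[where f="(+)"] sum.cong sum.neutral) (auto simp: min_def)
    then show ?thesis using v by (simp add: s)
  qed
  have "arr v * E (\<lambda>s. of_bool (fst s v < K)) = bk v * E (\<lambda>s. of_bool (0 < fst s v \<and> fst s v \<le> K \<and> snd s = None))" for K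
    using expectation_gen[OF stationary, of "?f K" "real K"] g by (simp add: g[abs_def])
  moreover have "(\<lambda>K. of_bool (m < K) :: real) \<longlonglongrightarrow> 1" for m :: nat
    by (rule tendsto_eventually) (auto intro: eventually_mono[OF eventually_gt_at_top[of m]])
  then have "(\<lambda>K. arr v * E (\<lambda>s. of_bool (fst s v < K))) \<longlonglongrightarrow> arr v * E (\<lambda>s. 1)"
    by (intro tendsto_intros integral_dominated_convergence[where w="\<lambda>_. 1"]) auto
  moreover have "(\<lambda>K. of_bool (0 < m \<and> m \<le> K \<and> Q) :: real) \<longlonglongrightarrow> of_bool (0 < m \<and> Q)" for m :: nat and Q
    by (rule tendsto_eventually) (auto intro: eventually_mono[OF eventually_ge_at_top[of m]])
  then have "(\<lambda>K. bk v * E (\<lambda>s. of_bool (0 < fst s v \<and> fst s v \<le> K \<and> snd s = None)))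
      \<longlonglongrightarrow> bk v * E (\<lambda>s. of_bool (0 < fst s v \<and> snd s = None))"
    by (intro tendsto_intros integral_dominated_convergence[where w="\<lambda>_. 1"]) auto
  ultimately have "arr v * E (\<lambda>s. 1) = bk v * E (\<lambda>s. of_bool (0 < fst s v \<and> snd s = None))"
    using LIMSEQ_unique by fastforce
  then show ?thesis using n_pos[of "fst v"] nu_pos[of "fst v"] by (simp add: arr_def bk_def field_simps)
qed

lemma expectation_active: "E (\<lambda>s. of_bool (snd s = Some d)) = lam d / mu d"
proof -
  let ?f = "\<lambda>s. of_bool (snd s = Some d) :: real"
  have g: "gen ?f s = (\<Sum>v\<in>nodes n. bk v * of_bool (fst v = d) * of_bool (0 < fst s v \<and> snd s = None)) - mu d * of_bool (snd s = Some d)" for s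
  proof -
    obtain x a where s: "s = (x, a)" by fastforce
    have "gen ?f (x, a) = 0 + (\<Sum>v\<in>nodes n. bk v * of_bool (fst v = d) * of_bool (0 < x v \<and> a = None))
      + (\<Sum>c\<in>UNIV. if c = d then - mu d * of_bool (a = Some d) else 0)"
      unfolding gen_apply by (intro arg_cong2[where f="(+)"] sum.cong sum.neutral) auto
    then show ?thesis by (simp add: s)
  qed
  have "mu d * E ?f = (\<Sum>v\<in>nodes n. bk v * of_bool (fst v = d) * E (\<lambda>s. of_bool (0 < fst s v \<and> snd s = None)))"
    using expectation_gen[OF stationary, of ?f 1] by (simp add: g[abs_def])
  also have "\<dots> = (\<Sum>v\<in>nodes n. bk v * (of_bool (fst v = d) * (lam (fst v) / nu (fst v))))"
    by (intro sum.cong) (auto simp: expectation_nonempty_idle)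
  also have "\<dots> = (\<Sum>c\<in>UNIV. nu c * (of_bool (c = d) * (lam c / nu c)))"
    by (rule sum_bk)
  also have "\<dots> = (\<Sum>c\<in>UNIV. if c = d then lam d else 0)"
    using less_imp_neq[OF nu_pos] by (intro sum.cong) auto
  finally show ?thesis using mu_pos[of d] by (simp add: field_simps)
qed

lemma expectation_idle: "E (\<lambda>s. of_bool (snd s = None)) = 1 - rho"
proof -
  have "(\<lambda>s::'c state. of_bool (snd s = None) :: real) = (\<lambda>s. 1 - (\<Sum>d\<in>UNIV. of_bool (snd s = Some d)))"
  proof
    fix s :: "'c state"
    show "(of_bool (snd s = None) :: real) = 1 - (\<Sum>d\<in>UNIV. of_bool (snd s = Some d))"
      by (cases "snd s") (auto simp: of_bool_def)
  qed
  then show ?thesis by (simp add: rho_def expectation_active)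
qed

definition start_load :: "('c node \<Rightarrow> nat) \<Rightarrow> real" where
  "start_load x = (\<Sum>v\<in>nodes n. bk v / mu (fst v) * of_bool (0 < x v))"

lemma start_load_nonneg: "0 \<le> start_load x"
  unfolding start_load_def by (intro sum_nonneg) (auto simp: rates_ge_0)

lemma start_load_le: "start_load x \<le> (\<Sum>d\<in>UNIV. nu d / mu d)"
proof -
  have "start_load x \<le> (\<Sum>v\<in>nodes n. bk v * (1 / mu (fst v)))"
    unfolding start_load_def by (intro sum_mono) (auto simp: rates_ge_0)
  then show ?thesis using sum_bk[of "\<lambda>c. 1 / mu c"] by simp
qed

text \<open>The activity moves fast compared to the queues: given the queues, the idle fraction of time is
  nearly \<open>1 / (1 + start_load x)\<close>.\<close>

lemma averaging:
  assumes B: "\<And>x. \<bar>h x\<bar> \<le> B"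
    and \<eta>: "\<And>x v. v \<in> nodes n \<Longrightarrow> \<bar>h (x(v := x v + 1)) - h x\<bar> \<le> \<eta> v"
  shows "\<bar>E (\<lambda>s. of_bool (snd s = None) * ((1 + start_load (fst s)) * h (fst s))) - E (\<lambda>s. h (fst s))\<bar>
    \<le> (\<Sum>d\<in>UNIV. 1 / mu d) * (\<Sum>v\<in>nodes n. (arr v + bk v) * \<eta> v)"
proof -
  let ?m = "\<Sum>d\<in>UNIV. 1 / mu d"
  let ?err = "?m * (\<Sum>v\<in>nodes n. (arr v + bk v) * \<eta> v)"
  let ?h = "\<lambda>s. of_bool (snd s = None) * ((1 + start_load (fst s)) * h (fst s)) - h (fst s)"
  \<comment> \<open>Solution of the Poisson equation of the activity with frozen queues: a
    completion contributes \<open>- h\<close>, a start at \<open>v\<close> contributes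
    \<open>h / mu (fst v)\<close>. The error comes only from the changes of \<open>h\<close> by
    arrivals and starts.\<close>
  define f where "f s = (case snd s of None \<Rightarrow> 0 | Some d \<Rightarrow> h (fst s) / mu d)" for s
  have m: "1 / mu d \<le> ?m" for d
    by (rule member_le_sum) (auto simp: rates_ge_0)
  have m0: "0 \<le> ?m" by (intro sum_nonneg) (auto simp: rates_ge_0)
  have B0: "0 \<le> B" using B[of undefined] by linarith
  have \<eta>0: "0 \<le> \<eta> v" if "v \<in> nodes n" for v
    using \<eta>[OF that, of undefined] by linarith
  have \<eta>': "\<bar>h (x(v := x v - 1)) - h x\<bar> \<le> \<eta> v" if "v \<in> nodes n" "0 < x v" for x v
    using \<eta>[OF that(1), of "x(v := x v - 1)"] that(2) by (simp add: abs_minus_commute)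
  have fB: "\<bar>f s\<bar> \<le> B * ?m" for s
  proof (cases "snd s")
    case None
    then show ?thesis using B0 m0 by (simp add: f_def)
  next
    case (Some d)
    have "\<bar>h (fst s)\<bar> * (1 / mu d) \<le> B * ?m"
      using B m B0 by (intro mult_mono) (auto simp: rates_ge_0)
    then show ?thesis using Some mu_pos[of d] by (simp add: f_def abs_mult)
  qed
  have bound: "\<bar>?h s - gen f s\<bar> \<le> ?err" for s
  proof -
    obtain x a where s: "s = (x, a)" by fastforce
    show ?thesis
    proof (cases a)
      case None
      have "gen f (x, None) = (\<Sum>v\<in>nodes n. if 0 < x v then bk v * (h (x(v := x v - 1)) / mu (fst v)) else 0)"
        by (simp add: gen_apply f_def cong: if_cong)
      moreover have "?h (x, None) = (\<Sum>v\<in>nodes n. if 0 < x v then bk v * (h x / mu (fst v)) else 0)"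
        by (simp add: start_load_def distrib_right sum_distrib_right) (auto intro!: sum.cong)
      ultimately have "?h (x, None) - gen f (x, None) =
          (\<Sum>v\<in>nodes n. if 0 < x v then bk v * (1 / mu (fst v)) * (h x - h (x(v := x v - 1))) else 0)"
        by (simp add: sum_subtractf[symmetric]) (auto intro!: sum.cong simp: algebra_simps diff_divide_distrib)
      also have "\<bar>\<dots>\<bar> \<le> (\<Sum>v\<in>nodes n. \<bar>if 0 < x v then bk v * (1 / mu (fst v)) * (h x - h (x(v := x v - 1))) else 0\<bar>)"
        by (rule sum_abs)
      also have "\<dots> \<le> (\<Sum>v\<in>nodes n. ?m * ((arr v + bk v) * \<eta> v))"
      proof (rule sum_mono)
        fix v assume v: "v \<in> nodes n"
        have "bk v * (1 / mu (fst v)) * \<bar>h x - h (x(v := x v - 1))\<bar> \<le> (arr v + bk v) * ?m * \<eta> v" if "0 < x v"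
          using \<eta>'[of v x, OF v that] m[of "fst v"] m0 \<eta>0[OF v] by (intro mult_mono) (auto simp: rates_ge_0 abs_minus_commute)
        then show "\<bar>if 0 < x v then bk v * (1 / mu (fst v)) * (h x - h (x(v := x v - 1))) else 0\<bar> \<le> ?m * ((arr v + bk v) * \<eta> v)"
          using m0 \<eta>0[OF v] rates_ge_0 by (auto simp: abs_mult ac_simps)
      qed
      finally show ?thesis using s None by (simp add: sum_distrib_left)
    next
      case (Some d)
      have "gen f (x, Some d) = (\<Sum>v\<in>nodes n. arr v * (h (x(v := x v + 1)) / mu d - h x / mu d)) - h x"
        using mu_pos[of d] by (simp add: gen_apply f_def cong: if_cong)
      then have "?h (x, Some d) - gen f (x, Some d) = - (\<Sum>v\<in>nodes n. arr v * (1 / mu d) * (h (x(v := x v + 1)) - h x))"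
        by (simp add: diff_divide_distrib algebra_simps)
      also have "\<bar>\<dots>\<bar> \<le> (\<Sum>v\<in>nodes n. \<bar>arr v * (1 / mu d) * (h (x(v := x v + 1)) - h x)\<bar>)"
        unfolding abs_minus_cancel by (rule sum_abs)
      also have "\<dots> \<le> (\<Sum>v\<in>nodes n. ?m * ((arr v + bk v) * \<eta> v))"
      proof (rule sum_mono)
        fix v assume v: "v \<in> nodes n"
        have "arr v * (1 / mu d) * \<bar>h (x(v := x v + 1)) - h x\<bar> \<le> (arr v + bk v) * ?m * \<eta> v"
          using \<eta>[OF v] m[of d] m0 \<eta>0[OF v] by (intro mult_mono) (auto simp: rates_ge_0)
        then show "\<bar>arr v * (1 / mu d) * (h (x(v := x v + 1)) - h x)\<bar> \<le> ?m * ((arr v + bk v) * \<eta> v)"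
          using rates_ge_0 by (simp add: abs_mult ac_simps)
      qed
      finally show ?thesis using s Some by (simp add: sum_distrib_left)
    qed
  qed
  have i1: "integrable (measure_pmf \<pi>) (\<lambda>s. of_bool (snd s = None) * ((1 + start_load (fst s)) * h (fst s)))"
  proof (rule integrable_of_bool_mult)
    fix s show "\<bar>(1 + start_load (fst s)) * h (fst s)\<bar> \<le> (1 + (\<Sum>d\<in>UNIV. nu d / mu d)) * B"
      using start_load_nonneg[of "fst s"] start_load_le[of "fst s"] B[of "fst s"] B0
      unfolding abs_mult by (intro mult_mono) auto
  qed
  have i2: "integrable (measure_pmf \<pi>) (\<lambda>s. h (fst s))"
    using B by (intro integrable_bounded) auto
  have i3: "integrable (measure_pmf \<pi>) (gen f)"
    using abs_gen_le[OF fB] by (rule integrable_bounded)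
  have i4: "integrable (measure_pmf \<pi>) (\<lambda>s. ?h s - gen f s)"
    by (intro Bochner_Integration.integrable_diff i1 i2 i3)
  have "\<bar>E ?h - E (gen f)\<bar> = \<bar>E (\<lambda>s. ?h s - gen f s)\<bar>"
    using i1 i2 i3 by simp
  also have "\<dots> \<le> E (\<lambda>s. \<bar>?h s - gen f s\<bar>)"
    by (rule integral_abs_bound)
  also have "\<dots> \<le> E (\<lambda>s. ?err)"
    by (rule integral_mono[OF integrable_abs[OF i4] _ bound]) simp
  finally show ?thesis
    unfolding Bochner_Integration.integral_diff[OF i1 i2] expectation_gen[OF stationary fB] by simp
qed

text \<open>For constant \<open>h\<close> the averaging error vanishes, so the idle average of the
  load is known exactly; this later upgrades a one-sided deviation bound to an absolute one.\<close>

lemma expectation_idle_start_load: "E (\<lambda>s. of_bool (snd s = None) * (1 + start_load (fst s))) = 1"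
  using averaging[of "\<lambda>_. 1" 1 "\<lambda>_. 0"] by simp

lemma queue_law_exchangeable:
  assumes v: "(c, i) \<in> nodes n" and w: "(c, j) \<in> nodes n"
  shows "queue_law \<pi> (c, i) = queue_law \<pi> (c, j)"
proof -
  define \<tau> where "\<tau> = Transposition.transpose (c, i) (c, j)"
  define g where "g s = (fst s \<circ> \<tau>, snd s)" for s :: "'c state"
  have \<tau>: "bij_betw \<tau> (nodes n) (nodes n)" "bij \<tau>" "\<And>v. fst (\<tau> v) = fst v"
    using v w by (auto simp: \<tau>_def Transposition.transpose_def)
  have gg: "g (g s) = s" for s
    by (cases s) (auto simp: g_def \<tau>_def fun_eq_iff)
  have bij: "bij g" using gg by (intro o_bij[of g g]) (auto simp: fun_eq_iff)
  have qg: "q (g s) (g s') = q s s'" for s s'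
    using rate_permute[OF \<tau>] by (cases s; cases s') (simp add: g_def)
  have pg: "pmf (map_pmf g \<pi>) s = pmf \<pi> (g s)" for s
    using pmf_map_inj'[of g \<pi> "g s"] bij gg by (simp add: bij_def)
  have re: "(\<integral>\<^sup>+s. f (g s) \<partial>count_space UNIV) = (\<integral>\<^sup>+s. f s \<partial>count_space UNIV)" for f :: "'c state \<Rightarrow> ennreal"
    using bij by (rule nn_integral_bij_count_space)
  have ex: "exit_rate q (g s) = exit_rate q s" for s
  proof -
    have "ennreal (exit_rate q (g s)) = ennreal (exit_rate q s)"
      unfolding nn_integral_rate[symmetric] using re[of "\<lambda>s'. ennreal (q (g s) s')"] by (simp add: qg)
    then show ?thesis by simp
  qed
  have "stationary_pmf q (map_pmf g \<pi>)"
    unfolding stationary_pmf_iff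
  proof
    fix s'
    have "(\<integral>\<^sup>+s. ennreal (pmf (map_pmf g \<pi>) s * q s s') \<partial>count_space UNIV)
       = (\<integral>\<^sup>+s. ennreal (pmf \<pi> (g s) * q (g s) (g s')) \<partial>count_space UNIV)"
      by (simp add: pg qg)
    also have "\<dots> = ennreal (pmf \<pi> (g s') * exit_rate q (g s'))"
      using re[of "\<lambda>s. ennreal (pmf \<pi> s * q s (g s'))"]
        stationary[unfolded stationary_pmf_iff, rule_format, of "g s'"] by simp
    finally show "(\<integral>\<^sup>+s. ennreal (pmf (map_pmf g \<pi>) s * q s s') \<partial>count_space UNIV)
       = ennreal (pmf (map_pmf g \<pi>) s' * exit_rate q s')"
      by (simp add: pg ex)
  qed
  moreover have "set_pmf (map_pmf g \<pi>) \<subseteq> network_states n"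
    using support v w by (fastforce simp: g_def network_states_def \<tau>_def Transposition.transpose_def)
  ultimately have "map_pmf g \<pi> = \<pi>"
    using stationary_pmf_unique[OF _ _ stationary support reaches_empty] by blast
  then have "queue_law \<pi> (c, i) = map_pmf (\<lambda>(x, a). x (c, i)) (map_pmf g \<pi>)"
    by (simp add: queue_law_def)
  also have "\<dots> = queue_law \<pi> (c, j)"
    by (simp add: queue_law_def map_pmf_comp g_def \<tau>_def case_prod_unfold o_def)
  finally show ?thesis .
qed

end

section \<open>Quadratic Lyapunov bound for the weighted means\<close>

context stationary_network
begin

text \<open>Margin between the idle share \<open>1 - rho\<close> of time and the share
  \<open>lam c / nu c\<close> in which a class-\<open>c\<close> node backs off, converted to work by
  \<open>1 / mu c\<close>. It becomes the coefficient of a queue length in the negative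
  drift.\<close>

definition slack :: "'c \<Rightarrow> real" where
  "slack c = (1 - rho - lam c / nu c) / mu c"

lemma slack_pos: "0 < slack c"
  using load_less[of c] mu_pos[of c] by (simp add: slack_def)

text \<open>Half of the squared increments of \<open>residual_work\<close>, at the rates of arrivals
  and completions; the completion terms of all classes are added to cover whichever is active. It
  does not grow with the number of nodes.\<close>

definition moment_const :: real where
  "moment_const = (\<Sum>c\<in>UNIV. lam c / (2 * (mu c)\<^sup>2) + 1 / (2 * mu c))"

text \<open>A transmission in progress counts with its mean residual duration
  \<open>1 / mu d\<close>, constant by memorylessness. A start therefore moves work from a queue to
  the server without changing the sum.\<close>

definition residual_work :: "'c state \<Rightarrow> real" where
  "residual_work = (\<lambda>(x, a). (\<Sum>v\<in>nodes n. real (x v) / mu (fst v)) + (case a of None \<Rightarrow> 0 | Some d \<Rightarrow> 1 / mu d))"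

text \<open>The weight of node \<open>v\<close> is chosen so that its starts, at rate
  \<open>bk v\<close>, lower the second sum at rate \<open>real (x v) / mu (fst v)\<close> up to a
  constant. Over all nodes this is the queued work, which compensates for residual work not
  shrinking while the network is idle.\<close>

definition lyapunov :: "'c state \<Rightarrow> real" where
  "lyapunov s = (residual_work s)\<^sup>2 / 2 + (\<Sum>v\<in>nodes n. (real (fst s v))\<^sup>2 / (2 * bk v * mu (fst v)))"

lemma sum_fun_upd:
  assumes "v \<in> A" "finite A"
  shows "(\<Sum>u\<in>A. g u ((x(v := y)) u)) = (\<Sum>u\<in>A. g u (x u)) - g v (x v) + (g v y :: real)"
  using assms by (simp add: sum.remove[of _ v])

text \<open>The expected remaining work \<open>residual_work\<close> has drift \<open>1{idle} - (1 - rho)\<close>; the quadratic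
  queue terms cancel the contribution of the idle states to the drift of its square.\<close>

lemma gen_lyapunov_le:
  "gen lyapunov s \<le> - (\<Sum>v\<in>nodes n. slack (fst v) * real (fst s v)) + moment_const
     + (\<Sum>v\<in>nodes n. arr v / (2 * bk v * mu (fst v)))
     + (\<Sum>v\<in>nodes n. of_bool (0 < fst s v \<and> snd s = None) / (2 * mu (fst v)))"
proof -
  obtain x a where s: "s = (x, a)" by fastforce
  let ?R = "residual_work (x, a)" and ?W = "\<Sum>v\<in>nodes n. real (x v) / mu (fst v)"
  let ?q = "\<lambda>x. \<Sum>v\<in>nodes n. (real (x v))\<^sup>2 / (2 * bk v * mu (fst v))"
  have mu: "mu d \<noteq> 0" and bk: "bk d' \<noteq> 0" and nu: "nu d \<noteq> 0" and mu0: "0 < mu d" for d d'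
    using mu_pos[of d] bk_pos[of d'] nu_pos[of d] by auto
  have ratio: "arr v / bk v = lam (fst v) / nu (fst v)" for v
    using n_pos[of "fst v"] by (simp add: arr_def bk_def)
  have Rarr: "residual_work (x(v := x v + 1), a) = ?R + 1 / mu (fst v)" if "v \<in> nodes n" for v
    using sum_fun_upd[OF that finite_nodes, of "\<lambda>u y. real y / mu (fst u)" x "x v + 1"]
    by (simp add: residual_work_def add_divide_distrib)
  have qarr: "?q (x(v := x v + 1)) = ?q x + (2 * real (x v) + 1) / (2 * bk v * mu (fst v))" if "v \<in> nodes n" for v
    using sum_fun_upd[OF that finite_nodes, of "\<lambda>u y. (real y)\<^sup>2 / (2 * bk u * mu (fst u))" x "x v + 1"]
    by (simp add: power2_eq_square algebra_simps add_divide_distrib)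
  have Rst: "residual_work (x(v := x v - 1), Some (fst v)) = residual_work (x, None)" if "v \<in> nodes n" "0 < x v" for v
    using sum_fun_upd[OF that(1) finite_nodes, of "\<lambda>u y. real y / mu (fst u)" x "x v - 1"] that(2)
    by (simp add: residual_work_def of_nat_diff diff_divide_distrib)
  have qst: "?q (x(v := x v - 1)) = ?q x + (- 2 * real (x v) + 1) / (2 * bk v * mu (fst v))" if "v \<in> nodes n" "0 < x v" for v
    using sum_fun_upd[OF that(1) finite_nodes, of "\<lambda>u y. (real y)\<^sup>2 / (2 * bk u * mu (fst u))" x "x v - 1"] that(2)
    by (simp add: of_nat_diff power2_eq_square algebra_simps add_divide_distrib diff_divide_distrib)
  have "(\<Sum>v\<in>nodes n. arr v * (lyapunov (x(v := x v + 1), a) - lyapunov (x, a)))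
     = (\<Sum>v\<in>nodes n. arr v * (1 / mu (fst v)) * ?R + arr v * (1 / (2 * (mu (fst v))\<^sup>2))
         + (lam (fst v) / nu (fst v)) * (real (x v) / mu (fst v)) + arr v / (2 * bk v * mu (fst v)))"
  proof (intro sum.cong refl)
    fix v assume v: "v \<in> nodes n"
    have "lyapunov (x(v := x v + 1), a) - lyapunov (x, a)
      = ?R / mu (fst v) + 1 / (2 * (mu (fst v))\<^sup>2) + (2 * real (x v) + 1) / (2 * bk v * mu (fst v))"
      unfolding lyapunov_def fst_conv Rarr[OF v] qarr[OF v]
      using mu[of "fst v"] by (simp add: field_simps power2_eq_square)
    moreover have "arr v * ((2 * real (x v) + 1) / (2 * bk v * mu (fst v)))
      = (arr v / bk v) * (real (x v) / mu (fst v)) + arr v / (2 * bk v * mu (fst v))"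
      using mu[of "fst v"] bk[of v] by (simp add: field_simps)
    ultimately show "arr v * (lyapunov (x(v := x v + 1), a) - lyapunov (x, a))
      = arr v * (1 / mu (fst v)) * ?R + arr v * (1 / (2 * (mu (fst v))\<^sup>2))
         + (lam (fst v) / nu (fst v)) * (real (x v) / mu (fst v)) + arr v / (2 * bk v * mu (fst v))"
      unfolding ratio by (simp add: algebra_simps)
  qed
  also have "\<dots> = rho * ?R + (\<Sum>c\<in>UNIV. lam c / (2 * (mu c)\<^sup>2))
     + (\<Sum>v\<in>nodes n. (lam (fst v) / nu (fst v)) * (real (x v) / mu (fst v))) + (\<Sum>v\<in>nodes n. arr v / (2 * bk v * mu (fst v)))"
    unfolding sum.distrib sum_distrib_right[symmetric] rho_def
      sum_arr[of "\<lambda>c. 1 / mu c"] sum_arr[of "\<lambda>c. 1 / (2 * (mu c)\<^sup>2)"]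
    by simp
  finally have A: "(\<Sum>v\<in>nodes n. arr v * (lyapunov (x(v := x v + 1), a) - lyapunov (x, a))) = \<dots>" .
  \<comment> \<open>The squared work decreases with coefficient \<open>1 - rho\<close> on the queued
    work, from which the increase of the node terms by arrivals is to be subtracted; the net
    coefficient of each queue is its slack.\<close>
  have slack: "(\<Sum>v\<in>nodes n. slack (fst v) * real (x v))
      = (1 - rho) * ?W - (\<Sum>v\<in>nodes n. (lam (fst v) / nu (fst v)) * (real (x v) / mu (fst v)))"
    unfolding slack_def sum_distrib_left sum_subtractf[symmetric]
    by (intro sum.cong refl) (simp add: mu nu field_simps)
  have mc: "moment_const = (\<Sum>c\<in>UNIV. lam c / (2 * (mu c)\<^sup>2)) + (\<Sum>c\<in>UNIV. 1 / (2 * mu c))"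
    by (simp add: moment_const_def sum.distrib)
  show ?thesis
  proof (cases a)
    case None
    have "(\<Sum>v\<in>nodes n. if a = None \<and> 0 < x v then bk v * (lyapunov (x(v := x v - 1), Some (fst v)) - lyapunov (x, a)) else 0)
       = (\<Sum>v\<in>nodes n. - (real (x v) / mu (fst v)) + of_bool (0 < x v) / (2 * mu (fst v)))"
    proof (intro sum.cong refl)
      fix v assume v: "v \<in> nodes n"
      have "lyapunov (x(v := x v - 1), Some (fst v)) - lyapunov (x, None) = (- 2 * real (x v) + 1) / (2 * bk v * mu (fst v))"
        if "0 < x v"
        unfolding lyapunov_def fst_conv Rst[OF v that] qst[OF v that] by simp
      then show "(if a = None \<and> 0 < x v then bk v * (lyapunov (x(v := x v - 1), Some (fst v)) - lyapunov (x, a)) else 0)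
        = - (real (x v) / mu (fst v)) + of_bool (0 < x v) / (2 * mu (fst v))"
        using None mu[of "fst v"] bk[of v] by (simp add: field_simps)
    qed
    also have "\<dots> = - ?W + (\<Sum>v\<in>nodes n. of_bool (0 < x v) / (2 * mu (fst v)))"
      by (simp add: sum_subtractf)
    finally have B: "(\<Sum>v\<in>nodes n. if a = None \<and> 0 < x v then bk v * (lyapunov (x(v := x v - 1), Some (fst v)) - lyapunov (x, a)) else 0) = \<dots>" .
    have R: "?R = ?W" by (simp add: residual_work_def None)
    have "0 \<le> (\<Sum>c\<in>UNIV. 1 / (2 * mu c))"
      by (intro sum_nonneg) (auto simp: rates_ge_0)
    then show ?thesis
      unfolding s fst_conv snd_conv gen_apply A B R slack mc using None by (simp add: algebra_simps)
  next
    case (Some d)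
    have R: "?R = ?W + 1 / mu d" by (simp add: residual_work_def Some)
    have "lyapunov (x, None) - lyapunov (x, Some d) = - (?W + 1 / mu d) / mu d + 1 / (2 * (mu d)\<^sup>2)"
      unfolding lyapunov_def residual_work_def using mu[of d] by (simp add: field_simps power2_eq_square)
    then have "mu d * (lyapunov (x, None) - lyapunov (x, Some d)) = - (?W + 1 / mu d) + 1 / (2 * mu d)"
      using mu[of d] by (simp add: field_simps power2_eq_square)
    then have C: "(\<Sum>c\<in>UNIV. if a = Some c then mu c * (lyapunov (x, None) - lyapunov (x, a)) else 0)
        = - (?W + 1 / mu d) + 1 / (2 * mu d)"
      using Some by (simp cong: if_cong)
    have "1 / (2 * mu d) \<le> (\<Sum>c\<in>UNIV. 1 / (2 * mu c))"
      by (rule member_le_sum) (auto simp: rates_ge_0)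
    moreover have "0 \<le> (1 - rho) * (1 / mu d)" using rho_less_1 mu0[of d] by simp
    ultimately show ?thesis
      unfolding s fst_conv snd_conv gen_apply A C R slack mc using Some by (simp add: algebra_simps)
  qed
qed

text \<open>The truncated Lyapunov function has mean drift zero, which bounds the mean on sublevel
  sets; Fatou removes the truncation. The two sums over nodes in the drift bound each give
  \<open>lam c / (2 * nu c * mu c)\<close> per node, one by the ratio of rates and one by the
  throughput identity.\<close>

lemma weighted_mean_queue_le:
  "(\<integral>\<^sup>+s. ennreal (\<Sum>v\<in>nodes n. slack (fst v) * real (fst s v)) \<partial>measure_pmf \<pi>)
     \<le> ennreal (moment_const + (\<Sum>c\<in>UNIV. real (n c) * (lam c / (nu c * mu c))))"
proof -
  let ?g = "\<lambda>s. \<Sum>v\<in>nodes n. slack (fst v) * real (fst s v)"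
  let ?B = "\<lambda>s. moment_const + (\<Sum>v\<in>nodes n. arr v / (2 * bk v * mu (fst v)))
     + (\<Sum>v\<in>nodes n. of_bool (0 < fst s v \<and> snd s = None) / (2 * mu (fst v)))"
  have g0: "0 \<le> ?g s" for s by (intro sum_nonneg mult_nonneg_nonneg) (auto simp: less_imp_le[OF slack_pos])
  have B0: "0 \<le> ?B s" for s
    by (auto intro!: add_nonneg_nonneg sum_nonneg simp: moment_const_def rates_ge_0)
  have iB: "integrable (measure_pmf \<pi>) ?B" by simp
  have lyapunov_nonneg: "0 \<le> lyapunov s" for s
    unfolding lyapunov_def by (intro add_nonneg_nonneg sum_nonneg) (auto simp: rates_ge_0)
  have bound: "(\<integral>\<^sup>+s. ennreal (of_bool (lyapunov s \<le> real M) * ?g s) \<partial>measure_pmf \<pi>) \<le> ennreal (E ?B)" for M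
  proof -
    let ?f = "\<lambda>s. min (lyapunov s) (real M)"
    have f: "\<bar>?f s\<bar> \<le> real M" for s using lyapunov_nonneg[of s] by simp
    have pw: "of_bool (lyapunov s \<le> real M) * ?g s \<le> ?B s - gen ?f s" for s
    proof -
      have "gen ?f s \<le> of_bool (lyapunov s \<le> real M) * gen lyapunov s" by (rule gen_min_le)
      also have "\<dots> \<le> of_bool (lyapunov s \<le> real M) * (?B s - ?g s)"
        using gen_lyapunov_le[of s] by (intro mult_left_mono) (auto simp: algebra_simps)
      finally show ?thesis using B0[of s] by (cases "lyapunov s \<le> real M") auto
    qed
    have ig: "integrable (measure_pmf \<pi>) (gen ?f)"
      using abs_gen_le[of ?f "real M", OF f] by (rule integrable_bounded)
    have "(\<integral>\<^sup>+s. ennreal (of_bool (lyapunov s \<le> real M) * ?g s) \<partial>measure_pmf \<pi>)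
       \<le> (\<integral>\<^sup>+s. ennreal (?B s - gen ?f s) \<partial>measure_pmf \<pi>)"
      using pw by (intro nn_integral_mono ennreal_leI)
    also have "\<dots> = ennreal (E (\<lambda>s. ?B s - gen ?f s))"
    proof (rule nn_integral_eq_integral)
      show "integrable (measure_pmf \<pi>) (\<lambda>s. ?B s - gen ?f s)"
        using iB ig by (rule Bochner_Integration.integrable_diff)
      have "0 \<le> of_bool (lyapunov s \<le> real M) * ?g s" for s using g0[of s] by simp
      then show "AE s in measure_pmf \<pi>. 0 \<le> ?B s - gen ?f s"
        using pw order_trans by (intro AE_pmfI) blast
    qed
    also have "E (\<lambda>s. ?B s - gen ?f s) = E ?B"
      using iB ig expectation_gen[OF stationary, of ?f "real M", OF f] by (subst Bochner_Integration.integral_diff) auto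
    finally show ?thesis .
  qed
  have "(\<integral>\<^sup>+s. ennreal (?g s) \<partial>measure_pmf \<pi>)
     = (\<integral>\<^sup>+s. liminf (\<lambda>M. ennreal (of_bool (lyapunov s \<le> real M) * ?g s)) \<partial>measure_pmf \<pi>)"
  proof (rule nn_integral_cong)
    fix s
    obtain M0 where M0: "lyapunov s \<le> real M0" using real_arch_simple by blast
    have "(\<lambda>M. ennreal (of_bool (lyapunov s \<le> real M) * ?g s)) \<longlonglongrightarrow> ennreal (?g s)"
      using M0 by (intro tendsto_eventually eventually_sequentiallyI[of M0]) auto
    then show "ennreal (?g s) = liminf (\<lambda>M. ennreal (of_bool (lyapunov s \<le> real M) * ?g s))"
      by (rule lim_imp_Liminf[OF trivial_limit_sequentially, symmetric])
  qed
  also have "\<dots> \<le> liminf (\<lambda>M. \<integral>\<^sup>+s. ennreal (of_bool (lyapunov s \<le> real M) * ?g s) \<partial>measure_pmf \<pi>)"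
    by (rule nn_integral_liminf) simp
  also have "\<dots> \<le> liminf (\<lambda>M::nat. ennreal (E ?B))"
    by (intro Liminf_mono always_eventually allI bound)
  also have "\<dots> = ennreal (E ?B)"
    by (simp add: Liminf_const)
  also have "E ?B = moment_const + (\<Sum>v\<in>nodes n. arr v / (2 * bk v * mu (fst v)))
     + (\<Sum>v\<in>nodes n. E (\<lambda>s. of_bool (0 < fst s v \<and> snd s = None)) / (2 * mu (fst v)))"
    by simp
  also have "(\<Sum>v\<in>nodes n. E (\<lambda>s. of_bool (0 < fst s v \<and> snd s = None)) / (2 * mu (fst v)))
      = (\<Sum>v\<in>nodes n. lam (fst v) / nu (fst v) / (2 * mu (fst v)))"
    by (intro sum.cong refl) (simp add: expectation_nonempty_idle)
  also have "(\<Sum>v\<in>nodes n. arr v / (2 * bk v * mu (fst v))) = (\<Sum>v\<in>nodes n. lam (fst v) / nu (fst v) / (2 * mu (fst v)))"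
    using n_pos by (intro sum.cong refl) (simp add: arr_def bk_def)
  also have "(moment_const + (\<Sum>v\<in>nodes n. lam (fst v) / nu (fst v) / (2 * mu (fst v)))
      + (\<Sum>v\<in>nodes n. lam (fst v) / nu (fst v) / (2 * mu (fst v))))
     = moment_const + (\<Sum>v\<in>nodes n. lam (fst v) / (nu (fst v) * mu (fst v)))"
    by (simp add: sum_distrib_left)
  also have "(\<Sum>v\<in>nodes n. lam (fst v) / (nu (fst v) * mu (fst v))) = (\<Sum>c\<in>UNIV. real (n c) * (lam c / (nu c * mu c)))"
    by (simp add: sum_nodes)
  finally show ?thesis .
qed

end

section \<open>Concentration of the load\<close>

text \<open>A one-sided Huber function: a convex, continuously differentiable positive part with
  derivative \<open>ramp \<epsilon>\<close>. Convexity serves for telescoping, the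
  \<open>1 / \<epsilon>\<close>-Lipschitz derivative for controlling single jumps.\<close>

definition smooth_pos :: "real \<Rightarrow> real \<Rightarrow> real" where
  "smooth_pos \<epsilon> y = (if y \<le> 0 then 0 else if y \<le> \<epsilon> then y\<^sup>2 / (2 * \<epsilon>) else y - \<epsilon> / 2)"

definition ramp :: "real \<Rightarrow> real \<Rightarrow> real" where
  "ramp \<epsilon> y = max 0 (min 1 (y / \<epsilon>))"

lemma ramp_bounds: "0 \<le> ramp \<epsilon> y" "ramp \<epsilon> y \<le> 1"
  by (auto simp: ramp_def)

lemma ramp_lipschitz:
  assumes "0 < \<epsilon>"
  shows "\<bar>ramp \<epsilon> y - ramp \<epsilon> z\<bar> \<le> \<bar>y - z\<bar> / \<epsilon>"
proof -
  have "\<bar>ramp \<epsilon> y - ramp \<epsilon> z\<bar> \<le> \<bar>y / \<epsilon> - z / \<epsilon>\<bar>"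
    by (auto simp: ramp_def max_def min_def abs_if)
  then show ?thesis using assms by (simp add: diff_divide_distrib[symmetric])
qed

lemma smooth_pos_bounds:
  assumes "0 < \<epsilon>"
  shows "0 \<le> smooth_pos \<epsilon> y" "smooth_pos \<epsilon> y \<le> max 0 y" "y - \<epsilon> \<le> smooth_pos \<epsilon> y" "smooth_pos \<epsilon> 0 = 0"
proof -
  show "0 \<le> smooth_pos \<epsilon> y" "smooth_pos \<epsilon> 0 = 0" using assms by (auto simp: smooth_pos_def)
  show "smooth_pos \<epsilon> y \<le> max 0 y"
  proof (cases "0 < y \<and> y \<le> \<epsilon>")
    case True
    then have "y * y \<le> y * (2 * \<epsilon>)" by (intro mult_left_mono) auto
    then show ?thesis using True assms by (auto simp: smooth_pos_def power2_eq_square field_simps)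
  qed (use assms in \<open>auto simp: smooth_pos_def\<close>)
  show "y - \<epsilon> \<le> smooth_pos \<epsilon> y"
  proof (cases "0 < y \<and> y \<le> \<epsilon>")
    case True
    then have "y - \<epsilon> \<le> 0" "0 \<le> y\<^sup>2 / (2 * \<epsilon>)" using assms by auto
    then have "y - \<epsilon> \<le> y\<^sup>2 / (2 * \<epsilon>)" by linarith
    then show ?thesis using True by (auto simp: smooth_pos_def)
  qed (use assms in \<open>auto simp: smooth_pos_def\<close>)
qed

lemma smooth_pos_convex:
  assumes e: "0 < \<epsilon>"
  shows "ramp \<epsilon> y * (z - y) \<le> smooth_pos \<epsilon> z - smooth_pos \<epsilon> y"
proof -
  consider "y \<le> 0" | "0 < y" "y \<le> \<epsilon>" | "\<epsilon> < y" by linarith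
  then show ?thesis
  proof cases
    case 1
    then have "y / \<epsilon> \<le> 0" using e by (simp add: divide_nonpos_pos)
    then have "ramp \<epsilon> y = 0" by (auto simp: ramp_def)
    then show ?thesis using 1 smooth_pos_bounds(1)[OF e, of z] by (simp add: smooth_pos_def)
  next
    case 2
    have r: "ramp \<epsilon> y = y / \<epsilon>" using 2 e by (auto simp: ramp_def max_def min_def)
    have "2 * y * z - y\<^sup>2 \<le> 2 * \<epsilon> * smooth_pos \<epsilon> z"
    proof -
      consider "z \<le> 0" | "0 < z" "z \<le> \<epsilon>" | "\<epsilon> < z" by linarith
      then show ?thesis
      proof cases
        case 1
        then have "y * z \<le> 0" using 2 by (simp add: mult_nonneg_nonpos)
        then have "2 * y * z \<le> 0" by linarith
        then have "2 * y * z - y\<^sup>2 \<le> 0" using zero_le_power2[of y] by linarith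
        then show ?thesis using 1 by (simp add: smooth_pos_def)
      next
        case 2
        have "0 \<le> (z - y)\<^sup>2" by simp
        then show ?thesis using 2 e by (simp add: smooth_pos_def power2_eq_square algebra_simps)
      next
        case 3
        have "0 \<le> (\<epsilon> - y) * (2 * z - \<epsilon> - y)" using 2 3 by simp
        then show ?thesis using 3 e by (simp add: smooth_pos_def power2_eq_square algebra_simps)
      qed
    qed
    then have "(2 * y * z - y\<^sup>2) / (2 * \<epsilon>) \<le> smooth_pos \<epsilon> z"
      using e by (simp add: pos_divide_le_eq mult.commute)
    moreover have "smooth_pos \<epsilon> y = y\<^sup>2 / (2 * \<epsilon>)" using 2 by (simp add: smooth_pos_def)
    moreover have "y / \<epsilon> * (z - y) = (2 * y * z - y\<^sup>2) / (2 * \<epsilon>) - y\<^sup>2 / (2 * \<epsilon>)"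
      using e by (simp add: field_simps power2_eq_square)
    ultimately show ?thesis unfolding r by linarith
  next
    case 3
    then have "ramp \<epsilon> y = 1" using e by (auto simp: ramp_def max_def min_def)
    moreover have "z - \<epsilon> / 2 \<le> smooth_pos \<epsilon> z"
    proof (cases "0 < z \<and> z \<le> \<epsilon>")
      case True
      have "0 \<le> (z - \<epsilon>)\<^sup>2" by simp
      then show ?thesis using True e by (simp add: smooth_pos_def power2_eq_square field_simps)
    qed (use e in \<open>auto simp: smooth_pos_def\<close>)
    ultimately show ?thesis using 3 e by (simp add: smooth_pos_def)
  qed
qed

text \<open>Convexity at \<open>z\<close> bounds the increment by the slope at \<open>z\<close>;
  replacing that slope by the one at \<open>y\<close> costs at most the Lipschitz constant times the
  squared increment.\<close>

lemma smooth_pos_smooth: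
  assumes e: "0 < \<epsilon>"
  shows "smooth_pos \<epsilon> z - smooth_pos \<epsilon> y \<le> ramp \<epsilon> y * (z - y) + (z - y)\<^sup>2 / \<epsilon>"
proof -
  have "smooth_pos \<epsilon> z - smooth_pos \<epsilon> y \<le> ramp \<epsilon> z * (z - y)"
    using smooth_pos_convex[OF e, of z y] by (simp add: algebra_simps)
  also have "\<dots> = ramp \<epsilon> y * (z - y) + (ramp \<epsilon> z - ramp \<epsilon> y) * (z - y)"
    by (simp add: algebra_simps)
  also have "(ramp \<epsilon> z - ramp \<epsilon> y) * (z - y) \<le> \<bar>ramp \<epsilon> z - ramp \<epsilon> y\<bar> * \<bar>z - y\<bar>"
    by (simp add: abs_mult[symmetric])
  also have "\<dots> \<le> \<bar>z - y\<bar> / \<epsilon> * \<bar>z - y\<bar>"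
    by (intro mult_right_mono ramp_lipschitz e) auto
  also have "\<dots> = (z - y)\<^sup>2 / \<epsilon>"
    by (simp add: power2_eq_square abs_mult[symmetric])
  finally show ?thesis by simp
qed

context network_rates
begin

definition tail :: "'c \<Rightarrow> nat \<Rightarrow> ('c node \<Rightarrow> nat) \<Rightarrow> real" where
  "tail c k x = (\<Sum>i<n c. of_bool (k \<le> x (c, i))) / real (n c)"

lemma tail_0 [simp]: "tail c 0 x = 1"
  using n_pos[of c] by (simp add: tail_def)

lemma tail_bounds: "0 \<le> tail c k x" "tail c k x \<le> 1"
proof -
  have "(\<Sum>i<n c. of_bool (k \<le> x (c, i)) :: real) \<le> (\<Sum>i<n c. 1)"
    by (intro sum_mono) auto
  then show "tail c k x \<le> 1" using n_pos[of c] by (simp add: tail_def)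
  show "0 \<le> tail c k x" unfolding tail_def by (intro divide_nonneg_nonneg sum_nonneg) auto
qed

lemma tail_diff: "tail c k x - tail c (Suc k) x = (\<Sum>i<n c. of_bool (x (c, i) = k)) / real (n c)"
  unfolding tail_def diff_divide_distrib[symmetric] sum_subtractf[symmetric]
  by (intro arg_cong2[where f="(/)"] sum.cong refl) auto

lemma tail_Suc_le: "tail c (Suc k) x \<le> tail c k x"
proof -
  have "0 \<le> tail c k x - tail c (Suc k) x"
    unfolding tail_diff by (intro divide_nonneg_nonneg sum_nonneg) auto
  then show ?thesis by simp
qed

lemma tail_arrival:
  assumes "(d, i) \<in> nodes n"
  shows "tail c k (x((d, i) := x (d, i) + 1)) = tail c k x + of_bool (c = d \<and> k = Suc (x (d, i))) / real (n d)"
proof (cases "c = d")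
  case True
  have i: "i < n d" using assms by (simp add: nodes_def)
  have "(\<Sum>j<n d. of_bool (k \<le> (x((d, i) := x (d, i) + 1)) (d, j)) :: real)
    = (\<Sum>j<n d. of_bool (k \<le> x (d, j)) + (if j = i then of_bool (k = Suc (x (d, i))) else 0))"
    by (intro sum.cong refl) auto
  also have "\<dots> = (\<Sum>j<n d. of_bool (k \<le> x (d, j))) + of_bool (k = Suc (x (d, i)))"
    using i by (simp add: sum.distrib)
  finally show ?thesis using True by (simp add: tail_def add_divide_distrib)
qed (simp add: tail_def)

lemma tail_departure:
  assumes "(d, i) \<in> nodes n" "0 < x (d, i)"
  shows "tail c k (x((d, i) := x (d, i) - 1)) = tail c k x - of_bool (c = d \<and> k = x (d, i)) / real (n d)"
  using tail_arrival[OF assms(1), of c k "x((d, i) := x (d, i) - 1)"] assms(2) by (simp add: fun_upd_idem)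

end

section \<open>First-order drift of the deficits\<close>

context stationary_network
begin

definition xi :: "'c \<Rightarrow> real" where
  "xi c = lam c / (nu c * (1 - rho))"

lemma xi_pos: "0 < xi c"
  using rho_less_1 by (simp add: xi_def lam_pos nu_pos)

lemma xi_less_1: "xi c < 1"
  using load_less[of c] nu_pos[of c] rho_less_1 by (simp add: xi_def field_simps)

lemma nu_xi: "nu c * xi c * (1 - rho) = lam c"
  using nu_pos[of c] rho_less_1 by (simp add: xi_def)

definition deficit :: "'c \<Rightarrow> nat \<Rightarrow> ('c node \<Rightarrow> nat) \<Rightarrow> real" where
  "deficit c k x = xi c ^ k - tail c k x"

text \<open>To first order, the rate at which arrivals lower \<open>total_deficit\<close>, whose
  factor \<open>real (n c)\<close> cancels the jump \<open>1 / real (n c)\<close> of a tail. The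
  division by \<open>mu c\<close> puts \<open>start_drift\<close>, the counterpart for starts in
  idle time, on the scale of \<open>start_load\<close>.\<close>

definition arrival_drift :: "real \<Rightarrow> nat \<Rightarrow> ('c node \<Rightarrow> nat) \<Rightarrow> real" where
  "arrival_drift \<epsilon> K x = (\<Sum>c\<in>UNIV. lam c / mu c * (\<Sum>k<K. ramp \<epsilon> (deficit c (Suc k) x) * (tail c k x - tail c (Suc k) x)))"

definition start_drift :: "real \<Rightarrow> nat \<Rightarrow> ('c node \<Rightarrow> nat) \<Rightarrow> real" where
  "start_drift \<epsilon> K x = (\<Sum>c\<in>UNIV. nu c / mu c * (\<Sum>k<K. ramp \<epsilon> (deficit c (Suc k) x) * (tail c (Suc k) x - tail c (Suc (Suc k)) x)))"

definition total_deficit :: "real \<Rightarrow> nat \<Rightarrow> ('c node \<Rightarrow> nat) \<Rightarrow> real" where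
  "total_deficit \<epsilon> K x = (\<Sum>c\<in>UNIV. real (n c) / mu c * (\<Sum>k<K. smooth_pos \<epsilon> (deficit c (Suc k) x)))"

lemma nu_mu_nonneg: "0 \<le> nu c / mu c" and lam_mu_nonneg: "0 \<le> lam c / mu c"
  by (simp_all add: rates_ge_0)

lemma start_load_eq: "start_load x = (\<Sum>c\<in>UNIV. nu c / mu c * tail c 1 x)"
proof -
  have "(\<Sum>i<n c. bk (c, i) / mu c * of_bool (0 < x (c, i))) = nu c / mu c * tail c 1 x" for c
    unfolding tail_def sum_distrib_left sum_divide_distrib
    by (intro sum.cong refl) (simp add: bk_def Suc_le_eq)
  then show ?thesis unfolding start_load_def sum_nodes by simp
qed

definition limit_load :: real where
  "limit_load = rho / (1 - rho)"

lemma limit_load_eq: "limit_load = (\<Sum>c\<in>UNIV. nu c / mu c * xi c)"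
proof -
  have "nu c / mu c * xi c = lam c / mu c / (1 - rho)" for c
    using nu_pos[of c] rho_less_1 by (simp add: xi_def)
  then show ?thesis by (simp add: limit_load_def rho_def sum_divide_distrib)
qed

lemma limit_load_1: "(1 - rho) * (1 + limit_load) = 1"
  using rho_less_1 by (simp add: limit_load_def field_simps)

lemma start_drift_bounds: "0 \<le> start_drift \<epsilon> K x" "start_drift \<epsilon> K x \<le> start_load x"
proof -
  have "(\<Sum>k<K. ramp \<epsilon> (deficit c (Suc k) x) * (tail c (Suc k) x - tail c (Suc (Suc k)) x)) \<le> tail c 1 x" for c
  proof -
    have "(\<Sum>k<K. ramp \<epsilon> (deficit c (Suc k) x) * (tail c (Suc k) x - tail c (Suc (Suc k)) x))
       \<le> (\<Sum>k<K. 1 * (tail c (Suc k) x - tail c (Suc (Suc k)) x))"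
      by (intro sum_mono mult_right_mono ramp_bounds) (simp add: tail_Suc_le)
    also have "\<dots> = tail c 1 x - tail c (Suc K) x"
      using sum_lessThan_telescope'[of "\<lambda>k. tail c (Suc k) x" K] by simp
    finally show ?thesis using tail_bounds(1)[of c "Suc K" x] by linarith
  qed
  then show "start_drift \<epsilon> K x \<le> start_load x"
    unfolding start_load_eq start_drift_def by (intro sum_mono mult_left_mono nu_mu_nonneg)
  show "0 \<le> start_drift \<epsilon> K x"
    unfolding start_drift_def
    by (intro sum_nonneg mult_nonneg_nonneg nu_mu_nonneg ramp_bounds) (simp add: tail_Suc_le)
qed

text \<open>The geometric tails satisfy \<open>lam c * (xi c ^ k - xi c ^ Suc k) = nu c * (1 - rho)
  * (xi c ^ Suc k - xi c ^ Suc (Suc k))\<close>, so the arrival drift and \<open>1 - rho\<close>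
  times the start drift differ only through differences of deficits. Convexity turns these into
  telescoping sums, leaving a gain at level one and an error at the cutoff \<open>K\<close>.\<close>

lemma arrival_drift_ge:
  assumes e: "0 < \<epsilon>"
  shows "(1 - rho) * (start_drift \<epsilon> K x + (\<Sum>c\<in>UNIV. nu c / mu c * smooth_pos \<epsilon> (deficit c 1 x))
      - (\<Sum>c\<in>UNIV. nu c / mu c * xi c ^ Suc K)) \<le> arrival_drift \<epsilon> K x"
proof -
  let ?g = "\<lambda>c k. ramp \<epsilon> (deficit c k x)" and ?D = "\<lambda>c k. deficit c k x" and ?f = "\<lambda>c k. smooth_pos \<epsilon> (deficit c k x)"
  \<comment> \<open>The lower end of the telescope vanishes: all nodes hold at least zero packets,
    so the deficit at level \<open>0\<close> is zero.\<close>
  have P1: "(\<Sum>k<K. ?g c (Suc k) * (?D c k - ?D c (Suc k))) \<le> 0" for c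
  proof -
    have "(\<Sum>k<K. ?g c (Suc k) * (?D c k - ?D c (Suc k))) \<le> (\<Sum>k<K. ?f c k - ?f c (Suc k))"
      by (intro sum_mono smooth_pos_convex e)
    also have "\<dots> = ?f c 0 - ?f c K" by (rule sum_lessThan_telescope')
    also have "\<dots> \<le> 0" using smooth_pos_bounds[OF e] by (simp add: deficit_def)
    finally show ?thesis .
  qed
  \<comment> \<open>The shift by one leaves level \<open>1\<close> as a gain and level
    \<open>Suc K\<close> as the cutoff error, since a deficit never exceeds its geometric
    part.\<close>
  have P2: "(\<Sum>k<K. ?g c (Suc k) * (?D c (Suc (Suc k)) - ?D c (Suc k))) \<le> xi c ^ Suc K - ?f c 1" for c
  proof -
    have "(\<Sum>k<K. ?g c (Suc k) * (?D c (Suc (Suc k)) - ?D c (Suc k))) \<le> (\<Sum>k<K. ?f c (Suc (Suc k)) - ?f c (Suc k))"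
      by (intro sum_mono smooth_pos_convex e)
    also have "\<dots> = ?f c (Suc K) - ?f c 1"
      using sum_lessThan_telescope[of "\<lambda>k. ?f c (Suc k)" K] by simp
    also have "?f c (Suc K) \<le> max 0 (?D c (Suc K))" by (rule smooth_pos_bounds(2)[OF e])
    also have "\<dots> \<le> xi c ^ Suc K"
      using tail_bounds(1)[of c "Suc K" x] xi_pos[of c] by (simp add: deficit_def)
    finally show ?thesis by simp
  qed
  have term_eq: "lam c * (?g c (Suc k) * (tail c k x - tail c (Suc k) x))
     = nu c * (1 - rho) * (?g c (Suc k) * (tail c (Suc k) x - tail c (Suc (Suc k)) x))
       - nu c * (1 - rho) * (?g c (Suc k) * (?D c (Suc (Suc k)) - ?D c (Suc k)))
       - lam c * (?g c (Suc k) * (?D c k - ?D c (Suc k)))" for c k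
  proof -
    have alg: "l * (g * r) = a * (g * u) - a * (g * w) - l * (g * z)" if "g * (l * r) = g * (a * u - a * w - l * z)"
      for l g r a u w z :: real
      using that by (simp only: right_diff_distrib mult_ac)
    have "lam c * (xi c ^ k - xi c ^ Suc k) = nu c * (1 - rho) * (xi c ^ Suc k - xi c ^ Suc (Suc k))"
      unfolding nu_xi[of c, symmetric] by (simp add: algebra_simps)
    then have "lam c * (tail c k x - tail c (Suc k) x) = nu c * (1 - rho) * (xi c ^ Suc k - xi c ^ Suc (Suc k)) - lam c * (?D c k - ?D c (Suc k))"
      by (simp add: deficit_def algebra_simps)
    also have "\<dots> = nu c * (1 - rho) * (tail c (Suc k) x - tail c (Suc (Suc k)) x)
        - nu c * (1 - rho) * (?D c (Suc (Suc k)) - ?D c (Suc k)) - lam c * (?D c k - ?D c (Suc k))"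
      by (simp add: deficit_def algebra_simps)
    finally have "?g c (Suc k) * (lam c * (tail c k x - tail c (Suc k) x)) = ?g c (Suc k) * \<dots>" by simp
    then show ?thesis by (rule alg)
  qed
  have class_le: "(1 - rho) * (nu c / mu c * (\<Sum>k<K. ?g c (Suc k) * (tail c (Suc k) x - tail c (Suc (Suc k)) x))
      + nu c / mu c * ?f c 1 - nu c / mu c * xi c ^ Suc K)
     \<le> lam c / mu c * (\<Sum>k<K. ?g c (Suc k) * (tail c k x - tail c (Suc k) x))" for c
  proof -
    let ?S = "\<Sum>k<K. ?g c (Suc k) * (tail c (Suc k) x - tail c (Suc (Suc k)) x)"
    have "lam c * (\<Sum>k<K. ?g c (Suc k) * (tail c k x - tail c (Suc k) x))
      = nu c * (1 - rho) * ?S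
       - nu c * (1 - rho) * (\<Sum>k<K. ?g c (Suc k) * (?D c (Suc (Suc k)) - ?D c (Suc k)))
       - lam c * (\<Sum>k<K. ?g c (Suc k) * (?D c k - ?D c (Suc k)))"
      unfolding sum_distrib_left term_eq by (simp add: sum_subtractf)
    moreover have "nu c * (1 - rho) * (\<Sum>k<K. ?g c (Suc k) * (?D c (Suc (Suc k)) - ?D c (Suc k)))
       \<le> nu c * (1 - rho) * (xi c ^ Suc K - ?f c 1)"
      using P2[of c] nu_pos[of c] rho_less_1 by (intro mult_left_mono) auto
    moreover have "lam c * (\<Sum>k<K. ?g c (Suc k) * (?D c k - ?D c (Suc k))) \<le> 0"
      using P1[of c] lam_pos[of c] by (simp add: mult_nonneg_nonpos)
    ultimately have "nu c * (1 - rho) * ?S - nu c * (1 - rho) * (xi c ^ Suc K - ?f c 1)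
      \<le> lam c * (\<Sum>k<K. ?g c (Suc k) * (tail c k x - tail c (Suc k) x))" by linarith
    then have "(nu c * (1 - rho) * ?S - nu c * (1 - rho) * (xi c ^ Suc K - ?f c 1)) / mu c
      \<le> (lam c * (\<Sum>k<K. ?g c (Suc k) * (tail c k x - tail c (Suc k) x))) / mu c"
      using mu_pos[of c] by (intro divide_right_mono) auto
    then show ?thesis by (simp add: algebra_simps add_divide_distrib diff_divide_distrib)
  qed
  have "(1 - rho) * (start_drift \<epsilon> K x + (\<Sum>c\<in>UNIV. nu c / mu c * ?f c 1) - (\<Sum>c\<in>UNIV. nu c / mu c * xi c ^ Suc K))
    = (\<Sum>c\<in>UNIV. (1 - rho) * (nu c / mu c * (\<Sum>k<K. ?g c (Suc k) * (tail c (Suc k) x - tail c (Suc (Suc k)) x))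
      + nu c / mu c * ?f c 1 - nu c / mu c * xi c ^ Suc K))"
    by (simp only: start_drift_def sum.distrib sum_subtractf sum_distrib_left[symmetric])
  also have "\<dots> \<le> arrival_drift \<epsilon> K x"
    unfolding arrival_drift_def by (intro sum_mono class_le)
  finally show ?thesis .
qed

definition max_load :: real where
  "max_load = (\<Sum>c\<in>UNIV. nu c / mu c)"

lemma max_load_nonneg: "0 \<le> max_load"
  unfolding max_load_def by (intro sum_nonneg nu_mu_nonneg)

text \<open>Because \<open>(1 - rho) * (1 + limit_load) = 1\<close>, the right side is at least
  \<open>1 - rho\<close> times \<open>(s - l) * H + (1 + s) * (Z - r)\<close>, where
  \<open>s\<close> is the load, \<open>l\<close> its limit, \<open>H\<close> the start drift,
  \<open>Z\<close> the smoothed deficit at level one and \<open>r\<close> the cutoff error. For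
  \<open>s\<close> above \<open>l\<close> the first product is nonnegative; below,
  \<open>H \<le> s\<close> limits its cost to less than the gain in \<open>Z\<close>, up to the
  smoothing error.\<close>

lemma drift_inequality:
  assumes e: "0 < \<epsilon>"
  shows "(1 - rho) * (max 0 (limit_load - start_load x)
       - (1 + max_load) * (\<epsilon> * max_load + (\<Sum>c\<in>UNIV. nu c / mu c * xi c ^ Suc K)))
     \<le> (1 + start_load x) * arrival_drift \<epsilon> K x - start_drift \<epsilon> K x"
proof -
  let ?s = "start_load x" and ?l = limit_load and ?H = "start_drift \<epsilon> K x"
  let ?Z = "\<Sum>c\<in>UNIV. nu c / mu c * smooth_pos \<epsilon> (deficit c 1 x)" and ?r = "\<Sum>c\<in>UNIV. nu c / mu c * xi c ^ Suc K"
  have s: "0 \<le> ?s" "?s \<le> max_load" using start_load_nonneg start_load_le by (auto simp: max_load_def)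
  have H: "0 \<le> ?H" "?H \<le> ?s" using start_drift_bounds by auto
  have r: "0 \<le> ?r" by (intro sum_nonneg mult_nonneg_nonneg nu_mu_nonneg zero_le_power) (simp add: less_imp_le xi_pos)
  have Z0: "0 \<le> ?Z" by (intro sum_nonneg mult_nonneg_nonneg nu_mu_nonneg smooth_pos_bounds e)
  have Z: "?l - ?s - \<epsilon> * max_load \<le> ?Z"
  proof -
    have "?l - ?s - \<epsilon> * max_load = (\<Sum>c\<in>UNIV. nu c / mu c * (deficit c 1 x - \<epsilon>))"
      unfolding limit_load_eq start_load_eq max_load_def sum_distrib_left sum_subtractf[symmetric]
      by (intro sum.cong refl) (simp add: deficit_def algebra_simps)
    also have "\<dots> \<le> ?Z"
      by (intro sum_mono mult_left_mono nu_mu_nonneg smooth_pos_bounds e)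
    finally show ?thesis .
  qed
  have em: "0 \<le> \<epsilon> * max_load" using e max_load_nonneg by simp
  have "max 0 (?l - ?s) - (1 + max_load) * (\<epsilon> * max_load + ?r) \<le> (?s - ?l) * ?H + (1 + ?s) * (?Z - ?r)"
  proof -
    have a: "(1 + ?s) * (\<epsilon> * max_load + ?r) \<le> (1 + max_load) * (\<epsilon> * max_load + ?r)"
      using s em r by (intro mult_right_mono) auto
    show ?thesis
    proof (cases "?l \<le> ?s")
      case True
      have "0 \<le> (?s - ?l) * ?H" "0 \<le> (1 + ?s) * ?Z" "0 \<le> (1 + ?s) * (\<epsilon> * max_load)"
        using True H Z0 s em by auto
      then show ?thesis using True a by (simp add: algebra_simps)
    next
      case False
      \<comment> \<open>The two bounds combine exactly:
        \<open>(s - l) * s + (1 + s) * (l - s) = l - s\<close>, the shortfall of the load.\<close>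
      have "(?s - ?l) * ?s \<le> (?s - ?l) * ?H" using False H by (intro mult_left_mono_neg) auto
      moreover have "(1 + ?s) * (?l - ?s - \<epsilon> * max_load) \<le> (1 + ?s) * ?Z"
        using Z s by (intro mult_left_mono) auto
      ultimately show ?thesis using False a by (simp add: algebra_simps)
    qed
  qed
  then have "(1 - rho) * (max 0 (?l - ?s) - (1 + max_load) * (\<epsilon> * max_load + ?r))
     \<le> (1 - rho) * ((?s - ?l) * ?H + (1 + ?s) * (?Z - ?r))"
    using rho_less_1 by (intro mult_left_mono) auto
  also have "\<dots> = (1 + ?s) * ((1 - rho) * (?H + ?Z - ?r)) - (1 - rho) * (1 + ?l) * ?H"
    by (simp add: algebra_simps)
  also have "\<dots> = (1 + ?s) * ((1 - rho) * (?H + ?Z - ?r)) - ?H"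
    unfolding limit_load_1 by simp
  also have "\<dots> \<le> (1 + ?s) * arrival_drift \<epsilon> K x - ?H"
    using arrival_drift_ge[OF e, of K x] s by (intro diff_right_mono mult_left_mono) auto
  finally show ?thesis .
qed

end

section \<open>Concentration of the load and asymptotic independence\<close>

context stationary_network
begin

lemma abs_deficit_le: "\<bar>deficit c k x\<bar> \<le> 1"
proof -
  have "0 \<le> xi c ^ k" "xi c ^ k \<le> 1"
    using xi_pos[of c] xi_less_1[of c] by (auto intro: power_le_one)
  then show ?thesis using tail_bounds[of c k x] unfolding deficit_def by linarith
qed

text \<open>One jump moves a single level of one class by \<open>1 / real (n d)\<close>, with sign
  \<open>\<sigma>\<close>: minus one for an arrival, plus one for a start. After multiplication by
  the weight \<open>real (n d)\<close> the second-order term leaves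
  \<open>1 / (\<epsilon> * real (n d))\<close>.\<close>

lemma total_deficit_diff_le:
  assumes e: "0 < \<epsilon>"
    and D: "\<And>c k. deficit c (Suc k) x' = deficit c (Suc k) x + (if c = d then \<sigma> * of_bool (m = k) / real (n d) else 0)"
    and \<sigma>: "\<sigma>\<^sup>2 = 1"
  shows "total_deficit \<epsilon> K x' - total_deficit \<epsilon> K x
     \<le> 1 / mu d * (\<Sum>k<K. of_bool (m = k) * (\<sigma> * ramp \<epsilon> (deficit d (Suc k) x) + 1 / (\<epsilon> * real (n d))))"
proof -
  let ?f = "\<lambda>c k. smooth_pos \<epsilon> (deficit c (Suc k) x') - smooth_pos \<epsilon> (deficit c (Suc k) x)"
  have "total_deficit \<epsilon> K x' - total_deficit \<epsilon> K x = (\<Sum>c\<in>UNIV. real (n c) / mu c * (\<Sum>k<K. ?f c k))"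
    unfolding total_deficit_def by (simp add: sum_subtractf right_diff_distrib)
  also have "\<dots> = (\<Sum>c\<in>UNIV. if c = d then real (n d) / mu d * (\<Sum>k<K. ?f d k) else 0)"
    by (intro sum.cong refl) (simp add: D)
  also have "\<dots> = real (n d) / mu d * (\<Sum>k<K. ?f d k)" by simp
  also have "\<dots> \<le> real (n d) / mu d * (\<Sum>k<K. of_bool (m = k) * (\<sigma> * ramp \<epsilon> (deficit d (Suc k) x) / real (n d) + 1 / (\<epsilon> * (real (n d))\<^sup>2)))"
  proof (intro mult_left_mono sum_mono)
    fix k
    have "?f d k \<le> ramp \<epsilon> (deficit d (Suc k) x) * (deficit d (Suc k) x' - deficit d (Suc k) x)
        + (deficit d (Suc k) x' - deficit d (Suc k) x)\<^sup>2 / \<epsilon>"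
      by (rule smooth_pos_smooth[OF e])
    also have "\<dots> = of_bool (m = k) * (\<sigma> * ramp \<epsilon> (deficit d (Suc k) x) / real (n d) + 1 / (\<epsilon> * (real (n d))\<^sup>2))"
      using \<sigma> by (simp add: D power_divide ac_simps)
    finally show "?f d k \<le> \<dots>" .
  qed (simp add: rates_ge_0)
  also have "\<dots> = 1 / mu d * (\<Sum>k<K. of_bool (m = k) * (\<sigma> * ramp \<epsilon> (deficit d (Suc k) x) + 1 / (\<epsilon> * real (n d))))"
    unfolding sum_distrib_left using n_pos[of d] mu_pos[of d] e
    by (intro sum.cong refl) (simp add: field_simps power2_eq_square)
  finally show ?thesis .
qed

text \<open>Summing over nodes turns queue lengths into differences of tails. The map
  \<open>h\<close> is the identity for arrivals and \<open>Suc\<close> for starts, since an arrival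
  at length \<open>k\<close> and a start at length \<open>Suc k\<close> both move level
  \<open>Suc k\<close>.\<close>

lemma weighted_class_sum:
  "(\<Sum>i<n c. r / real (n c) * (1 / mu c * (\<Sum>k<K. of_bool (x (c, i) = h k) * w k)))
     = r / mu c * (\<Sum>k<K. w k * (tail c (h k) x - tail c (Suc (h k)) x))"
proof -
  have "(\<Sum>i<n c. r / real (n c) * (1 / mu c * (\<Sum>k<K. of_bool (x (c, i) = h k) * w k)))
      = (\<Sum>k<K. \<Sum>i<n c. r / mu c * (w k * (of_bool (x (c, i) = h k) / real (n c))))"
    unfolding sum_distrib_left by (subst sum.swap) (simp add: ac_simps)
  also have "\<dots> = r / mu c * (\<Sum>k<K. w k * (tail c (h k) x - tail c (Suc (h k)) x))"
    unfolding tail_diff sum_distrib_left sum_divide_distrib by simp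
  finally show ?thesis .
qed

lemma weighted_tail_le:
  assumes e: "0 < \<epsilon>" and r: "0 \<le> r"
  shows "r / mu c * (\<Sum>k<K. (w k + 1 / (\<epsilon> * real (n c))) * (tail c (h k) x - tail c (Suc (h k)) x))
    \<le> r / mu c * (\<Sum>k<K. w k * (tail c (h k) x - tail c (Suc (h k)) x)) + r / mu c * (real K / (\<epsilon> * real (n c)))"
proof -
  have "(\<Sum>k<K. 1 / (\<epsilon> * real (n c)) * (tail c (h k) x - tail c (Suc (h k)) x)) \<le> (\<Sum>k<K. 1 / (\<epsilon> * real (n c)) * 1)"
  proof (intro sum_mono mult_left_mono)
    fix k show "tail c (h k) x - tail c (Suc (h k)) x \<le> 1"
      using tail_bounds(2)[of c "h k" x] tail_bounds(1)[of c "Suc (h k)" x] by linarith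
  qed (use e in auto)
  then have "(\<Sum>k<K. (w k + 1 / (\<epsilon> * real (n c))) * (tail c (h k) x - tail c (Suc (h k)) x))
    \<le> (\<Sum>k<K. w k * (tail c (h k) x - tail c (Suc (h k)) x)) + real K / (\<epsilon> * real (n c))"
    by (simp add: distrib_right sum.distrib)
  then have "r / mu c * (\<Sum>k<K. (w k + 1 / (\<epsilon> * real (n c))) * (tail c (h k) x - tail c (Suc (h k)) x))
    \<le> r / mu c * ((\<Sum>k<K. w k * (tail c (h k) x - tail c (Suc (h k)) x)) + real K / (\<epsilon> * real (n c)))"
    using r mu_pos[of c] by (intro mult_left_mono) auto
  then show ?thesis by (simp add: distrib_left)
qed

definition jump_error :: "real \<Rightarrow> nat \<Rightarrow> real" where
  "jump_error \<epsilon> K = (\<Sum>c\<in>UNIV. (lam c + nu c) / mu c * (real K / (\<epsilon> * real (n c))))"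

lemma gen_total_deficit_le:
  assumes e: "0 < \<epsilon>"
  shows "gen (\<lambda>s. total_deficit \<epsilon> K (fst s)) s
     \<le> - arrival_drift \<epsilon> K (fst s) + of_bool (snd s = None) * start_drift \<epsilon> K (fst s) + jump_error \<epsilon> K"
proof -
  obtain x a where s: "s = (x, a)" by fastforce
  let ?V = "total_deficit \<epsilon> K" and ?g = "\<lambda>c k. ramp \<epsilon> (deficit c (Suc k) x)"
  let ?e = "\<lambda>c. 1 / (\<epsilon> * real (n c))"
  have Da: "deficit c (Suc k) (x((d, i) := x (d, i) + 1)) = deficit c (Suc k) x
      + (if c = d then - 1 * of_bool (x (d, i) = k) / real (n d) else 0)" if "(d, i) \<in> nodes n" for c k d i
    unfolding deficit_def tail_arrival[where x=x and d=d and i=i, OF that] by (auto simp: of_bool_def)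
  have Ds: "deficit c (Suc k) (x((d, i) := x (d, i) - 1)) = deficit c (Suc k) x
      + (if c = d then 1 * of_bool (x (d, i) - 1 = k) / real (n d) else 0)" if "(d, i) \<in> nodes n" "0 < x (d, i)" for c k d i
    unfolding deficit_def tail_departure[where x=x and d=d and i=i, OF that] using that(2) by (auto simp: of_bool_def)
  have "(\<Sum>v\<in>nodes n. arr v * (?V (x(v := x v + 1)) - ?V x))
     \<le> (\<Sum>c\<in>UNIV. \<Sum>i<n c. lam c / real (n c) * (1 / mu c * (\<Sum>k<K. of_bool (x (c, i) = k) * (- 1 * ?g c k + ?e c))))"
    unfolding sum_nodes
  proof (intro sum_mono)
    fix c i assume "i \<in> {..<n c}"
    then have v: "(c, i) \<in> nodes n" by (simp add: nodes_def)
    show "arr (c, i) * (?V (x((c, i) := x (c, i) + 1)) - ?V x)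
      \<le> lam c / real (n c) * (1 / mu c * (\<Sum>k<K. of_bool (x (c, i) = k) * (- 1 * ?g c k + ?e c)))"
      unfolding arr_def fst_conv
      by (intro mult_left_mono total_deficit_diff_le[OF e Da[OF v]]) (auto simp: rates_ge_0)
  qed
  also have "\<dots> = (\<Sum>c\<in>UNIV. lam c / mu c * (\<Sum>k<K. (- 1 * ?g c k + ?e c) * (tail c k x - tail c (Suc k) x)))"
    by (intro sum.cong refl weighted_class_sum[where h="\<lambda>k. k"])
  also have "\<dots> \<le> (\<Sum>c\<in>UNIV. lam c / mu c * (\<Sum>k<K. - 1 * ?g c k * (tail c k x - tail c (Suc k) x)) + lam c / mu c * (real K / (\<epsilon> * real (n c))))"
    by (intro sum_mono weighted_tail_le[where h="\<lambda>k. k", OF e]) (simp add: rates_ge_0)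
  also have "\<dots> = - arrival_drift \<epsilon> K x + (\<Sum>c\<in>UNIV. lam c / mu c * (real K / (\<epsilon> * real (n c))))"
    by (simp add: arrival_drift_def sum.distrib sum_negf sum_subtractf)
  finally have A: "(\<Sum>v\<in>nodes n. arr v * (?V (x(v := x v + 1)) - ?V x)) \<le> \<dots>" .
  have S: "(\<Sum>v\<in>nodes n. if a = None \<and> 0 < x v then bk v * (?V (x(v := x v - 1)) - ?V x) else 0)
      \<le> of_bool (a = None) * start_drift \<epsilon> K x + (\<Sum>c\<in>UNIV. nu c / mu c * (real K / (\<epsilon> * real (n c))))"
  proof (cases "a = None")
    case False
    then show ?thesis using e by (auto intro!: sum_nonneg simp: rates_ge_0)
  next
    case True
    have "(\<Sum>v\<in>nodes n. if a = None \<and> 0 < x v then bk v * (?V (x(v := x v - 1)) - ?V x) else 0)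
     \<le> (\<Sum>c\<in>UNIV. \<Sum>i<n c. nu c / real (n c) * (1 / mu c * (\<Sum>k<K. of_bool (x (c, i) = Suc k) * (1 * ?g c k + ?e c))))"
      unfolding sum_nodes
    proof (intro sum_mono)
      fix c i assume "i \<in> {..<n c}"
      then have v: "(c, i) \<in> nodes n" by (simp add: nodes_def)
      show "(if a = None \<and> 0 < x (c, i) then bk (c, i) * (?V (x((c, i) := x (c, i) - 1)) - ?V x) else 0)
        \<le> nu c / real (n c) * (1 / mu c * (\<Sum>k<K. of_bool (x (c, i) = Suc k) * (1 * ?g c k + ?e c)))"
      proof (cases "0 < x (c, i)")
        case False
        then show ?thesis using e by simp
      next
        case pos: True
        have "?V (x((c, i) := x (c, i) - 1)) - ?V x
          \<le> 1 / mu c * (\<Sum>k<K. of_bool (x (c, i) - 1 = k) * (1 * ?g c k + ?e c))"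
          by (rule total_deficit_diff_le[OF e Ds[OF v pos]]) simp
        also have "(\<Sum>k<K. of_bool (x (c, i) - 1 = k) * (1 * ?g c k + ?e c)) = (\<Sum>k<K. of_bool (x (c, i) = Suc k) * (1 * ?g c k + ?e c))"
          using pos by (intro sum.cong refl) auto
        finally have "bk (c, i) * (?V (x((c, i) := x (c, i) - 1)) - ?V x)
          \<le> bk (c, i) * (1 / mu c * (\<Sum>k<K. of_bool (x (c, i) = Suc k) * (1 * ?g c k + ?e c)))"
          by (rule mult_left_mono) (rule rates_ge_0)
        then show ?thesis
          using pos True by (simp only: bk_def fst_conv simp_thms if_True)
      qed
    qed
    also have "\<dots> = (\<Sum>c\<in>UNIV. nu c / mu c * (\<Sum>k<K. (1 * ?g c k + ?e c) * (tail c (Suc k) x - tail c (Suc (Suc k)) x)))"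
      by (intro sum.cong refl weighted_class_sum[where h=Suc])
    also have "\<dots> \<le> (\<Sum>c\<in>UNIV. nu c / mu c * (\<Sum>k<K. 1 * ?g c k * (tail c (Suc k) x - tail c (Suc (Suc k)) x)) + nu c / mu c * (real K / (\<epsilon> * real (n c))))"
      by (intro sum_mono weighted_tail_le[where h=Suc, OF e]) (simp add: rates_ge_0)
    also have "\<dots> = start_drift \<epsilon> K x + (\<Sum>c\<in>UNIV. nu c / mu c * (real K / (\<epsilon> * real (n c))))"
      by (simp add: start_drift_def sum.distrib)
    finally show ?thesis using True by simp
  qed
  have je: "jump_error \<epsilon> K = (\<Sum>c\<in>UNIV. lam c / mu c * (real K / (\<epsilon> * real (n c)))) + (\<Sum>c\<in>UNIV. nu c / mu c * (real K / (\<epsilon> * real (n c))))"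
    unfolding jump_error_def sum.distrib[symmetric] by (simp add: add_divide_distrib distrib_right)
  have "gen (\<lambda>s. ?V (fst s)) (x, a) = (\<Sum>v\<in>nodes n. arr v * (?V (x(v := x v + 1)) - ?V x)) +
     (\<Sum>v\<in>nodes n. if a = None \<and> 0 < x v then bk v * (?V (x(v := x v - 1)) - ?V x) else 0)"
    by (simp add: gen_apply cong: if_cong)
  then show ?thesis using A S je unfolding s by simp
qed

lemma arrival_drift_bounds: "0 \<le> arrival_drift \<epsilon> K x" "arrival_drift \<epsilon> K x \<le> (\<Sum>c\<in>UNIV. lam c / mu c * real K)"
proof -
  have t: "0 \<le> tail c k x - tail c (Suc k) x" "tail c k x - tail c (Suc k) x \<le> 1" for c k
    using tail_Suc_le[of c k x] tail_bounds[of c k x] tail_bounds[of c "Suc k" x] by linarith+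
  show "0 \<le> arrival_drift \<epsilon> K x"
    unfolding arrival_drift_def
    by (intro sum_nonneg mult_nonneg_nonneg lam_mu_nonneg ramp_bounds t)
  have "(\<Sum>k<K. ramp \<epsilon> (deficit c (Suc k) x) * (tail c k x - tail c (Suc k) x)) \<le> (\<Sum>k<K. 1 * 1)" for c
    by (intro sum_mono mult_mono ramp_bounds t) auto
  then show "arrival_drift \<epsilon> K x \<le> (\<Sum>c\<in>UNIV. lam c / mu c * real K)"
    unfolding arrival_drift_def by (intro sum_mono mult_left_mono lam_mu_nonneg) simp
qed

text \<open>An arrival changes the tails of one class by at most \<open>1 / real (n d)\<close>. For
  each of the \<open>K\<close> levels the slope contributes \<open>1 / \<epsilon>\<close> and the
  difference of two tails contributes \<open>2\<close>.\<close>

lemma arrival_drift_lipschitz: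
  assumes e: "0 < \<epsilon>" and v: "v \<in> nodes n"
  shows "\<bar>arrival_drift \<epsilon> K (x(v := x v + 1)) - arrival_drift \<epsilon> K x\<bar>
    \<le> lam (fst v) / mu (fst v) * (real K * ((1 / \<epsilon> + 2) / real (n (fst v))))"
proof -
  obtain d i where vd: "v = (d, i)" by fastforce
  let ?x = "x((d, i) := x (d, i) + 1)"
  let ?F = "\<lambda>x c. lam c / mu c * (\<Sum>k<K. ramp \<epsilon> (deficit c (Suc k) x) * (tail c k x - tail c (Suc k) x))"
  have tl: "\<bar>tail d k ?x - tail d k x\<bar> \<le> 1 / real (n d)" for k
    using tail_arrival[of d i d k x] v vd by (auto simp: of_bool_def)
  have each: "\<bar>ramp \<epsilon> (deficit d (Suc k) ?x) * (tail d k ?x - tail d (Suc k) ?x)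
      - ramp \<epsilon> (deficit d (Suc k) x) * (tail d k x - tail d (Suc k) x)\<bar> \<le> (1 / \<epsilon> + 2) / real (n d)" for k
  proof -
    let ?g = "ramp \<epsilon> (deficit d (Suc k) x)" and ?g' = "ramp \<epsilon> (deficit d (Suc k) ?x)"
    let ?t = "tail d k x - tail d (Suc k) x" and ?t' = "tail d k ?x - tail d (Suc k) ?x"
    have "\<bar>?g' - ?g\<bar> \<le> \<bar>deficit d (Suc k) ?x - deficit d (Suc k) x\<bar> / \<epsilon>"
      by (rule ramp_lipschitz[OF e])
    also have "\<dots> \<le> 1 / real (n d) / \<epsilon>"
      using tl[of "Suc k"] e by (intro divide_right_mono) (auto simp: deficit_def)
    finally have g: "\<bar>?g' - ?g\<bar> \<le> 1 / real (n d) / \<epsilon>" .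
    have t': "\<bar>?t'\<bar> \<le> 1"
      using tail_Suc_le[of d k ?x] tail_bounds[of d k ?x] tail_bounds[of d "Suc k" ?x] by linarith
    have tt: "\<bar>?t' - ?t\<bar> \<le> 2 / real (n d)" using tl[of k] tl[of "Suc k"] by linarith
    have "\<bar>?g' * ?t' - ?g * ?t\<bar> = \<bar>(?g' - ?g) * ?t' + ?g * (?t' - ?t)\<bar>" by (simp add: algebra_simps)
    also have "\<dots> \<le> \<bar>?g' - ?g\<bar> * \<bar>?t'\<bar> + \<bar>?g\<bar> * \<bar>?t' - ?t\<bar>"
      unfolding abs_mult[symmetric] by (rule abs_triangle_ineq)
    also have "\<bar>?g' - ?g\<bar> * \<bar>?t'\<bar> + \<bar>?g\<bar> * \<bar>?t' - ?t\<bar> \<le> (1 / real (n d) / \<epsilon>) * 1 + 1 * (2 / real (n d))"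
      using e ramp_bounds[of \<epsilon> "deficit d (Suc k) x"] by (intro add_mono mult_mono g t' tt) auto
    also have "\<dots> = (1 / \<epsilon> + 2) / real (n d)"
      using e n_pos[of d] by (simp add: field_simps)
    finally show ?thesis .
  qed
  have other: "tail c k ?x = tail c k x" if "c \<noteq> d" for c k
    using tail_arrival[of d i c k x] v vd that by simp
  have "arrival_drift \<epsilon> K ?x - arrival_drift \<epsilon> K x = (\<Sum>c\<in>UNIV. ?F ?x c - ?F x c)"
    unfolding arrival_drift_def by (simp add: sum_subtractf)
  also have "\<dots> = (\<Sum>c\<in>UNIV. if c = d then ?F ?x d - ?F x d else 0)"
    by (intro sum.cong refl) (simp add: deficit_def other[simplified])
  also have "\<dots> = lam d / mu d * (\<Sum>k<K. ramp \<epsilon> (deficit d (Suc k) ?x) * (tail d k ?x - tail d (Suc k) ?x)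
      - ramp \<epsilon> (deficit d (Suc k) x) * (tail d k x - tail d (Suc k) x))"
    by (simp add: sum_subtractf right_diff_distrib)
  finally have "\<bar>arrival_drift \<epsilon> K ?x - arrival_drift \<epsilon> K x\<bar> = lam d / mu d * \<bar>\<Sum>k<K. ramp \<epsilon> (deficit d (Suc k) ?x) * (tail d k ?x - tail d (Suc k) ?x)
      - ramp \<epsilon> (deficit d (Suc k) x) * (tail d k x - tail d (Suc k) x)\<bar>"
    using rates_ge_0 by (simp add: abs_mult)
  also have "\<dots> \<le> lam d / mu d * (\<Sum>k<K. (1 / \<epsilon> + 2) / real (n d))"
    by (intro mult_left_mono lam_mu_nonneg order_trans[OF sum_abs] sum_mono each)
  finally show ?thesis by (simp add: vd)
qed

definition averaging_error :: "real \<Rightarrow> nat \<Rightarrow> real" where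
  "averaging_error \<epsilon> K = (\<Sum>d\<in>UNIV. 1 / mu d) *
     (\<Sum>c\<in>UNIV. (lam c + nu c) * (lam c / mu c * (real K * ((1 / \<epsilon> + 2) / real (n c)))))"

text \<open>The first summand is the price of smoothing and cutoff and does not depend on the number
  of nodes; the second vanishes as the classes grow. Hence \<open>\<epsilon>\<close> and
  \<open>K\<close> are fixed before the limit.\<close>

definition conc_error :: "real \<Rightarrow> nat \<Rightarrow> real" where
  "conc_error \<epsilon> K = (1 + max_load) * (\<epsilon> * max_load + (\<Sum>c\<in>UNIV. nu c / mu c * xi c ^ Suc K))
     + (jump_error \<epsilon> K + averaging_error \<epsilon> K) / (1 - rho)"

text \<open>Stationarity of \<open>total_deficit\<close> bounds the mean arrival drift by the mean
  start drift over idle states. Averaging moves the arrival drift to idle states with the factor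
  \<open>1 + start_load\<close>, and there the drift inequality applies state by state.\<close>

lemma concentration:
  assumes e: "0 < \<epsilon>"
  shows "E (\<lambda>s. of_bool (snd s = None) * max 0 (limit_load - start_load (fst s))) \<le> conc_error \<epsilon> K"
proof -
  let ?J = "\<lambda>s :: 'c state. of_bool (snd s = None) :: real"
  let ?A = "\<lambda>s :: 'c state. arrival_drift \<epsilon> K (fst s)" and ?H = "\<lambda>s :: 'c state. start_drift \<epsilon> K (fst s)"
  let ?s = "\<lambda>s :: 'c state. start_load (fst s)"
  let ?\<kappa> = "(1 + max_load) * (\<epsilon> * max_load + (\<Sum>c\<in>UNIV. nu c / mu c * xi c ^ Suc K))"
  have sl: "0 \<le> ?s s" "?s s \<le> max_load" for s using start_load_nonneg start_load_le by (auto simp: max_load_def)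
  have r: "0 \<le> (\<Sum>c\<in>UNIV. nu c / mu c * xi c ^ Suc K)"
    by (intro sum_nonneg mult_nonneg_nonneg nu_mu_nonneg zero_le_power) (simp add: less_imp_le xi_pos)
  have \<kappa>0: "0 \<le> ?\<kappa>" using r e max_load_nonneg by simp
  have ll: "0 \<le> limit_load" using rho_pos rho_less_1 by (simp add: limit_load_def)
  define a where "a = (\<Sum>c\<in>UNIV. lam c / mu c * real K)"
  have A: "0 \<le> ?A s" "?A s \<le> a" for s using arrival_drift_bounds by (auto simp: a_def)
  have a0: "0 \<le> a" using A[of undefined] by linarith
  have iA: "integrable (measure_pmf \<pi>) ?A"
    using A by (intro integrable_bounded[of _ a]) auto
  have iJH: "integrable (measure_pmf \<pi>) (\<lambda>s. ?J s * ?H s)"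
  proof (rule integrable_of_bool_mult)
    fix s show "\<bar>?H s\<bar> \<le> max_load" using start_drift_bounds[of \<epsilon> K "fst s"] sl[of s] by linarith
  qed
  have iJA: "integrable (measure_pmf \<pi>) (\<lambda>s. ?J s * ((1 + ?s s) * ?A s))"
  proof (rule integrable_of_bool_mult)
    fix s show "\<bar>(1 + ?s s) * ?A s\<bar> \<le> (1 + max_load) * a"
      using sl[of s] A[of s] unfolding abs_mult by (intro mult_mono) auto
  qed
  have im: "integrable (measure_pmf \<pi>) (\<lambda>s. ?J s * max 0 (limit_load - ?s s))"
  proof (rule integrable_of_bool_mult)
    fix s show "\<bar>max 0 (limit_load - ?s s)\<bar> \<le> limit_load" using sl[of s] ll by auto
  qed
  have "E ?A \<le> E (\<lambda>s. ?J s * ?H s) + jump_error \<epsilon> K"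
  proof -
    define b where "b = (\<Sum>c\<in>UNIV. real (n c) / mu c * (\<Sum>k<K. 1))"
    have B: "\<bar>total_deficit \<epsilon> K (fst s)\<bar> \<le> b" for s
    proof -
      have "0 \<le> total_deficit \<epsilon> K (fst s)"
        unfolding total_deficit_def
        by (intro sum_nonneg mult_nonneg_nonneg smooth_pos_bounds e) (auto simp: rates_ge_0)
      moreover have "smooth_pos \<epsilon> (deficit c k (fst s)) \<le> 1" for c k
        using smooth_pos_bounds(2)[OF e, of "deficit c k (fst s)"] abs_deficit_le[of c k "fst s"] by linarith
      then have "total_deficit \<epsilon> K (fst s) \<le> b"
        unfolding total_deficit_def b_def
        by (intro sum_mono mult_left_mono) (auto simp: rates_ge_0)
      ultimately show ?thesis by simp
    qed
    let ?f = "\<lambda>s. total_deficit \<epsilon> K (fst s)"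
    have ig: "integrable (measure_pmf \<pi>) (gen ?f)"
      using abs_gen_le[of ?f b, OF B] by (rule integrable_bounded)
    have "0 = E (gen ?f)"
      using expectation_gen[OF stationary, of ?f b, OF B] by simp
    also have "\<dots> \<le> E (\<lambda>s. - ?A s + ?J s * ?H s + jump_error \<epsilon> K)"
      using ig iA iJH gen_total_deficit_le[OF e, of K] by (intro integral_mono) auto
    also have "\<dots> = - E ?A + E (\<lambda>s. ?J s * ?H s) + jump_error \<epsilon> K"
      using iA iJH by simp
    finally show ?thesis by simp
  qed
  moreover have "\<bar>E (\<lambda>s. ?J s * ((1 + ?s s) * ?A s)) - E ?A\<bar> \<le> averaging_error \<epsilon> K"
  proof -
    let ?\<eta> = "\<lambda>c. lam c / mu c * (real K * ((1 / \<epsilon> + 2) / real (n c)))"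
    have "\<bar>E (\<lambda>s. ?J s * ((1 + ?s s) * ?A s)) - E ?A\<bar>
      \<le> (\<Sum>d\<in>UNIV. 1 / mu d) * (\<Sum>v\<in>nodes n. (arr v + bk v) * ?\<eta> (fst v))"
      using arrival_drift_bounds[of \<epsilon> K] a0
      by (intro averaging[where B=a] arrival_drift_lipschitz e) (auto simp: a_def)
    also have "(\<Sum>v\<in>nodes n. (arr v + bk v) * ?\<eta> (fst v)) = (\<Sum>c\<in>UNIV. (lam c + nu c) * ?\<eta> c)"
      unfolding distrib_right sum.distrib sum_arr[of ?\<eta>] sum_bk[of ?\<eta>] ..
    finally show ?thesis by (simp only: averaging_error_def)
  qed
  ultimately have up: "E (\<lambda>s. ?J s * ((1 + ?s s) * ?A s)) - E (\<lambda>s. ?J s * ?H s) \<le> jump_error \<epsilon> K + averaging_error \<epsilon> K"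
    by linarith
  have "(1 - rho) * (E (\<lambda>s. ?J s * max 0 (limit_load - ?s s)) - ?\<kappa>)
     = E (\<lambda>s. (1 - rho) * (?J s * max 0 (limit_load - ?s s) - ?\<kappa>))"
    using im by simp
  also have "\<dots> \<le> E (\<lambda>s. ?J s * ((1 + ?s s) * ?A s) - ?J s * ?H s)"
  proof (rule integral_mono)
    fix s :: "'c state"
    \<comment> \<open>In active states all indicator terms vanish, and the subtracted error keeps
      the left side nonpositive.\<close>
    have "0 \<le> (1 - rho) * ?\<kappa>" using \<kappa>0 rho_less_1 by simp
    then show "(1 - rho) * (?J s * max 0 (limit_load - ?s s) - ?\<kappa>) \<le> ?J s * ((1 + ?s s) * ?A s) - ?J s * ?H s"
      using drift_inequality[OF e, of "fst s" K] by (cases "snd s = None") auto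
  qed (use im iJA iJH in auto)
  also have "\<dots> \<le> jump_error \<epsilon> K + averaging_error \<epsilon> K"
    using up iJA iJH by simp
  finally have "E (\<lambda>s. ?J s * max 0 (limit_load - ?s s)) - ?\<kappa> \<le> (jump_error \<epsilon> K + averaging_error \<epsilon> K) / (1 - rho)"
    using rho_less_1 by (simp add: pos_le_divide_eq mult.commute)
  then show ?thesis unfolding conc_error_def by linarith
qed

text \<open>On idle states the load is close to \<open>limit_load\<close> in the mean, so the weight
  \<open>1 + start_load\<close> in the averaging identity for the event of length \<open>k\<close>
  may be replaced by the constant \<open>1 / (1 - rho)\<close>. The event changes only by jumps at
  \<open>v\<close> itself, hence the small averaging error.\<close>

lemma idle_almost_independent:
  assumes e: "0 < \<epsilon>" and v: "v \<in> nodes n"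
  shows "\<bar>E (\<lambda>s. of_bool (fst s v = k)) - E (\<lambda>s. of_bool (fst s v = k \<and> snd s = None)) / (1 - rho)\<bar>
    \<le> (\<Sum>d\<in>UNIV. 1 / mu d) * (arr v + bk v) + 2 * conc_error \<epsilon> K"
proof -
  let ?J = "\<lambda>s :: 'c state. of_bool (snd s = None) :: real" and ?h = "\<lambda>s :: 'c state. of_bool (fst s v = k) :: real"
  let ?s = "\<lambda>s :: 'c state. start_load (fst s)"
  have sl: "0 \<le> ?s s" "?s s \<le> max_load" for s using start_load_nonneg start_load_le by (auto simp: max_load_def)
  have ll: "0 \<le> limit_load" using rho_pos rho_less_1 by (simp add: limit_load_def)
  have iJs: "integrable (measure_pmf \<pi>) (\<lambda>s. ?J s * ((1 + ?s s) * ?h s))"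
    by (rule integrable_of_bool_mult[where B="1 + max_load"]) (use sl max_load_nonneg in \<open>auto simp: abs_mult of_bool_def\<close>)
  have iJ: "integrable (measure_pmf \<pi>) (\<lambda>s. ?J s * ?h s)"
    by (rule integrable_of_bool_mult[where B=1]) auto
  have iJ1: "integrable (measure_pmf \<pi>) (\<lambda>s. ?J s * (1 + ?s s))"
    by (rule integrable_of_bool_mult[where B="1 + max_load"]) (use sl in auto)
  have im: "integrable (measure_pmf \<pi>) (\<lambda>s. ?J s * max 0 (limit_load - ?s s))"
    by (rule integrable_of_bool_mult[where B=limit_load]) (use sl ll in auto)
  have iab: "integrable (measure_pmf \<pi>) (\<lambda>s. ?J s * \<bar>limit_load - ?s s\<bar>)"
  proof (rule integrable_of_bool_mult)
    fix s show "\<bar>\<bar>limit_load - ?s s\<bar>\<bar> \<le> limit_load + max_load" using sl[of s] ll by linarith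
  qed
  \<comment> \<open>The absolute value of \<open>z\<close> is \<open>2 * max 0 z - z\<close>; the
    linear part has mean zero by the exact idle identities, so the one-sided bound suffices.\<close>
  have "E (\<lambda>s. ?J s * \<bar>limit_load - ?s s\<bar>) = E (\<lambda>s. 2 * (?J s * max 0 (limit_load - ?s s)) + ?J s * (1 + ?s s) - (1 + limit_load) * ?J s)"
    by (intro Bochner_Integration.integral_cong refl) (auto simp: max_def algebra_simps)
  also have "\<dots> = 2 * E (\<lambda>s. ?J s * max 0 (limit_load - ?s s)) + E (\<lambda>s. ?J s * (1 + ?s s)) - (1 + limit_load) * E ?J"
    using im iJ1 by simp
  also have "\<dots> = 2 * E (\<lambda>s. ?J s * max 0 (limit_load - ?s s))"
    using limit_load_1 by (simp only: expectation_idle_start_load expectation_idle) (simp add: mult.commute)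
  also have "\<dots> \<le> 2 * conc_error \<epsilon> K" using concentration[OF e] by simp
  finally have ab: "E (\<lambda>s. ?J s * \<bar>limit_load - ?s s\<bar>) \<le> 2 * conc_error \<epsilon> K" .
  have "\<bar>E (\<lambda>s. ?J s * ((1 + ?s s) * ?h s)) - E ?h\<bar> \<le> (\<Sum>d\<in>UNIV. 1 / mu d) * (\<Sum>u\<in>nodes n. (arr u + bk u) * (if u = v then 1 else 0))"
    by (rule averaging[where B=1]) (auto simp: of_bool_def)
  also have "(\<Sum>u\<in>nodes n. (arr u + bk u) * (if u = v then 1 else 0)) = arr v + bk v"
    using v by (simp add: sum.If_cases if_distrib cong: if_cong)
  finally have av: "\<bar>E (\<lambda>s. ?J s * ((1 + ?s s) * ?h s)) - E ?h\<bar> \<le> (\<Sum>d\<in>UNIV. 1 / mu d) * (arr v + bk v)" .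
  have "\<bar>E (\<lambda>s. ?J s * ((1 + ?s s) * ?h s)) - (1 + limit_load) * E (\<lambda>s. ?J s * ?h s)\<bar>
     = \<bar>E (\<lambda>s. ?J s * ((1 + ?s s) * ?h s) - (1 + limit_load) * (?J s * ?h s))\<bar>"
    using iJs iJ by simp
  also have "\<dots> \<le> E (\<lambda>s. \<bar>?J s * ((1 + ?s s) * ?h s) - (1 + limit_load) * (?J s * ?h s)\<bar>)"
    by (rule integral_abs_bound)
  also have "\<dots> \<le> E (\<lambda>s. ?J s * \<bar>limit_load - ?s s\<bar>)"
  proof (rule integral_mono)
    show "integrable (measure_pmf \<pi>) (\<lambda>s. \<bar>?J s * ((1 + ?s s) * ?h s) - (1 + limit_load) * (?J s * ?h s)\<bar>)"
      by (intro integrable_abs Bochner_Integration.integrable_diff iJs integrable_mult_right iJ)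
    show "\<bar>?J s * ((1 + ?s s) * ?h s) - (1 + limit_load) * (?J s * ?h s)\<bar> \<le> ?J s * \<bar>limit_load - ?s s\<bar>" for s
      by (auto simp: of_bool_def)
  qed (rule iab)
  also note ab
  finally have ind: "\<bar>E (\<lambda>s. ?J s * ((1 + ?s s) * ?h s)) - (1 + limit_load) * E (\<lambda>s. ?J s * ?h s)\<bar> \<le> 2 * conc_error \<epsilon> K" .
  have "1 + limit_load = 1 / (1 - rho)" using limit_load_1 rho_less_1 by (simp add: field_simps)
  moreover have "E (\<lambda>s. ?J s * ?h s) = E (\<lambda>s. of_bool (fst s v = k \<and> snd s = None))"
    by (intro Bochner_Integration.integral_cong refl) (auto simp: of_bool_def)
  ultimately have "(1 + limit_load) * E (\<lambda>s. ?J s * ?h s) = E (\<lambda>s. of_bool (fst s v = k \<and> snd s = None)) / (1 - rho)"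
    by simp
  with av ind show ?thesis by linarith
qed

end

text \<open>If class \<open>c\<close> exceeded its limit by \<open>e\<close>, its term would
  contribute at least \<open>m\<close>, and the lower bounds let the other classes take back at most
  half of that. With \<open>B\<close> below the other half this contradicts the upper bound.\<close>

lemma tendsto_of_weighted_sum_le:
  fixes r w :: "nat \<Rightarrow> 'c::finite \<Rightarrow> real"
  assumes w: "\<And>N d. 0 \<le> w N d" "\<And>N d. w N d \<le> 1" "\<And>d. (\<lambda>N. w N d) \<longlonglongrightarrow> p d" "\<And>d. 0 < p d"
    and s: "\<And>d. 0 < s d"
    and le: "\<forall>\<^sub>F N in sequentially. (\<Sum>d\<in>UNIV. w N d * (s d * (r N d - t d))) \<le> B N"
    and B: "B \<longlonglongrightarrow> 0"
    and low: "\<And>d \<delta>. 0 < \<delta> \<Longrightarrow> \<forall>\<^sub>F N in sequentially. t d - \<delta> \<le> r N d"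
  shows "(\<lambda>N. r N c) \<longlonglongrightarrow> t c"
proof (rule order_tendstoI)
  fix a assume "a < t c"
  then show "\<forall>\<^sub>F N in sequentially. a < r N c"
    using low[of "(t c - a) / 2" c] by (auto elim!: eventually_mono simp: field_simps)
next
  fix a assume a: "t c < a"
  define e where "e = a - t c"
  define S where "S = (\<Sum>d\<in>UNIV. s d)"
  have S: "0 < S" unfolding S_def using s by (intro sum_pos) auto
  define m where "m = p c / 2 * (s c * e)"
  have m: "0 < m" using a w(4)[of c] s[of c] by (simp add: m_def e_def)
  \<comment> \<open>The weights are at most one, so the other classes together lose at most
    \<open>\<delta> * S = m / 2\<close>.\<close>
  define \<delta> where "\<delta> = m / (2 * S)"
  have \<delta>: "0 < \<delta>" "\<delta> * S = m / 2" using m S by (auto simp: \<delta>_def)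
  have "\<forall>\<^sub>F N in sequentially. \<forall>d. t d - \<delta> \<le> r N d"
    using low[OF \<delta>(1)] by (simp add: eventually_all_finite)
  moreover have "\<forall>\<^sub>F N in sequentially. p c / 2 < w N c"
    using w(4)[of c] by (intro order_tendstoD(1)[OF w(3)]) auto
  moreover have "\<forall>\<^sub>F N in sequentially. B N < m / 2"
    using m by (intro order_tendstoD(2)[OF B]) auto
  ultimately show "\<forall>\<^sub>F N in sequentially. r N c < a"
    using le
  proof eventually_elim
    case (elim N)
    show ?case
    proof (rule ccontr)
      assume "\<not> r N c < a"
      then have e: "e \<le> r N c - t c" by (simp add: e_def)
      have "(\<Sum>d\<in>UNIV - {c}. - (s d * \<delta>)) \<le> (\<Sum>d\<in>UNIV - {c}. w N d * (s d * (r N d - t d)))"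
      proof (rule sum_mono)
        fix d
        have "w N d * (s d * \<delta>) \<le> 1 * (s d * \<delta>)"
          using w s[of d] \<delta> by (intro mult_right_mono) auto
        moreover have "w N d * (s d * (- \<delta>)) \<le> w N d * (s d * (r N d - t d))"
          using elim(1)[rule_format, of d] w(1)[of N d] s[of d] by (intro mult_left_mono) auto
        ultimately show "- (s d * \<delta>) \<le> w N d * (s d * (r N d - t d))" by simp
      qed
      moreover have "(\<Sum>d\<in>UNIV - {c}. s d * \<delta>) \<le> (\<Sum>d\<in>UNIV. s d * \<delta>)"
        using s \<delta> by (intro sum_mono2) (auto simp: less_imp_le)
      ultimately have "- (m / 2) \<le> (\<Sum>d\<in>UNIV - {c}. w N d * (s d * (r N d - t d)))"
        using \<delta>(2) unfolding sum_negf sum_distrib_right[symmetric] S_def by (simp add: mult.commute)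
      moreover have "(\<Sum>d\<in>UNIV. w N d * (s d * (r N d - t d)))
         = w N c * (s c * (r N c - t c)) + (\<Sum>d\<in>UNIV - {c}. w N d * (s d * (r N d - t d)))"
        by (rule sum.remove) auto
      moreover have "p c / 2 * (s c * e) \<le> w N c * (s c * (r N c - t c))"
        using elim(2) e s[of c] w(4)[of c] a by (intro mult_mono) (auto simp: e_def)
      ultimately show False using elim(3,4) m_def by linarith
    qed
  qed
qed

section \<open>Mean queue lengths\<close>

context stationary_network
begin

definition mean_queue :: "'c node \<Rightarrow> ennreal" where
  "mean_queue v = (\<integral>\<^sup>+k. of_nat k \<partial>measure_pmf (queue_law \<pi> v))"

lemma mean_queue_eq: "mean_queue v = (\<integral>\<^sup>+s. ennreal (real (fst s v)) \<partial>measure_pmf \<pi>)"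
  by (simp add: mean_queue_def queue_law_def case_prod_unfold ennreal_of_nat_eq_real_of_nat)

lemma partial_mean_le:
  "ennreal (\<Sum>k<K. real k * E (\<lambda>s. of_bool (fst s v = k))) \<le> mean_queue v"
proof -
  have "(\<Sum>k<K. real k * E (\<lambda>s. of_bool (fst s v = k))) = E (\<lambda>s. \<Sum>k<K. real k * of_bool (fst s v = k))"
    by simp
  also have "ennreal \<dots> = (\<integral>\<^sup>+s. ennreal (\<Sum>k<K. real k * of_bool (fst s v = k)) \<partial>measure_pmf \<pi>)"
    by (intro nn_integral_eq_integral[symmetric]) (auto intro!: sum_nonneg)
  also have "\<dots> \<le> mean_queue v"
    unfolding mean_queue_eq
  proof (intro nn_integral_mono ennreal_leI)
    fix s
    have "(\<Sum>k<K. real k * of_bool (fst s v = k)) = (\<Sum>k<K. if k = fst s v then real (fst s v) else 0)"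
      by (intro sum.cong refl) auto
    then show "(\<Sum>k<K. real k * of_bool (fst s v = k)) \<le> real (fst s v)" by simp
  qed
  finally show ?thesis .
qed

lemma weighted_mean_queue_sum_le:
  "(\<Sum>c\<in>UNIV. ennreal (real (n c) * slack c) * mean_queue (c, 0))
     \<le> ennreal (moment_const + (\<Sum>c\<in>UNIV. real (n c) * (lam c / (nu c * mu c))))"
proof -
  have "(\<integral>\<^sup>+s. ennreal (\<Sum>v\<in>nodes n. slack (fst v) * real (fst s v)) \<partial>measure_pmf \<pi>)
     = (\<integral>\<^sup>+s. (\<Sum>v\<in>nodes n. ennreal (slack (fst v)) * ennreal (real (fst s v))) \<partial>measure_pmf \<pi>)"
    by (intro nn_integral_cong)
       (auto simp: ennreal_mult[symmetric] less_imp_le[OF slack_pos] intro!: sum_ennreal[symmetric])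
  also have "\<dots> = (\<Sum>v\<in>nodes n. ennreal (slack (fst v)) * mean_queue v)"
    by (simp add: nn_integral_sum nn_integral_cmult mean_queue_eq)
  also have "\<dots> = (\<Sum>c\<in>UNIV. \<Sum>j<n c. ennreal (slack c) * mean_queue (c, 0))"
    unfolding sum_nodes
  proof (intro sum.cong refl)
    fix c i assume "i \<in> {..<n c}"
    then have "queue_law \<pi> (c, i) = queue_law \<pi> (c, 0)"
      by (intro queue_law_exchangeable) (auto simp: nodes_def n_pos)
    then show "ennreal (slack (fst (c, i))) * mean_queue (c, i) = ennreal (slack c) * mean_queue (c, 0)"
      by (simp add: mean_queue_def)
  qed
  also have "\<dots> = (\<Sum>c\<in>UNIV. ennreal (real (n c) * slack c) * mean_queue (c, 0))"
    by (simp add: ennreal_mult less_imp_le[OF slack_pos] ennreal_of_nat_eq_real_of_nat mult.assoc)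
  finally show ?thesis using weighted_mean_queue_le by simp
qed

text \<open>Every class has positive slack, so each mean is controlled by the weighted sum.
  Finiteness is what later allows flows of waiting packets to be cancelled.\<close>

lemma mean_queue_finite:
  assumes "v \<in> nodes n"
  shows "mean_queue v < \<top>"
proof -
  obtain c i where v: "v = (c, i)" by fastforce
  have eq: "mean_queue v = mean_queue (c, 0)"
    unfolding mean_queue_def v using assms v by (subst queue_law_exchangeable[of c i 0]) (auto simp: nodes_def n_pos)
  have "ennreal (real (n c) * slack c) * mean_queue (c, 0) \<le> (\<Sum>c\<in>UNIV. ennreal (real (n c) * slack c) * mean_queue (c, 0))"
    by (rule member_le_sum) auto
  also note weighted_mean_queue_sum_le
  finally have "ennreal (real (n c) * slack c) * mean_queue (c, 0) < \<top>"
    using le_less_trans ennreal_less_top by blast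
  then show ?thesis
    using n_pos[of c] slack_pos[of c] unfolding eq by (auto simp: ennreal_mult_less_top)
qed

text \<open>Makes the quadratic bound sharp: at the geometric means its left side equals the part of
  its right side that grows with the number of nodes, and only \<open>moment_const\<close> separates
  them.\<close>

lemma slack_mean: "slack c * (xi c / (1 - xi c)) = lam c / (nu c * mu c)"
proof -
  have "xi c / (1 - xi c) = lam c / (nu c * (1 - rho) - lam c)"
  proof -
    have "a / x / (1 - a / x) = a / (x - a)" if "x \<noteq> 0" for a x :: real
      using that by (simp add: divide_simps)
    then show ?thesis using nu_pos[of c] rho_less_1 by (simp add: xi_def)
  qed
  moreover have "1 - rho - lam c / nu c = (nu c * (1 - rho) - lam c) / nu c"
    using nu_pos[of c] by (simp add: field_simps)
  moreover have "nu c * (1 - rho) - lam c \<noteq> 0"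
    using load_less[of c] nu_pos[of c] by (simp add: field_simps)
  ultimately show ?thesis
    using nu_pos[of c] mu_pos[of c] by (simp add: slack_def)
qed

end

section \<open>Limits along the sequence of networks\<close>

locale network_sequence =
  fixes lam mu nu p :: "'c::finite \<Rightarrow> real"
    and n :: "nat \<Rightarrow> 'c \<Rightarrow> nat" and \<pi> :: "nat \<Rightarrow> 'c state pmf"
  assumes network: "\<And>N. CARD('c) \<le> N \<Longrightarrow> stationary_network (n N) lam mu nu (\<pi> N)"
    and total: "\<And>N. CARD('c) \<le> N \<Longrightarrow> (\<Sum>d\<in>UNIV. n N d) = N"
    and fractions: "\<And>d. (\<lambda>N. real (n N d) / real N) \<longlonglongrightarrow> p d" "\<And>d. 0 < p d"
begin

abbreviation "rho \<equiv> stationary_network.rho lam mu"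
abbreviation "xi \<equiv> stationary_network.xi lam mu nu"
abbreviation "queue_prob N v k \<equiv> measure_pmf.expectation (\<pi> N) (\<lambda>s. of_bool (fst s v = k))"
abbreviation "queue_idle_prob N v k \<equiv> measure_pmf.expectation (\<pi> N) (\<lambda>s. of_bool (fst s v = k \<and> snd s = None))"
abbreviation "mean N v \<equiv> stationary_network.mean_queue (\<pi> N) v"

text \<open>Quantities such as \<open>rho\<close> and \<open>xi\<close> do not depend on the size,
  so the smallest admissible network supplies their properties.\<close>

lemma first_network: "stationary_network (n CARD('c)) lam mu nu (\<pi> CARD('c))"
  by (rule network) simp

lemmas rho_less_1 = stationary_network.rho_less_1[OF first_network]
  and xi_pos = stationary_network.xi_pos[OF first_network]
  and xi_less_1 = stationary_network.xi_less_1[OF first_network]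

lemma nu_pos: "0 < nu d"
  using first_network unfolding stationary_network_def network_rates_def by blast

lemma class_size_at_top: "filterlim (\<lambda>N. real (n N d)) at_top sequentially"
proof -
  have "filterlim (\<lambda>N. real (n N d) / real N * real N) at_top sequentially"
    by (rule filterlim_tendsto_pos_mult_at_top[OF fractions filterlim_real_sequentially])
  moreover have "\<forall>\<^sub>F N in sequentially. real (n N d) / real N * real N = real (n N d)"
    using eventually_gt_at_top[of "0::nat"] by eventually_elim simp
  ultimately show ?thesis
    using filterlim_cong[OF refl refl] by fast
qed

lemma inverse_class_size: "(\<lambda>N. 1 / real (n N d)) \<longlonglongrightarrow> 0"
  using tendsto_inverse_0_at_top[OF class_size_at_top[of d]] by (simp add: inverse_eq_divide)

lemma div_class_size: "(\<lambda>N. x / real (n N d)) \<longlonglongrightarrow> 0"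
  using tendsto_mult_left[OF inverse_class_size[of d], of x] by simp

lemma conc_error_tendsto:
  assumes e: "0 < \<epsilon>"
  shows "(\<lambda>N. stationary_network.conc_error (n N) lam mu nu \<epsilon> K) \<longlonglongrightarrow>
     (1 + stationary_network.max_load mu nu) * (\<epsilon> * stationary_network.max_load mu nu + (\<Sum>c\<in>UNIV. nu c / mu c * xi c ^ Suc K))"
proof -
  let ?C = "1 + stationary_network.max_load mu nu"
  let ?L = "\<epsilon> * stationary_network.max_load mu nu + (\<Sum>c\<in>UNIV. nu c / mu c * xi c ^ Suc K)"
  let ?F = "\<lambda>N. ?C * ?L + ((\<Sum>c\<in>UNIV. (lam c + nu c) / mu c * (real K / (\<epsilon> * real (n N c)))) +
      (\<Sum>d\<in>UNIV. 1 / mu d) * (\<Sum>c\<in>UNIV. (lam c + nu c) * (lam c / mu c * (real K * ((1 / \<epsilon> + 2) / real (n N c)))))) / (1 - rho)"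
  have "?F \<longlonglongrightarrow> ?C * ?L + ((\<Sum>c\<in>(UNIV :: 'c set). (lam c + nu c) / mu c * 0) +
      (\<Sum>d\<in>UNIV. 1 / mu d) * (\<Sum>c\<in>(UNIV :: 'c set). (lam c + nu c) * (lam c / mu c * (real K * 0)))) / (1 - rho)"
    using div_class_size[of "real K / \<epsilon>"] rho_less_1
    by (intro tendsto_intros div_class_size) (simp_all add: divide_divide_eq_left)
  moreover have "\<forall>\<^sub>F N in sequentially. ?F N = stationary_network.conc_error (n N) lam mu nu \<epsilon> K"
    using eventually_ge_at_top[of "CARD('c)"]
  proof eventually_elim
    case (elim N)
    interpret net: stationary_network "n N" lam mu nu "\<pi> N" using network[OF elim] .
    show ?case unfolding net.conc_error_def net.jump_error_def net.averaging_error_def ..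
  qed
  ultimately have "(\<lambda>N. stationary_network.conc_error (n N) lam mu nu \<epsilon> K) \<longlonglongrightarrow>
    ?C * ?L + ((\<Sum>c\<in>(UNIV :: 'c set). (lam c + nu c) / mu c * 0) +
      (\<Sum>d\<in>UNIV. 1 / mu d) * (\<Sum>c\<in>(UNIV :: 'c set). (lam c + nu c) * (lam c / mu c * (real K * 0)))) / (1 - rho)"
    by (rule Lim_transform_eventually)
  then show ?thesis by simp
qed

text \<open>The order of choice matters: \<open>\<epsilon>\<close> makes the smoothing error at most
  \<open>e / 2\<close>, then \<open>K\<close> makes the geometric cutoff small, and only then the
  number of nodes grows.\<close>

lemma eventually_conc_error_less:
  assumes "0 < e"
  shows "\<exists>\<epsilon>>0. \<exists>K. \<forall>\<^sub>F N in sequentially. stationary_network.conc_error (n N) lam mu nu \<epsilon> K < e"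
proof -
  let ?m = "stationary_network.max_load mu nu"
  have m: "0 \<le> ?m" by (rule stationary_network.max_load_nonneg[OF first_network])
  define \<epsilon> where "\<epsilon> = e / (2 * (1 + ?m)\<^sup>2)"
  have e: "0 < \<epsilon>" using assms m by (simp add: \<epsilon>_def)
  have "(1 + ?m) * (\<epsilon> * ?m) \<le> (1 + ?m) * (\<epsilon> * (1 + ?m))"
    using m e by (intro mult_left_mono) auto
  also have "\<dots> = e / 2"
  proof -
    have "a * (e / (2 * a\<^sup>2) * a) = e / 2" if "a \<noteq> 0" for a
      using that by (simp add: power2_eq_square)
    then show ?thesis using m unfolding \<epsilon>_def by simp
  qed
  finally have "(1 + ?m) * (\<epsilon> * ?m + 0) < e" using assms by simp
  moreover have "(\<lambda>K. (1 + ?m) * (\<epsilon> * ?m + (\<Sum>c\<in>UNIV. nu c / mu c * xi c ^ Suc K))) \<longlonglongrightarrow> (1 + ?m) * (\<epsilon> * ?m + (\<Sum>c\<in>(UNIV::'c set). nu c / mu c * 0))"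
    using xi_pos xi_less_1 by (intro tendsto_intros LIMSEQ_Suc[OF LIMSEQ_power_zero]) (simp add: less_imp_le)
  ultimately have "\<forall>\<^sub>F K in sequentially. (1 + ?m) * (\<epsilon> * ?m + (\<Sum>c\<in>UNIV. nu c / mu c * xi c ^ Suc K)) < e"
    by (intro order_tendstoD(2)) auto
  then obtain K where K: "(1 + ?m) * (\<epsilon> * ?m + (\<Sum>c\<in>UNIV. nu c / mu c * xi c ^ Suc K)) < e"
    by (auto simp: eventually_sequentially)
  show ?thesis
    using order_tendstoD(2)[OF conc_error_tendsto[OF e] K] e by blast
qed

lemma idle_asymptotically_independent:
  assumes v: "\<And>N. CARD('c) \<le> N \<Longrightarrow> (c, j N) \<in> nodes (n N)"
  shows "(\<lambda>N. queue_prob N (c, j N) k - queue_idle_prob N (c, j N) k / (1 - rho)) \<longlonglongrightarrow> 0"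
proof (rule LIMSEQ_I)
  fix r :: real assume r: "0 < r"
  obtain \<epsilon> K where e: "0 < \<epsilon>" and K: "\<forall>\<^sub>F N in sequentially. stationary_network.conc_error (n N) lam mu nu \<epsilon> K < r / 4"
    using eventually_conc_error_less[of "r / 4"] r by auto
  have "(\<lambda>N. (\<Sum>d\<in>UNIV. 1 / mu d) * (lam c / real (n N c) + nu c / real (n N c))) \<longlonglongrightarrow> (\<Sum>d\<in>(UNIV::'c set). 1 / mu d) * (0 + 0)"
    by (intro tendsto_intros div_class_size)
  then have "\<forall>\<^sub>F N in sequentially. (\<Sum>d\<in>UNIV. 1 / mu d) * (lam c / real (n N c) + nu c / real (n N c)) < r / 2"
    using r by (intro order_tendstoD(2)) auto
  then have "\<forall>\<^sub>F N in sequentially. norm (queue_prob N (c, j N) k - queue_idle_prob N (c, j N) k / (1 - rho) - 0) < r"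
    using K eventually_ge_at_top[of "CARD('c)"]
  proof eventually_elim
    case (elim N)
    interpret net: stationary_network "n N" lam mu nu "\<pi> N" using network[OF elim(3)] .
    show ?case
      using net.idle_almost_independent[OF e v[OF elim(3)], of k K, unfolded net.arr_def net.bk_def fst_conv] elim(1,2)
      unfolding real_norm_def diff_0_right by linarith
  qed
  then show "\<exists>no. \<forall>N\<ge>no. norm (queue_prob N (c, j N) k - queue_idle_prob N (c, j N) k / (1 - rho) - 0) < r"
    by (simp add: eventually_sequentially)
qed

text \<open>For length zero, the exact probability of an idle network with an empty queue, divided
  by \<open>1 - rho\<close>, is \<open>1 - xi c\<close>. The cut equation then gives a factor
  \<open>xi c\<close> per length, and asymptotic independence passes from idle probabilities to
  unconditional ones.\<close>

lemma queue_prob_tendsto: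
  assumes v: "\<And>N. CARD('c) \<le> N \<Longrightarrow> (c, j N) \<in> nodes (n N)"
  shows "(\<lambda>N. queue_prob N (c, j N) k) \<longlonglongrightarrow> (1 - xi c) * xi c ^ k"
proof (induction k)
  case 0
  have "\<forall>\<^sub>F N in sequentially. queue_prob N (c, j N) 0 - queue_idle_prob N (c, j N) 0 / (1 - rho) + (1 - xi c) = queue_prob N (c, j N) 0"
    using eventually_ge_at_top[of "CARD('c)"]
  proof eventually_elim
    case (elim N)
    interpret net: stationary_network "n N" lam mu nu "\<pi> N" using network[OF elim] .
    have "queue_idle_prob N (c, j N) 0 = net.E (\<lambda>s. of_bool (snd s = None) - of_bool (0 < fst s (c, j N) \<and> snd s = None))"
      by (intro Bochner_Integration.integral_cong refl) (auto simp: of_bool_def)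
    also have "\<dots> = 1 - rho - lam c / nu c"
      using net.expectation_nonempty_idle[OF v[OF elim]] by (simp add: net.expectation_idle)
    finally have "queue_idle_prob N (c, j N) 0 / (1 - rho) = 1 - xi c"
      using rho_less_1 nu_pos[of c] by (simp add: net.xi_def diff_divide_distrib)
    then show ?case by simp
  qed
  moreover have "(\<lambda>N. queue_prob N (c, j N) 0 - queue_idle_prob N (c, j N) 0 / (1 - rho) + (1 - xi c)) \<longlonglongrightarrow> 0 + (1 - xi c)"
    by (intro tendsto_intros idle_asymptotically_independent v)
  ultimately have "(\<lambda>N. queue_prob N (c, j N) 0) \<longlonglongrightarrow> 0 + (1 - xi c)"
    by (rule Lim_transform_eventually[rotated])
  then show ?case by simp
next
  case (Suc k)
  have "\<forall>\<^sub>F N in sequentially. queue_prob N (c, j N) (Suc k) - queue_idle_prob N (c, j N) (Suc k) / (1 - rho)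
      + xi c * queue_prob N (c, j N) k = queue_prob N (c, j N) (Suc k)"
    using eventually_ge_at_top[of "CARD('c)"]
  proof eventually_elim
    case (elim N)
    interpret net: stationary_network "n N" lam mu nu "\<pi> N" using network[OF elim] .
    have "queue_idle_prob N (c, j N) (Suc k) / (1 - rho) = xi c * queue_prob N (c, j N) k"
      using net.expectation_queue_Suc_idle[OF v[OF elim], of k] rho_less_1 nu_pos[of c] by (simp add: net.xi_def field_simps)
    then show ?case by simp
  qed
  moreover have "(\<lambda>N. queue_prob N (c, j N) (Suc k) - queue_idle_prob N (c, j N) (Suc k) / (1 - rho) + xi c * queue_prob N (c, j N) k)
      \<longlonglongrightarrow> 0 + xi c * ((1 - xi c) * xi c ^ k)"
    by (intro tendsto_intros idle_asymptotically_independent v Suc)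
  ultimately have "(\<lambda>N. queue_prob N (c, j N) (Suc k)) \<longlonglongrightarrow> 0 + xi c * ((1 - xi c) * xi c ^ k)"
    by (rule Lim_transform_eventually[rotated])
  then show ?case by (simp add: mult.left_commute)
qed

text \<open>Finitely many terms of the geometric mean come within \<open>\<delta>\<close> of it, and
  those terms converge; the rest of the mean is nonnegative. Mass escaping to long queues cannot
  hurt in this direction.\<close>

lemma eventually_mean_ge:
  assumes v: "\<And>N. CARD('c) \<le> N \<Longrightarrow> (c, j N) \<in> nodes (n N)" and \<delta>: "0 < \<delta>"
  shows "\<forall>\<^sub>F N in sequentially. ennreal (xi c / (1 - xi c) - \<delta>) \<le> mean N (c, j N)"
proof -
  have "(\<lambda>k. real k * ((1 - xi c) * xi c ^ k)) sums (xi c / (1 - xi c))"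
  proof -
    have "(\<lambda>k. real k * xi c ^ k) sums (xi c / (1 - xi c)\<^sup>2)"
      using sums_Suc[of "\<lambda>k. real k * xi c ^ k"] sums_mult[OF geometric_deriv_sums[of "xi c"], of "xi c"]
        xi_pos[of c] xi_less_1[of c] by (simp add: mult.left_commute)
    from sums_mult[OF this, of "1 - xi c"] show ?thesis
      using xi_less_1[of c] by (simp add: power2_eq_square mult.left_commute)
  qed
  then have "(\<lambda>K. \<Sum>k<K. real k * ((1 - xi c) * xi c ^ k)) \<longlonglongrightarrow> xi c / (1 - xi c)"
    by (simp add: sums_def)
  then have "\<forall>\<^sub>F K in sequentially. xi c / (1 - xi c) - \<delta> < (\<Sum>k<K. real k * ((1 - xi c) * xi c ^ k))"
    using \<delta> by (intro order_tendstoD(1)) auto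
  then obtain K where K: "xi c / (1 - xi c) - \<delta> < (\<Sum>k<K. real k * ((1 - xi c) * xi c ^ k))"
    by (auto simp: eventually_sequentially)
  have "(\<lambda>N. \<Sum>k<K. real k * queue_prob N (c, j N) k) \<longlonglongrightarrow> (\<Sum>k<K. real k * ((1 - xi c) * xi c ^ k))"
    by (intro tendsto_intros queue_prob_tendsto v)
  from order_tendstoD(1)[OF this K] show ?thesis
    using eventually_ge_at_top[of "CARD('c)"]
  proof eventually_elim
    case (elim N)
    interpret net: stationary_network "n N" lam mu nu "\<pi> N" using network[OF elim(2)] .
    show ?case
      using net.partial_mean_le[where K=K and v="(c, j N)"] ennreal_leI[OF less_imp_le[OF elim(1)]] by (rule order_trans[rotated])
  qed
qed

theorem mean_queue_tendsto:
  assumes v: "\<And>N. CARD('c) \<le> N \<Longrightarrow> (c, j N) \<in> nodes (n N)"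
  shows "(\<lambda>N. mean N (c, j N)) \<longlonglongrightarrow> ennreal (xi c / (1 - xi c))"
proof -
  define r where "r N d = enn2real (mean N (d, 0))" for N and d :: 'c
  let ?mc = "stationary_network.moment_const lam mu" and ?s = "stationary_network.slack lam mu nu"
  define B where "B N = ?mc / real N" for N
  \<comment> \<open>For fewer nodes than classes nothing is known, so the weights are set to zero
    there to satisfy their bounds for all \<open>N\<close>.\<close>
  define w where "w N d = (if CARD('c) \<le> N then real (n N d) / real N else 0)" for N d
  have node0: "(d, 0) \<in> nodes (n N)" if "CARD('c) \<le> N" for d N
  proof -
    interpret net: stationary_network "n N" lam mu nu "\<pi> N" using network[OF that] .
    show ?thesis using net.n_pos by (simp add: nodes_def)
  qed
  have rN: "mean N (d, 0) = ennreal (r N d)" if "CARD('c) \<le> N" for N d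
    using stationary_network.mean_queue_finite[OF network node0, OF that that] by (simp add: r_def)
  have "(\<lambda>N. r N c) \<longlonglongrightarrow> xi c / (1 - xi c)"
  proof (rule tendsto_of_weighted_sum_le[where w=w and p=p and s="?s" and B=B])
    show "0 \<le> w N d" for N d by (simp add: w_def)
    show "w N d \<le> 1" for N d
    proof (cases "CARD('c) \<le> N")
      case True
      have "n N d \<le> (\<Sum>d\<in>UNIV. n N d)" by (rule member_le_sum) auto
      then show ?thesis using total[OF True] by (simp add: w_def divide_le_eq)
    qed (simp add: w_def)
    have ev: "\<forall>\<^sub>F N in sequentially. real (n N d) / real N = w N d" for d
      using eventually_ge_at_top[of "CARD('c)"] by eventually_elim (simp add: w_def)
    show "(\<lambda>N. w N d) \<longlonglongrightarrow> p d" for d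
      by (rule Lim_transform_eventually[OF fractions(1) ev])
    show "0 < ?s d" for d by (rule stationary_network.slack_pos[OF first_network])
    show "B \<longlonglongrightarrow> 0" unfolding B_def by (rule lim_const_over_n)
    show "\<forall>\<^sub>F N in sequentially. xi d / (1 - xi d) - \<delta> \<le> r N d" if "0 < \<delta>" for d \<delta>
    proof -
      have "\<forall>\<^sub>F N in sequentially. ennreal (xi d / (1 - xi d) - \<delta>) \<le> mean N (d, 0)"
        using node0 that by (rule eventually_mean_ge[where j="\<lambda>_. 0"])
      then show ?thesis
        using eventually_ge_at_top[of "CARD('c)"]
    proof eventually_elim
      case (elim N)
      then show ?case unfolding rN[OF elim(2)] by (simp add: r_def ennreal_le_iff)
    qed
    qed
    show "\<forall>\<^sub>F N in sequentially. (\<Sum>d\<in>UNIV. w N d * (?s d * (r N d - xi d / (1 - xi d)))) \<le> B N"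
      using eventually_ge_at_top[of "CARD('c)"] eventually_gt_at_top[of 0]
    proof eventually_elim
      case (elim N)
      interpret net: stationary_network "n N" lam mu nu "\<pi> N" using network[OF elim(1)] .
      have r0: "0 \<le> r N d" for d by (simp add: r_def)
      have "(\<Sum>d\<in>UNIV. ennreal (real (n N d) * net.slack d) * net.mean_queue (d, 0)) = ennreal (\<Sum>d\<in>UNIV. real (n N d) * net.slack d * r N d)"
        unfolding rN[OF elim(1)]
        by (subst sum_ennreal[symmetric]) (auto simp: ennreal_mult r0 less_imp_le[OF net.slack_pos])
      then have "ennreal (\<Sum>d\<in>UNIV. real (n N d) * net.slack d * r N d)
        \<le> ennreal (net.moment_const + (\<Sum>c\<in>UNIV. real (n N c) * (lam c / (nu c * mu c))))"
        using net.weighted_mean_queue_sum_le by simp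
      moreover have "0 \<le> net.moment_const + (\<Sum>c\<in>UNIV. real (n N c) * (lam c / (nu c * mu c)))"
        unfolding net.moment_const_def by (intro add_nonneg_nonneg sum_nonneg) (auto simp: net.rates_ge_0)
      \<comment> \<open>\<open>slack_mean\<close> replaces the leading term by the same weighted sum
        of the limits; after division by \<open>N\<close> only \<open>moment_const / N\<close> is
        left.\<close>
      ultimately have "(\<Sum>d\<in>UNIV. real (n N d) * net.slack d * r N d)
        \<le> net.moment_const + (\<Sum>d\<in>UNIV. real (n N d) * (net.slack d * (xi d / (1 - xi d))))"
        unfolding net.slack_mean by (subst (asm) ennreal_le_iff) auto
      then have "(\<Sum>d\<in>UNIV. real (n N d) * (net.slack d * (r N d - xi d / (1 - xi d)))) \<le> net.moment_const"
        by (simp add: right_diff_distrib sum_subtractf mult.assoc)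
      then have "(\<Sum>d\<in>UNIV. real (n N d) * (net.slack d * (r N d - xi d / (1 - xi d)))) / real N \<le> net.moment_const / real N"
        by (intro divide_right_mono) auto
      then show ?case using elim(1) by (simp add: w_def B_def sum_divide_distrib)
    qed
  qed (rule fractions)
  then have "(\<lambda>N. ennreal (r N c)) \<longlonglongrightarrow> ennreal (xi c / (1 - xi c))"
    by (rule tendsto_ennrealI)
  moreover have "\<forall>\<^sub>F N in sequentially. ennreal (r N c) = mean N (c, j N)"
    using eventually_ge_at_top[of "CARD('c)"]
  proof eventually_elim
    case (elim N)
    interpret net: stationary_network "n N" lam mu nu "\<pi> N" using network[OF elim] .
    have "net.mean_queue (c, j N) = net.mean_queue (c, 0)"
      unfolding net.mean_queue_def using net.queue_law_exchangeable[OF v[OF elim] node0[OF elim]] by simp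
    then show ?case using rN[OF elim] by simp
  qed
  ultimately show ?thesis by (rule Lim_transform_eventually)
qed

end

section \<open>The stationary jump process\<close>

text \<open>The state type of the network is uncountable, so events are decomposed over a countable
  set \<open>S\<close> that carries the law and is closed under transitions.\<close>

locale jump_process = rate_matrix q L
  for q :: "'s \<Rightarrow> 's \<Rightarrow> real" and L :: real +
  fixes \<pi> :: "'s pmf" and S :: "'s set"
    and M :: "'w measure" and Y :: "nat \<Rightarrow> 'w \<Rightarrow> 's" and H :: "nat \<Rightarrow> 'w \<Rightarrow> real"
  assumes stationary: "stationary_pmf q \<pi>"
    and support: "set_pmf \<pi> \<subseteq> S"
    and countable_S: "countable S"
    and closed: "s \<in> S \<Longrightarrow> q s s' \<noteq> 0 \<Longrightarrow> s' \<in> S"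
    and process: "markov_jump_process q \<pi> M Y H"
begin

sublocale prob_space M
  using process by (simp add: markov_jump_process_def)

lemma measurable_Y [measurable]: "Y k \<in> measurable M (count_space UNIV)"
  and measurable_H [measurable]: "H k \<in> borel_measurable M"
  using process by (auto simp: markov_jump_process_def)

lemma measurable_Y_in [measurable]: "Measurable.pred M (\<lambda>\<omega>. Y k \<omega> \<in> A)"
  by (rule measurable_compose[OF measurable_Y]) simp

abbreviation P :: "'s \<Rightarrow> 's \<Rightarrow> real" where
  "P s s' \<equiv> q s s' / exit_rate q s"

lemma P_nonneg: "0 \<le> P s s'"
  by (simp add: rate_nonneg)

lemma sum_P:
  assumes "s \<in> S"
  shows "(\<integral>\<^sup>+s'. ennreal (P s s') \<partial>count_space S) = 1"
proof -
  have "(\<integral>\<^sup>+s'. ennreal (P s s') \<partial>count_space S) = (\<integral>\<^sup>+s'. ennreal (P s s') \<partial>count_space UNIV)"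
  proof (rule nn_integral_count_space_eq)
    fix s' assume "s' \<in> UNIV - S"
    then have "q s s' = 0" using closed[OF assms] by blast
    then show "ennreal (P s s') = 0" by simp
  qed auto
  also have "\<dots> = (\<integral>\<^sup>+s'. ennreal (1 / exit_rate q s) * ennreal (q s s') \<partial>count_space UNIV)"
    by (intro nn_integral_cong) (simp add: ennreal_mult[symmetric] rate_nonneg)
  also have "\<dots> = 1"
    using exit_rate_pos[of s] by (simp add: nn_integral_cmult nn_integral_rate ennreal_mult[symmetric])
  finally show ?thesis .
qed

definition cylinder :: "nat \<Rightarrow> (nat \<Rightarrow> 's) \<Rightarrow> (nat \<Rightarrow> real) \<Rightarrow> 'w set" where
  "cylinder n \<sigma> t = {\<omega> \<in> space M. (\<forall>k\<le>n. Y k \<omega> = \<sigma> k) \<and> (\<forall>k<n. t k < H k \<omega>)}"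

lemma sets_cylinder [measurable]: "cylinder n \<sigma> t \<in> sets M"
  unfolding cylinder_def by measurable

lemma emeasure_cylinder:
  assumes "\<And>k. k < n \<Longrightarrow> 0 \<le> t k"
  shows "emeasure M (cylinder n \<sigma> t) = ennreal (pmf \<pi> (\<sigma> 0) *
     (\<Prod>k<n. P (\<sigma> k) (\<sigma> (Suc k)) * exp (- exit_rate q (\<sigma> k) * t k)))"
  using process assms unfolding markov_jump_process_def cylinder_def
  by (simp add: emeasure_eq_measure)

lemma emeasure_cylinder_Suc:
  assumes "\<And>k. k < n \<Longrightarrow> 0 \<le> t k" "0 \<le> u"
  shows "emeasure M {\<omega> \<in> cylinder n \<sigma> t. u < H n \<omega> \<and> Y (Suc n) \<omega> = s'}
     = emeasure M (cylinder n \<sigma> t) * ennreal (P (\<sigma> n) s' * exp (- exit_rate q (\<sigma> n) * u))"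
proof -
  have eq: "{\<omega> \<in> cylinder n \<sigma> t. u < H n \<omega> \<and> Y (Suc n) \<omega> = s'} = cylinder (Suc n) (\<sigma>(Suc n := s')) (t(n := u))"
    unfolding cylinder_def by (auto simp: le_Suc_eq less_Suc_eq)
  have pr: "(\<Prod>k<n. P ((\<sigma>(Suc n := s')) k) ((\<sigma>(Suc n := s')) (Suc k)) * exp (- exit_rate q ((\<sigma>(Suc n := s')) k) * (t(n := u)) k))
     = (\<Prod>k<n. P (\<sigma> k) (\<sigma> (Suc k)) * exp (- exit_rate q (\<sigma> k) * t k))"
    by (intro prod.cong) auto
  let ?w = "pmf \<pi> (\<sigma> 0) * (\<Prod>k<n. P (\<sigma> k) (\<sigma> (Suc k)) * exp (- exit_rate q (\<sigma> k) * t k))"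
  let ?p = "P (\<sigma> n) s' * exp (- exit_rate q (\<sigma> n) * u)"
  have "emeasure M (cylinder (Suc n) (\<sigma>(Suc n := s')) (t(n := u)))
    = ennreal (pmf \<pi> ((\<sigma>(Suc n := s')) 0) * (\<Prod>k<Suc n. P ((\<sigma>(Suc n := s')) k) ((\<sigma>(Suc n := s')) (Suc k)) * exp (- exit_rate q ((\<sigma>(Suc n := s')) k) * (t(n := u)) k)))"
    by (rule emeasure_cylinder) (use assms in \<open>auto simp: less_Suc_eq\<close>)
  also have "\<dots> = ennreal (?w * ?p)"
    unfolding prod.lessThan_Suc pr by (simp add: mult.assoc)
  also have "\<dots> = ennreal ?w * ennreal ?p"
    by (rule ennreal_mult) (intro mult_nonneg_nonneg prod_nonneg P_nonneg exp_ge_zero pmf_nonneg)+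
  also have "ennreal ?w = emeasure M (cylinder n \<sigma> t)"
    using assms by (simp add: emeasure_cylinder)
  finally show ?thesis unfolding eq .
qed

lemma countable_paths: "countable (Pi\<^sub>E {..n::nat} (\<lambda>_. S))"
  by (rule countable_PiE) (auto simp: countable_S)

text \<open>Given a path prefix in \<open>S\<close>, the transition probabilities into
  \<open>S\<close> sum to one and the threshold \<open>0\<close> costs nothing, so the extended
  cylinders exhaust the prefix. This yields positive holding times as well as confinement to
  \<open>S\<close>.\<close>

lemma AE_states: "AE \<omega> in M. (\<forall>k\<le>n. Y k \<omega> \<in> S) \<and> (\<forall>k<n. 0 < H k \<omega>)"
proof (induction n)
  case 0
  have "emeasure M {\<omega> \<in> space M. Y 0 \<omega> \<in> S} = emeasure M (\<Union>s\<in>S. cylinder 0 (\<lambda>_. s) (\<lambda>_. 0))"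
    by (rule arg_cong[where f="emeasure M"]) (auto simp: cylinder_def)
  also have "\<dots> = (\<integral>\<^sup>+s. emeasure M (cylinder 0 (\<lambda>_. s) (\<lambda>_. 0)) \<partial>count_space S)"
    by (rule emeasure_UN_countable) (auto simp: countable_S disjoint_family_on_def cylinder_def)
  also have "\<dots> = 1"
    using support by (simp add: emeasure_cylinder nn_integral_pmf measure_pmf.emeasure_eq_1_AE AE_measure_pmf_iff subset_eq)
  finally have "AE \<omega> in M. Y 0 \<omega> \<in> S"
    by (intro AE_I_eq_1) auto
  then show ?case by simp
next
  case (Suc n)
  have paths: "AE \<omega> in M. \<forall>\<sigma>\<in>Pi\<^sub>E {..n} (\<lambda>_. S). \<omega> \<in> cylinder n \<sigma> (\<lambda>_. 0) \<longrightarrow> Y (Suc n) \<omega> \<in> S \<and> 0 < H n \<omega>"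
  proof (intro AE_ball_countable' countable_paths)
    fix \<sigma> assume \<sigma>: "\<sigma> \<in> Pi\<^sub>E {..n} (\<lambda>_. S)"
    let ?C = "cylinder n \<sigma> (\<lambda>_. 0)"
    let ?G = "{\<omega> \<in> space M. \<omega> \<in> ?C \<and> Y (Suc n) \<omega> \<in> S \<and> 0 < H n \<omega>}"
    have [measurable]: "?G \<in> sets M" by measurable
    have "emeasure M ?G = emeasure M (\<Union>s\<in>S. {\<omega> \<in> ?C. 0 < H n \<omega> \<and> Y (Suc n) \<omega> = s})"
      by (rule arg_cong[where f="emeasure M"]) (auto simp: cylinder_def)
    also have "\<dots> = (\<integral>\<^sup>+s. emeasure M {\<omega> \<in> ?C. 0 < H n \<omega> \<and> Y (Suc n) \<omega> = s} \<partial>count_space S)"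
      by (rule emeasure_UN_countable) (auto simp: countable_S disjoint_family_on_def)
    also have "\<dots> = emeasure M ?C * (\<integral>\<^sup>+s. ennreal (P (\<sigma> n) s) \<partial>count_space S)"
      by (simp add: emeasure_cylinder_Suc nn_integral_cmult)
    also have "\<dots> = emeasure M ?C" using \<sigma> by (subst sum_P) auto
    finally have "emeasure M (?C - ?G) = 0"
      by (subst emeasure_Diff) (auto simp: emeasure_eq_measure)
    then show "AE \<omega> in M. \<omega> \<in> ?C \<longrightarrow> Y (Suc n) \<omega> \<in> S \<and> 0 < H n \<omega>"
      by (intro AE_I[of _ _ "?C - ?G"]) (auto simp: cylinder_def)
  qed
  show ?case
    using Suc paths AE_space
  proof eventually_elim
    case (elim \<omega>)
    then have "restrict (\<lambda>k. Y k \<omega>) {..n} \<in> Pi\<^sub>E {..n} (\<lambda>_. S)" by auto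
    moreover have "\<omega> \<in> space M \<Longrightarrow> \<omega> \<in> cylinder n (restrict (\<lambda>k. Y k \<omega>) {..n}) (\<lambda>_. 0)"
      using elim(1) by (auto simp: cylinder_def)
    ultimately show ?case using elim by (auto simp: le_Suc_eq less_Suc_eq)
  qed
qed

lemma AE_path: "AE \<omega> in M. \<forall>k. Y k \<omega> \<in> S \<and> 0 < H k \<omega>"
proof -
  have "AE \<omega> in M. \<forall>n. (\<forall>k\<le>n. Y k \<omega> \<in> S) \<and> (\<forall>k<n. 0 < H k \<omega>)"
    using AE_states by (simp add: AE_all_countable)
  then show ?thesis by eventually_elim auto
qed

definition rect :: "nat \<Rightarrow> (nat \<Rightarrow> 's set) \<Rightarrow> (nat \<Rightarrow> real set) \<Rightarrow> 'w set" where
  "rect n A B = {\<omega> \<in> space M. (\<forall>k\<le>n. Y k \<omega> \<in> A k) \<and> (\<forall>k<n. H k \<omega> \<in> B k)}"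

text \<open>Half-lines match the events that define the process; \<open>UNIV\<close> leaves a
  coordinate free, so that the rectangles include the whole space.\<close>

definition half_lines :: "real set set" where
  "half_lines = insert UNIV (range greaterThan)"

definition rects :: "nat \<Rightarrow> 'w set set" where
  "rects n = {rect n A B |A B. B \<in> UNIV \<rightarrow> half_lines}"

text \<open>What is known on entering state \<open>Y n\<close>: the states up to \<open>n\<close>,
  but the holding times only before \<open>n\<close>.\<close>

definition history :: "nat \<Rightarrow> 'w measure" where
  "history n = sigma (space M) (rects n)"

lemma half_lines_borel [measurable]: "B \<in> half_lines \<Longrightarrow> B \<in> sets borel"
  by (auto simp: half_lines_def)

lemma sets_rect: "B \<in> UNIV \<rightarrow> half_lines \<Longrightarrow> rect n A B \<in> sets M"
proof -
  assume "B \<in> UNIV \<rightarrow> half_lines"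
  then have [measurable]: "B k \<in> sets borel" for k by (auto intro: half_lines_borel)
  show ?thesis unfolding rect_def by measurable
qed

lemma rects_subset: "rects n \<subseteq> sets M"
  unfolding rects_def using sets_rect by auto

lemma space_history [simp]: "space (history n) = space M"
  by (simp add: history_def space_measure_of_conv)

lemma sets_history: "sets (history n) = sigma_sets (space M) (rects n)"
  unfolding history_def by (rule sets_measure_of) (auto simp: rects_def rect_def)

lemma history_subset: "sets (history n) \<subseteq> sets M"
  unfolding sets_history using rects_subset by (rule sets.sigma_sets_subset)

lemma measurable_from_history: "f \<in> measurable (history n) N \<Longrightarrow> f \<in> measurable M N"
  using history_subset[of n] by (auto simp: measurable_def)

lemma rect_UNIV: "rect n (\<lambda>_. UNIV) (\<lambda>_. UNIV) = space M"
  by (simp add: rect_def)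

lemma measurable_Y_history [measurable]:
  assumes "k \<le> n"
  shows "Y k \<in> measurable (history n) (count_space UNIV)"
proof (rule measurableI)
  fix A
  have "Y k -` A \<inter> space (history n) = rect n ((\<lambda>_. UNIV)(k := A)) (\<lambda>_. UNIV)"
    using assms by (auto simp: rect_def)
  also have "\<dots> \<in> rects n"
    unfolding rects_def by (intro CollectI exI conjI refl) (auto simp: half_lines_def)
  finally show "Y k -` A \<inter> space (history n) \<in> sets (history n)"
    unfolding sets_history by (rule sigma_sets.Basic)
qed simp

lemma measurable_H_history [measurable]:
  assumes "k < n"
  shows "H k \<in> borel_measurable (history n)"
proof (rule borel_measurableI_greater)
  fix u
  have "{\<omega> \<in> space (history n). u < H k \<omega>} = rect n (\<lambda>_. UNIV) ((\<lambda>_. UNIV)(k := {u<..}))"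
    using assms by (auto simp: rect_def)
  also have "\<dots> \<in> rects n"
    unfolding rects_def by (intro CollectI exI conjI refl) (auto simp: half_lines_def)
  finally show "{\<omega> \<in> space (history n). u < H k \<omega>} \<in> sets (history n)"
    unfolding sets_history by (rule sigma_sets.Basic)
qed

lemma Int_stable_rects: "Int_stable (rects n)"
proof (rule Int_stableI)
  fix a b assume "a \<in> rects n" "b \<in> rects n"
  then obtain A B A' B' where ab: "a = rect n A B" "b = rect n A' B'" "B \<in> UNIV \<rightarrow> half_lines" "B' \<in> UNIV \<rightarrow> half_lines"
    by (auto simp: rects_def)
  have "a \<inter> b = rect n (\<lambda>k. A k \<inter> A' k) (\<lambda>k. B k \<inter> B' k)"
    by (auto simp: ab rect_def)
  moreover have "X \<inter> X' \<in> half_lines" if "X \<in> half_lines" "X' \<in> half_lines" for X X'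
  proof -
    have "{x<..} \<inter> {y<..} = {max x y<..}" for x y :: real by auto
    then show ?thesis using that by (auto simp: half_lines_def)
  qed
  then have "(\<lambda>k. B k \<inter> B' k) \<in> UNIV \<rightarrow> half_lines" using ab by auto
  ultimately show "a \<inter> b \<in> rects n" by (auto simp: rects_def)
qed

text \<open>A rectangle with last state \<open>s\<close> is, up to a null set, a countable disjoint
  union of cylinders over paths in \<open>S\<close>, and all of them acquire the same transition
  factor.\<close>

lemma markov_rect:
  assumes B: "B \<in> UNIV \<rightarrow> half_lines" and u: "0 \<le> u" and s: "s \<in> S"
  shows "emeasure M {\<omega> \<in> rect n A B. Y n \<omega> = s \<and> u < H n \<omega> \<and> Y (Suc n) \<omega> = s'}
     = emeasure M {\<omega> \<in> rect n A B. Y n \<omega> = s} * ennreal (P s s' * exp (- exit_rate q s * u))"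
proof -
  \<comment> \<open>Free coordinates and negative thresholds become the threshold \<open>0\<close>,
    which changes nothing because holding times are almost surely positive.\<close>
  define t where "t k = (if B k = UNIV then 0 else max 0 (SOME r. B k = {r<..}))" for k
  have t: "0 \<le> t k" for k by (simp add: t_def)
  have Bt: "h \<in> B k \<longleftrightarrow> t k < h" if "0 < h" for h k
  proof (cases "B k = UNIV")
    case False
    then obtain r where "B k = {r<..}" using B by (force simp: half_lines_def Pi_iff)
    then have "B k = {SOME r. B k = {r<..}<..}" by (metis (mono_tags, lifting) someI_ex)
    then show ?thesis using False that by (auto simp: t_def)
  qed (use that in \<open>simp add: t_def\<close>)
  let ?I = "{\<sigma> \<in> Pi\<^sub>E {..n} (\<lambda>_. S). (\<forall>k\<le>n. \<sigma> k \<in> A k) \<and> \<sigma> n = s}"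
  have cI: "countable ?I" by (rule countable_subset[OF _ countable_paths[of n]]) auto
  have mr [measurable]: "rect n A B \<in> sets M" using B by (rule sets_rect)
  have disj: "disjoint_family_on (\<lambda>\<sigma>. {\<omega> \<in> cylinder n \<sigma> t. Q \<omega>}) ?I" for Q
  proof (unfold disjoint_family_on_def, intro ballI impI)
    fix \<sigma> \<tau> assume a: "\<sigma> \<in> ?I" "\<tau> \<in> ?I" "\<sigma> \<noteq> \<tau>"
    then obtain k where "k \<le> n" "\<sigma> k \<noteq> \<tau> k"
      by (metis (mono_tags, lifting) PiE_ext atMost_iff mem_Collect_eq)
    then show "{\<omega> \<in> cylinder n \<sigma> t. Q \<omega>} \<inter> {\<omega> \<in> cylinder n \<tau> t. Q \<omega>} = {}"
      by (auto simp: cylinder_def)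
  qed
  have ae: "AE \<omega> in M. \<omega> \<in> {\<omega> \<in> rect n A B. Y n \<omega> = s \<and> Q \<omega>} \<longleftrightarrow> \<omega> \<in> (\<Union>\<sigma>\<in>?I. {\<omega> \<in> cylinder n \<sigma> t. Q \<omega>})" for Q
    using AE_states[of n] AE_space
  proof eventually_elim
    case (elim \<omega>)
    let ?\<sigma> = "restrict (\<lambda>k. Y k \<omega>) {..n}"
    have H: "H k \<omega> \<in> B k \<longleftrightarrow> t k < H k \<omega>" if "k < n" for k
      using elim(1) that by (intro Bt) auto
    show ?case
    proof
      assume a: "\<omega> \<in> {\<omega> \<in> rect n A B. Y n \<omega> = s \<and> Q \<omega>}"
      then have "?\<sigma> \<in> ?I" using elim by (auto simp: rect_def)
      moreover have "\<omega> \<in> {\<omega> \<in> cylinder n ?\<sigma> t. Q \<omega>}"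
        using a H elim by (auto simp: rect_def cylinder_def)
      ultimately show "\<omega> \<in> (\<Union>\<sigma>\<in>?I. {\<omega> \<in> cylinder n \<sigma> t. Q \<omega>})" by blast
    next
      assume "\<omega> \<in> (\<Union>\<sigma>\<in>?I. {\<omega> \<in> cylinder n \<sigma> t. Q \<omega>})"
      then show "\<omega> \<in> {\<omega> \<in> rect n A B. Y n \<omega> = s \<and> Q \<omega>}"
        using H elim by (auto simp: rect_def cylinder_def)
    qed
  qed
  have sum: "emeasure M {\<omega> \<in> rect n A B. Y n \<omega> = s \<and> Q \<omega>} = (\<integral>\<^sup>+\<sigma>. emeasure M {\<omega> \<in> cylinder n \<sigma> t. Q \<omega>} \<partial>count_space ?I)"
    if Q [measurable]: "Measurable.pred M Q" for Q
  proof -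
    have m: "{\<omega> \<in> cylinder n \<sigma> t. Q \<omega>} \<in> sets M" for \<sigma>
    proof -
      have "{\<omega> \<in> cylinder n \<sigma> t. Q \<omega>} = {\<omega> \<in> space M. \<omega> \<in> cylinder n \<sigma> t \<and> Q \<omega>}"
        using sets.sets_into_space[OF sets_cylinder] by blast
      then show ?thesis by simp
    qed
    have "{\<omega> \<in> rect n A B. Y n \<omega> = s \<and> Q \<omega>} = {\<omega> \<in> space M. \<omega> \<in> rect n A B \<and> Y n \<omega> = s \<and> Q \<omega>}"
      by (auto simp: rect_def)
    then have "emeasure M {\<omega> \<in> rect n A B. Y n \<omega> = s \<and> Q \<omega>} = emeasure M (\<Union>\<sigma>\<in>?I. {\<omega> \<in> cylinder n \<sigma> t. Q \<omega>})"
      by (intro emeasure_eq_AE ae sets.countable_UN'' cI m) simp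
    also have "\<dots> = (\<integral>\<^sup>+\<sigma>. emeasure M {\<omega> \<in> cylinder n \<sigma> t. Q \<omega>} \<partial>count_space ?I)"
      by (rule emeasure_UN_countable[OF m cI disj])
    finally show ?thesis .
  qed
  have "emeasure M {\<omega> \<in> rect n A B. Y n \<omega> = s \<and> u < H n \<omega> \<and> Y (Suc n) \<omega> = s'}
    = (\<integral>\<^sup>+\<sigma>. emeasure M {\<omega> \<in> cylinder n \<sigma> t. u < H n \<omega> \<and> Y (Suc n) \<omega> = s'} \<partial>count_space ?I)"
    by (rule sum) measurable
  also have "\<dots> = (\<integral>\<^sup>+\<sigma>. emeasure M {\<omega> \<in> cylinder n \<sigma> t. True} * ennreal (P s s' * exp (- exit_rate q s * u)) \<partial>count_space ?I)"
    using t u by (intro nn_integral_cong) (simp add: emeasure_cylinder_Suc)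
  also have "\<dots> = (\<integral>\<^sup>+\<sigma>. emeasure M {\<omega> \<in> cylinder n \<sigma> t. True} \<partial>count_space ?I) * ennreal (P s s' * exp (- exit_rate q s * u))"
    by (rule nn_integral_multc) simp
  also have "(\<integral>\<^sup>+\<sigma>. emeasure M {\<omega> \<in> cylinder n \<sigma> t. True} \<partial>count_space ?I) = emeasure M {\<omega> \<in> rect n A B. Y n \<omega> = s \<and> True}"
    by (rule sum[symmetric]) simp
  finally show ?thesis by simp
qed

text \<open>Both sides are finite measures in \<open>A\<close>, so Dynkin's argument extends the
  identity from rectangles to the whole history.\<close>

lemma markov_history:
  assumes A: "A \<in> sets (history n)" and u: "0 \<le> u" and s: "s \<in> S"
  shows "emeasure M {\<omega> \<in> A. Y n \<omega> = s \<and> u < H n \<omega> \<and> Y (Suc n) \<omega> = s'}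
     = emeasure M {\<omega> \<in> A. Y n \<omega> = s} * ennreal (P s s' * exp (- exit_rate q s * u))"
proof -
  let ?c = "P s s' * exp (- exit_rate q s * u)"
  define X where "X = {\<omega> \<in> space M. Y n \<omega> = s \<and> u < H n \<omega> \<and> Y (Suc n) \<omega> = s'}"
  define Z where "Z = {\<omega> \<in> space M. Y n \<omega> = s}"
  have [measurable]: "X \<in> sets M" "Z \<in> sets M" unfolding X_def Z_def by measurable
  have c: "0 \<le> ?c" by (intro mult_nonneg_nonneg P_nonneg) simp
  have rect: "measure M (rect n A B \<inter> X) = ?c * measure M (rect n A B \<inter> Z)" if "B \<in> UNIV \<rightarrow> half_lines" for A B
  proof -
    have "{\<omega> \<in> rect n A B. Y n \<omega> = s \<and> u < H n \<omega> \<and> Y (Suc n) \<omega> = s'} = rect n A B \<inter> X"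
      "{\<omega> \<in> rect n A B. Y n \<omega> = s} = rect n A B \<inter> Z" by (auto simp: X_def Z_def rect_def)
    then have "ennreal (measure M (rect n A B \<inter> X)) = ennreal (?c * measure M (rect n A B \<inter> Z))"
      using markov_rect[OF that u s, of n A s'] c by (simp add: emeasure_eq_measure ennreal_mult[symmetric] mult.commute)
    moreover have "0 \<le> ?c * measure M (rect n A B \<inter> Z)" using c by (rule mult_nonneg_nonneg) simp
    ultimately show ?thesis using ennreal_inj[OF measure_nonneg] by blast
  qed
  have sub: "rects n \<subseteq> Pow (space M)" by (auto simp: rects_def rect_def)
  have "A \<in> sigma_sets (space M) (rects n)" using A by (simp add: sets_history)
  then have "measure M (A \<inter> X) = ?c * measure M (A \<inter> Z)"
  proof (induction rule: sigma_sets_induct_disjoint[OF Int_stable_rects sub, consumes 1, case_names basic empty compl union])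
    case (basic A)
    then show ?case using rect by (auto simp: rects_def)
  next
    case empty
    show ?case by simp
  next
    case (compl A)
    then have [measurable]: "A \<in> sets M" using history_subset by (auto simp: sets_history)
    have whole: "measure M X = ?c * measure M Z"
      using rect[of "\<lambda>_. UNIV" "\<lambda>_. UNIV"] sets.sets_into_space[of X M] sets.sets_into_space[of Z M]
      by (simp add: rect_UNIV half_lines_def Int_absorb1)
    have "(space M - A) \<inter> W = W - (A \<inter> W)" if "W \<in> sets M" for W
      using sets.sets_into_space[OF that] by auto
    then show ?case using compl whole
      by (simp add: finite_measure_Diff right_diff_distrib)
  next
    case (union F)
    then have F: "F i \<in> sets M" for i using history_subset by (auto simp: sets_history)
    have U: "(\<lambda>i. measure M (F i \<inter> W)) sums measure M ((\<Union>i. F i) \<inter> W)" if "W \<in> sets M" for W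
      using finite_measure_UNION[of "\<lambda>i. F i \<inter> W"] F that union(1) by (auto simp: disjoint_family_on_def)
    have "(\<lambda>i. ?c * measure M (F i \<inter> Z)) sums (?c * measure M ((\<Union>i. F i) \<inter> Z))"
      by (intro sums_mult U) simp
    then show ?case using U[of X] union(3) sums_unique2 by fastforce
  qed
  moreover have "{\<omega> \<in> A. Y n \<omega> = s \<and> u < H n \<omega> \<and> Y (Suc n) \<omega> = s'} = A \<inter> X" "{\<omega> \<in> A. Y n \<omega> = s} = A \<inter> Z"
    using sets.sets_into_space[of A "history n"] A by (auto simp: X_def Z_def)
  ultimately show ?thesis
    using c by (simp add: emeasure_eq_measure ennreal_mult[symmetric] mult.commute)
qed

definition hold :: "'s \<Rightarrow> real measure" where
  "hold s = density lborel (\<lambda>h. ennreal (exponential_density (exit_rate q s) h))"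

lemma sets_hold [measurable_cong, simp]: "sets (hold s) = sets borel"
  by (simp add: hold_def)

lemma space_hold [simp]: "space (hold s) = UNIV"
  by (simp add: hold_def)

lemma prob_space_hold: "prob_space (hold s)"
  unfolding hold_def by (rule prob_space_exponential_density) (rule exit_rate_pos)

lemma emeasure_hold_greater: "emeasure (hold s) {u<..} = ennreal (exp (- exit_rate q s * max 0 u))"
proof -
  interpret h: prob_space "hold s" by (rule prob_space_hold)
  have D: "distributed (hold s) lborel (\<lambda>x. x) (exponential_density (exit_rate q s))"
  proof -
    have "distr (hold s) lborel (\<lambda>x. x) = hold s" by (intro distr_id2) simp
    then show ?thesis unfolding distributed_def by (simp add: hold_def)
  qed
  have ge: "emeasure (hold s) {a<..} = ennreal (exp (- exit_rate q s * a))" if "0 \<le> a" for a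
    using h.exponential_distributedD_gt[OF D that exit_rate_pos]
    by (simp add: h.emeasure_eq_measure mult.commute greaterThan_def)
  show ?thesis
  proof (cases "0 \<le> u")
    case False
    have "emeasure (hold s) {0<..} \<le> emeasure (hold s) {u<..}"
      using False by (intro emeasure_mono) auto
    then have "emeasure (hold s) {u<..} = 1"
      using ge[of 0] h.emeasure_le_1[of "{u<..}"] by simp
    then show ?thesis using False by simp
  qed (use ge in simp)
qed

text \<open>For fixed \<open>A\<close>, \<open>s\<close> and \<open>s'\<close> both sides are finite
  measures in \<open>B\<close>, so agreement on half-lines suffices; negative thresholds reduce to
  \<open>0\<close> by positivity of \<open>H n\<close>.\<close>

lemma emeasure_history_hold:
  assumes A: "A \<in> sets (history n)" and s: "s \<in> S" and B: "B \<in> sets borel"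
  shows "emeasure M {\<omega> \<in> A. Y n \<omega> = s \<and> Y (Suc n) \<omega> = s' \<and> H n \<omega> \<in> B}
     = emeasure M {\<omega> \<in> A. Y n \<omega> = s} * ennreal (P s s') * emeasure (hold s) B"
proof -
  have AM [measurable]: "A \<in> sets M" using A history_subset by auto
  define X where "X = {\<omega> \<in> space M. \<omega> \<in> A \<and> Y n \<omega> = s \<and> Y (Suc n) \<omega> = s'}"
  have [measurable]: "X \<in> sets M" unfolding X_def by measurable
  define c where "c = emeasure M {\<omega> \<in> A. Y n \<omega> = s} * ennreal (P s s')"
  define N1 where "N1 = distr (density M (indicator X)) borel (H n)"
  define N2 where "N2 = density (hold s) (\<lambda>_. c)"
  have sets: "sets N1 = sets borel" "sets N2 = sets borel" by (simp_all add: N1_def N2_def)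
  have N1: "emeasure N1 B = emeasure M {\<omega> \<in> A. Y n \<omega> = s \<and> Y (Suc n) \<omega> = s' \<and> H n \<omega> \<in> B}" if [measurable]: "B \<in> sets borel" for B
  proof -
    have "emeasure N1 B = emeasure M (X \<inter> (H n -` B \<inter> space M))"
      unfolding N1_def by (simp add: emeasure_distr emeasure_density nn_integral_indicator flip: indicator_inter_arith)
    also have "X \<inter> (H n -` B \<inter> space M) = {\<omega> \<in> A. Y n \<omega> = s \<and> Y (Suc n) \<omega> = s' \<and> H n \<omega> \<in> B}"
      using sets.sets_into_space[OF AM] by (auto simp: X_def)
    finally show ?thesis .
  qed
  have N2: "emeasure N2 B = c * emeasure (hold s) B" if "B \<in> sets borel" for B
    unfolding N2_def using that by (simp add: emeasure_density nn_integral_cmult_indicator)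
  have "N1 = N2"
  proof (rule measure_eqI_lessThan[OF sets])
    fix u
    show "emeasure N1 {u<..} < \<infinity>"
      using N1[of "{u<..}"] by (simp add: emeasure_eq_measure)
    have "emeasure N1 {u<..} = emeasure M {\<omega> \<in> A. Y n \<omega> = s \<and> Y (Suc n) \<omega> = s' \<and> H n \<omega> \<in> {u<..}}"
      by (rule N1) simp
    also have "\<dots> = emeasure M {\<omega> \<in> A. Y n \<omega> = s \<and> max 0 u < H n \<omega> \<and> Y (Suc n) \<omega> = s'}"
    proof (rule emeasure_eq_AE)
      show "AE \<omega> in M. \<omega> \<in> {\<omega> \<in> A. Y n \<omega> = s \<and> Y (Suc n) \<omega> = s' \<and> H n \<omega> \<in> {u<..}} \<longleftrightarrow>
        \<omega> \<in> {\<omega> \<in> A. Y n \<omega> = s \<and> max 0 u < H n \<omega> \<and> Y (Suc n) \<omega> = s'}"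
        using AE_path by eventually_elim auto
      have "{\<omega> \<in> A. Q \<omega>} = {\<omega> \<in> space M. \<omega> \<in> A \<and> Q \<omega>}" for Q
        using sets.sets_into_space[OF AM] by auto
      then show "{\<omega> \<in> A. Y n \<omega> = s \<and> Y (Suc n) \<omega> = s' \<and> H n \<omega> \<in> {u<..}} \<in> sets M"
        "{\<omega> \<in> A. Y n \<omega> = s \<and> max 0 u < H n \<omega> \<and> Y (Suc n) \<omega> = s'} \<in> sets M"
        by simp_all
    qed
    also have "\<dots> = c * emeasure (hold s) {u<..}"
      using markov_history[OF A _ s, of "max 0 u" s']
      unfolding c_def emeasure_hold_greater ennreal_mult[OF P_nonneg exp_ge_zero] by (simp add: mult.assoc)
    finally show "emeasure N1 {u<..} = emeasure N2 {u<..}" by (simp add: N2)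
  qed
  then show ?thesis using N1[OF B] N2[OF B] by (simp add: c_def)
qed

text \<open>On a transition from \<open>s\<close> to \<open>s'\<close> the past and
  \<open>H n\<close> have a product law, identified on products of events. The integrand may
  therefore depend jointly on the past and on the holding time, as elapsed times do.\<close>

lemma markov_step:
  assumes s: "s \<in> S" and f: "(\<lambda>(\<omega>, h). f \<omega> h) \<in> borel_measurable (history n \<Otimes>\<^sub>M borel)"
  shows "(\<integral>\<^sup>+\<omega>. of_bool (Y n \<omega> = s \<and> Y (Suc n) \<omega> = s') * f \<omega> (H n \<omega>) \<partial>M)
     = ennreal (P s s') * (\<integral>\<^sup>+\<omega>. of_bool (Y n \<omega> = s) * (\<integral>\<^sup>+h. f \<omega> h \<partial>hold s) \<partial>M)"
proof -
  interpret h: prob_space "hold s" by (rule prob_space_hold)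
  have idH [measurable]: "(\<lambda>\<omega>. \<omega>) \<in> measurable M (history n)"
    by (rule measurable_from_history) (rule measurable_ident_sets[OF refl])
  define N1 where "N1 = distr (density M (\<lambda>\<omega>. of_bool (Y n \<omega> = s \<and> Y (Suc n) \<omega> = s'))) (history n \<Otimes>\<^sub>M borel) (\<lambda>\<omega>. (\<omega>, H n \<omega>))"
  define N2 where "N2 = distr (density M (\<lambda>\<omega>. ennreal (P s s') * of_bool (Y n \<omega> = s))) (history n) (\<lambda>\<omega>. \<omega>)"
  have e2: "emeasure N2 A = emeasure M {\<omega> \<in> A. Y n \<omega> = s} * ennreal (P s s')" if A: "A \<in> sets (history n)" for A
  proof -
    have AM [measurable]: "A \<in> sets M" using A history_subset by auto
    have "emeasure N2 A = (\<integral>\<^sup>+\<omega>. ennreal (P s s') * indicator {\<omega> \<in> space M. \<omega> \<in> A \<and> Y n \<omega> = s} \<omega> \<partial>M)"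
      unfolding N2_def using A
      by (subst emeasure_distr) (auto simp: emeasure_density sets.Int_space_eq2[OF AM] indicator_def intro!: nn_integral_cong)
    also have "\<dots> = ennreal (P s s') * emeasure M {\<omega> \<in> space M. \<omega> \<in> A \<and> Y n \<omega> = s}"
      by (rule nn_integral_cmult_indicator) simp
    also have "{\<omega> \<in> space M. \<omega> \<in> A \<and> Y n \<omega> = s} = {\<omega> \<in> A. Y n \<omega> = s}"
      using sets.sets_into_space[OF AM] by auto
    finally show ?thesis by (simp add: mult.commute)
  qed
  interpret n2: finite_measure N2
    using e2[OF sets.top] by (intro finite_measureI) (simp add: N2_def emeasure_eq_measure ennreal_mult[symmetric] P_nonneg)
  have sN2: "sets N2 = sets (history n)" by (simp add: N2_def)
  have "N2 \<Otimes>\<^sub>M hold s = N1"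
  proof (rule pair_measure_eqI)
    show "sigma_finite_measure N2" "sigma_finite_measure (hold s)" by unfold_locales
    show "sets (N2 \<Otimes>\<^sub>M hold s) = sets N1"
      unfolding N1_def by (simp add: sN2 cong: sets_pair_measure_cong)
    fix A B assume "A \<in> sets N2" "B \<in> sets (hold s)"
    then have A: "A \<in> sets (history n)" and B: "B \<in> sets borel" by (simp_all add: sN2)
    have AM [measurable]: "A \<in> sets M" using A history_subset by auto
    note B [measurable]
    have "emeasure N1 (A \<times> B) = (\<integral>\<^sup>+\<omega>. indicator {\<omega> \<in> space M. \<omega> \<in> A \<and> Y n \<omega> = s \<and> Y (Suc n) \<omega> = s' \<and> H n \<omega> \<in> B} \<omega> \<partial>M)"
    proof -
      have AB: "A \<times> B \<in> sets (history n \<Otimes>\<^sub>M borel)" using A B by simp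
      have m: "(\<lambda>\<omega>. (\<omega>, H n \<omega>)) \<in> measurable M (history n \<Otimes>\<^sub>M borel)" by measurable
      have "emeasure N1 (A \<times> B) = emeasure (density M (\<lambda>\<omega>. of_bool (Y n \<omega> = s \<and> Y (Suc n) \<omega> = s'))) ((\<lambda>\<omega>. (\<omega>, H n \<omega>)) -` (A \<times> B) \<inter> space M)"
        unfolding N1_def using m AB by (simp add: emeasure_distr)
      also have "\<dots> = (\<integral>\<^sup>+\<omega>. of_bool (Y n \<omega> = s \<and> Y (Suc n) \<omega> = s') * indicator ((\<lambda>\<omega>. (\<omega>, H n \<omega>)) -` (A \<times> B) \<inter> space M) \<omega> \<partial>M)"
        using measurable_sets[OF m AB] by (intro emeasure_density) auto
      finally show ?thesis
        by (simp only:) (intro nn_integral_cong, auto simp: indicator_def)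
    qed
    also have "\<dots> = emeasure M {\<omega> \<in> space M. \<omega> \<in> A \<and> Y n \<omega> = s \<and> Y (Suc n) \<omega> = s' \<and> H n \<omega> \<in> B}"
      by (rule nn_integral_indicator) simp
    also have "{\<omega> \<in> space M. \<omega> \<in> A \<and> Y n \<omega> = s \<and> Y (Suc n) \<omega> = s' \<and> H n \<omega> \<in> B} = {\<omega> \<in> A. Y n \<omega> = s \<and> Y (Suc n) \<omega> = s' \<and> H n \<omega> \<in> B}"
      using sets.sets_into_space[OF AM] by auto
    also have "emeasure M \<dots> = emeasure N2 A * emeasure (hold s) B"
      unfolding e2[OF A] by (rule emeasure_history_hold[OF A s B])
    finally show "emeasure N2 A * emeasure (hold s) B = emeasure N1 (A \<times> B)" by simp
  qed
  moreover have "(\<lambda>(\<omega>, h). f \<omega> h) \<in> borel_measurable (N2 \<Otimes>\<^sub>M hold s)"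
    using f by (simp add: sN2 cong: measurable_cong_sets sets_pair_measure_cong)
  ultimately have "(\<integral>\<^sup>+x. (case x of (\<omega>, h) \<Rightarrow> f \<omega> h) \<partial>N1) = (\<integral>\<^sup>+\<omega>. \<integral>\<^sup>+h. f \<omega> h \<partial>hold s \<partial>N2)"
    using h.nn_integral_fst[of "\<lambda>(\<omega>, h). f \<omega> h" N2] by simp
  also have "\<dots> = (\<integral>\<^sup>+\<omega>. (ennreal (P s s') * of_bool (Y n \<omega> = s)) * (\<integral>\<^sup>+h. f \<omega> h \<partial>hold s) \<partial>M)"
  proof -
    have m: "(\<lambda>\<omega>. \<integral>\<^sup>+h. f \<omega> h \<partial>hold s) \<in> borel_measurable (history n)"
      using f by (intro h.borel_measurable_nn_integral) (simp cong: measurable_cong_sets sets_pair_measure_cong)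
    show ?thesis
      unfolding N2_def using m measurable_from_history[OF m]
      by (simp add: nn_integral_distr nn_integral_density)
  qed
  also have "\<dots> = ennreal (P s s') * (\<integral>\<^sup>+\<omega>. of_bool (Y n \<omega> = s) * (\<integral>\<^sup>+h. f \<omega> h \<partial>hold s) \<partial>M)"
  proof -
    have m: "(\<lambda>\<omega>. \<integral>\<^sup>+h. f \<omega> h \<partial>hold s) \<in> borel_measurable M"
      using f by (intro measurable_from_history[of _ n] h.borel_measurable_nn_integral) (simp cong: measurable_cong_sets sets_pair_measure_cong)
    show ?thesis using m by (simp add: mult.assoc nn_integral_cmult)
  qed
  finally have "(\<integral>\<^sup>+x. (case x of (\<omega>, h) \<Rightarrow> f \<omega> h) \<partial>N1) = \<dots>" .
  moreover have "(\<integral>\<^sup>+x. (case x of (\<omega>, h) \<Rightarrow> f \<omega> h) \<partial>N1) = (\<integral>\<^sup>+\<omega>. of_bool (Y n \<omega> = s \<and> Y (Suc n) \<omega> = s') * f \<omega> (H n \<omega>) \<partial>M)"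
  proof -
    have m: "(\<lambda>\<omega>. (\<omega>, H n \<omega>)) \<in> measurable M (history n \<Otimes>\<^sub>M borel)" by measurable
    have "(\<lambda>\<omega>. f \<omega> (H n \<omega>)) \<in> borel_measurable M"
      using measurable_compose[OF m f] by simp
    then show ?thesis
      unfolding N1_def using f m by (simp add: nn_integral_distr nn_integral_density)
  qed
  ultimately show ?thesis by simp
qed

end

section \<open>Renewal equation and Campbell's formula\<close>

context jump_process
begin

text \<open>Time of entry into \<open>Y n\<close>, so \<open>elapsed (Suc k)\<close> is the time of
  jump \<open>k\<close>; with this index it is known to \<open>history n\<close>.\<close>

definition elapsed :: "nat \<Rightarrow> 'w \<Rightarrow> real" where
  "elapsed n \<omega> = (\<Sum>j<n. H j \<omega>)"

lemma elapsed_Suc: "elapsed (Suc n) \<omega> = elapsed n \<omega> + H n \<omega>"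
  by (simp add: elapsed_def)

lemma elapsed_history [measurable]: "elapsed n \<in> borel_measurable (history n)"
  unfolding elapsed_def by (intro borel_measurable_sum measurable_H_history) auto

lemma elapsed_measurable [measurable]: "elapsed n \<in> borel_measurable M"
  by (rule measurable_from_history) (rule elapsed_history)

lemma emeasure_of_bool: "Measurable.pred M Q \<Longrightarrow> emeasure M {\<omega> \<in> space M. Q \<omega>} = (\<integral>\<^sup>+\<omega>. of_bool (Q \<omega>) \<partial>M)"
proof -
  assume Q: "Measurable.pred M Q"
  have "(\<integral>\<^sup>+\<omega>. of_bool (Q \<omega>) \<partial>M) = (\<integral>\<^sup>+\<omega>. indicator {\<omega> \<in> space M. Q \<omega>} \<omega> \<partial>M)"
    by (intro nn_integral_cong) (auto simp: indicator_def)
  then show ?thesis using Q by simp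
qed

lemma nn_integral_split_state:
  assumes [measurable]: "f \<in> borel_measurable M"
  shows "(\<integral>\<^sup>+\<omega>. f \<omega> \<partial>M) = (\<integral>\<^sup>+s. (\<integral>\<^sup>+\<omega>. of_bool (Y n \<omega> = s) * f \<omega> \<partial>M) \<partial>count_space S)"
proof -
  have "(\<integral>\<^sup>+\<omega>. f \<omega> \<partial>M) = (\<integral>\<^sup>+\<omega>. (\<integral>\<^sup>+s. of_bool (Y n \<omega> = s) * f \<omega> \<partial>count_space S) \<partial>M)"
  proof (rule nn_integral_cong_AE)
    show "AE \<omega> in M. f \<omega> = (\<integral>\<^sup>+s. of_bool (Y n \<omega> = s) * f \<omega> \<partial>count_space S)"
      using AE_path
    proof eventually_elim
      case (elim \<omega>)
      have "(\<integral>\<^sup>+s. of_bool (Y n \<omega> = s) * f \<omega> \<partial>count_space S) = (\<integral>\<^sup>+s. f \<omega> * indicator {Y n \<omega>} s \<partial>count_space S)"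
        by (intro nn_integral_cong) (auto simp: indicator_def)
      also have "\<dots> = f \<omega>" using elim by (simp add: nn_integral_cmult_indicator)
      finally show ?case by simp
    qed
  qed
  also have "\<dots> = (\<integral>\<^sup>+s. (\<integral>\<^sup>+\<omega>. of_bool (Y n \<omega> = s) * f \<omega> \<partial>M) \<partial>count_space S)"
    by (rule nn_integral_count_space_nn_integral[OF countable_S]) measurable
  finally show ?thesis .
qed

lemma markov_hold:
  assumes s: "s \<in> S" and f: "(\<lambda>(\<omega>, h). f \<omega> h) \<in> borel_measurable (history n \<Otimes>\<^sub>M borel)"
  shows "(\<integral>\<^sup>+\<omega>. of_bool (Y n \<omega> = s) * f \<omega> (H n \<omega>) \<partial>M)
     = (\<integral>\<^sup>+\<omega>. of_bool (Y n \<omega> = s) * (\<integral>\<^sup>+h. f \<omega> h \<partial>hold s) \<partial>M)"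
proof -
  have idH [measurable]: "(\<lambda>\<omega>. \<omega>) \<in> measurable M (history n)"
    by (rule measurable_from_history) (rule measurable_ident_sets[OF refl])
  have m: "(\<lambda>\<omega>. (\<omega>, H n \<omega>)) \<in> measurable M (history n \<Otimes>\<^sub>M borel)" by measurable
  have [measurable]: "(\<lambda>\<omega>. f \<omega> (H n \<omega>)) \<in> borel_measurable M"
    using measurable_compose[OF m f] by simp
  have "(\<integral>\<^sup>+\<omega>. of_bool (Y n \<omega> = s) * f \<omega> (H n \<omega>) \<partial>M)
     = (\<integral>\<^sup>+s'. (\<integral>\<^sup>+\<omega>. of_bool (Y (Suc n) \<omega> = s') * (of_bool (Y n \<omega> = s) * f \<omega> (H n \<omega>)) \<partial>M) \<partial>count_space S)"
    by (rule nn_integral_split_state) measurable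
  also have "\<dots> = (\<integral>\<^sup>+s'. (\<integral>\<^sup>+\<omega>. of_bool (Y n \<omega> = s \<and> Y (Suc n) \<omega> = s') * f \<omega> (H n \<omega>) \<partial>M) \<partial>count_space S)"
    by (intro nn_integral_cong) auto
  also have "\<dots> = (\<integral>\<^sup>+s'. ennreal (P s s') \<partial>count_space S) * (\<integral>\<^sup>+\<omega>. of_bool (Y n \<omega> = s) * (\<integral>\<^sup>+h. f \<omega> h \<partial>hold s) \<partial>M)"
    unfolding markov_step[OF s f] by (rule nn_integral_multc) simp
  finally show ?thesis by (simp add: sum_P[OF s])
qed

lemma markov_transition:
  assumes "Measurable.pred (history n) Q" and s: "s \<in> S"
  shows "emeasure M {\<omega> \<in> space M. Q \<omega> \<and> Y n \<omega> = s \<and> Y (Suc n) \<omega> = s'}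
    = emeasure M {\<omega> \<in> space M. Q \<omega> \<and> Y n \<omega> = s} * ennreal (P s s')"
proof -
  interpret h: prob_space "hold s" by (rule prob_space_hold)
  have A: "{\<omega> \<in> space M. Q \<omega>} \<in> sets (history n)"
    using assms(1) by (simp add: pred_def)
  show ?thesis
    using emeasure_history_hold[OF A s, of UNIV s'] h.emeasure_space_1 by (simp add: conj_assoc)
qed

lemma nn_integral_hold: "(\<integral>\<^sup>+h. f h \<partial>hold s) = (\<integral>\<^sup>+h. ennreal (exponential_density (exit_rate q s) h) * f h \<partial>lborel)"
  if "f \<in> borel_measurable borel"
  unfolding hold_def using that by (simp add: nn_integral_density)

lemma mean_hold: "(\<integral>\<^sup>+h. ennreal h \<partial>hold s) = ennreal (1 / exit_rate q s)"
  using nn_integral_erlang_ith_moment[OF exit_rate_pos[of s], of 0 1]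
  by (simp add: nn_integral_hold ennreal_mult'' mult.commute exponential_density_def[symmetric] del: times_divide_eq_right)

lemma expected_hold:
  assumes Q [measurable]: "Measurable.pred (history n) Q" and s: "s \<in> S"
  shows "(\<integral>\<^sup>+\<omega>. of_bool (Q \<omega> \<and> Y n \<omega> = s) * ennreal (H n \<omega>) \<partial>M)
    = emeasure M {\<omega> \<in> space M. Q \<omega> \<and> Y n \<omega> = s} * ennreal (1 / exit_rate q s)"
proof -
  have [measurable]: "Measurable.pred M Q" by (rule measurable_from_history[OF Q])
  have "(\<integral>\<^sup>+\<omega>. of_bool (Q \<omega> \<and> Y n \<omega> = s) * ennreal (H n \<omega>) \<partial>M)
    = (\<integral>\<^sup>+\<omega>. of_bool (Y n \<omega> = s) * (of_bool (Q \<omega>) * ennreal (H n \<omega>)) \<partial>M)"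
    by (intro nn_integral_cong) auto
  also have "\<dots> = (\<integral>\<^sup>+\<omega>. of_bool (Y n \<omega> = s) * (\<integral>\<^sup>+h. of_bool (Q \<omega>) * ennreal h \<partial>hold s) \<partial>M)"
    by (rule markov_hold[OF s]) measurable
  also have "\<dots> = (\<integral>\<^sup>+\<omega>. of_bool (Q \<omega> \<and> Y n \<omega> = s) * ennreal (1 / exit_rate q s) \<partial>M)"
    by (intro nn_integral_cong) (simp add: nn_integral_cmult mean_hold)
  also have "\<dots> = (\<integral>\<^sup>+\<omega>. of_bool (Q \<omega> \<and> Y n \<omega> = s) \<partial>M) * ennreal (1 / exit_rate q s)"
    by (rule nn_integral_multc) measurable
  finally show ?thesis by (simp add: emeasure_of_bool)
qed

text \<open>A visit is counted when it ends, at \<open>elapsed (Suc n)\<close>, because the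
  transitions to be counted occur at the ends of visits.\<close>

definition visit :: "nat \<Rightarrow> 's \<Rightarrow> real \<Rightarrow> ennreal" where
  "visit n s t = emeasure M {\<omega> \<in> space M. Y n \<omega> = s \<and> elapsed (Suc n) \<omega> \<le> t}"

definition renewal :: "('s \<Rightarrow> real \<Rightarrow> ennreal) \<Rightarrow> 's \<Rightarrow> real \<Rightarrow> ennreal" where
  "renewal \<phi> s t = (\<integral>\<^sup>+h. (\<integral>\<^sup>+s'. \<phi> s' (t - h) * ennreal (P s' s) \<partial>count_space S) \<partial>hold s)"

lemma visit_eq:
  assumes s: "s \<in> S"
  shows "visit n s t = (\<integral>\<^sup>+h. emeasure M {\<omega> \<in> space M. Y n \<omega> = s \<and> elapsed n \<omega> \<le> t - h} \<partial>hold s)"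
proof -
  interpret h: prob_space "hold s" by (rule prob_space_hold)
  interpret pair_sigma_finite M "hold s" by unfold_locales
  have idH [measurable]: "(\<lambda>\<omega>. \<omega>) \<in> measurable M (history n)"
    by (rule measurable_from_history) (rule measurable_ident_sets[OF refl])
  have "visit n s t = (\<integral>\<^sup>+\<omega>. of_bool (Y n \<omega> = s \<and> elapsed (Suc n) \<omega> \<le> t) \<partial>M)"
    unfolding visit_def by (rule emeasure_of_bool) measurable
  also have "\<dots> = (\<integral>\<^sup>+\<omega>. of_bool (Y n \<omega> = s) * of_bool (elapsed n \<omega> + H n \<omega> \<le> t) \<partial>M)"
    by (intro nn_integral_cong) (auto simp: elapsed_Suc)
  also have "\<dots> = (\<integral>\<^sup>+\<omega>. of_bool (Y n \<omega> = s) * (\<integral>\<^sup>+h. of_bool (elapsed n \<omega> + h \<le> t) \<partial>hold s) \<partial>M)"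
    by (rule markov_hold[OF s, of "\<lambda>\<omega> h. of_bool (elapsed n \<omega> + h \<le> t)"]) measurable
  also have "\<dots> = (\<integral>\<^sup>+\<omega>. \<integral>\<^sup>+h. of_bool (Y n \<omega> = s \<and> elapsed n \<omega> \<le> t - h) \<partial>hold s \<partial>M)"
    by (intro nn_integral_cong) (auto simp: nn_integral_cmult[symmetric] algebra_simps intro!: nn_integral_cong)
  also have "\<dots> = (\<integral>\<^sup>+h. \<integral>\<^sup>+\<omega>. of_bool (Y n \<omega> = s \<and> elapsed n \<omega> \<le> t - h) \<partial>M \<partial>hold s)"
    by (rule Fubini'[symmetric]) measurable
  finally show ?thesis by (simp add: emeasure_of_bool)
qed

lemma visit_transition:
  assumes s: "s \<in> S"
  shows "emeasure M {\<omega> \<in> space M. Y n \<omega> = s \<and> Y (Suc n) \<omega> = s' \<and> elapsed (Suc n) \<omega> \<le> t}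
     = visit n s t * ennreal (P s s')"
proof -
  let ?f = "\<lambda>\<omega> h. of_bool (elapsed n \<omega> + h \<le> t) :: ennreal"
  have f: "(\<lambda>(\<omega>, h). ?f \<omega> h) \<in> borel_measurable (history n \<Otimes>\<^sub>M borel)" by measurable
  have "emeasure M {\<omega> \<in> space M. Y n \<omega> = s \<and> Y (Suc n) \<omega> = s' \<and> elapsed (Suc n) \<omega> \<le> t}
    = (\<integral>\<^sup>+\<omega>. of_bool (Y n \<omega> = s \<and> Y (Suc n) \<omega> = s') * ?f \<omega> (H n \<omega>) \<partial>M)"
    by (subst emeasure_of_bool) (auto simp: elapsed_Suc intro!: nn_integral_cong)
  also have "\<dots> = ennreal (P s s') * (\<integral>\<^sup>+\<omega>. of_bool (Y n \<omega> = s) * ?f \<omega> (H n \<omega>) \<partial>M)"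
    unfolding markov_step[OF s f] markov_hold[OF s f] ..
  also have "(\<integral>\<^sup>+\<omega>. of_bool (Y n \<omega> = s) * ?f \<omega> (H n \<omega>) \<partial>M) = visit n s t"
    unfolding visit_def by (subst emeasure_of_bool) (auto simp: elapsed_Suc intro!: nn_integral_cong)
  finally show ?thesis by (simp add: mult.commute)
qed

lemma visit_Suc:
  assumes s: "s \<in> S"
  shows "visit (Suc n) s t = renewal (visit n) s t"
  unfolding visit_eq[OF s] renewal_def
proof (intro nn_integral_cong)
  fix h
  have "emeasure M {\<omega> \<in> space M. Y (Suc n) \<omega> = s \<and> elapsed (Suc n) \<omega> \<le> t - h}
     = (\<integral>\<^sup>+s'. (\<integral>\<^sup>+\<omega>. of_bool (Y n \<omega> = s') * of_bool (Y (Suc n) \<omega> = s \<and> elapsed (Suc n) \<omega> \<le> t - h) \<partial>M) \<partial>count_space S)"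
    by (subst emeasure_of_bool) (measurable, rule nn_integral_split_state, measurable)
  also have "\<dots> = (\<integral>\<^sup>+s'. emeasure M {\<omega> \<in> space M. Y n \<omega> = s' \<and> Y (Suc n) \<omega> = s \<and> elapsed (Suc n) \<omega> \<le> t - h} \<partial>count_space S)"
    by (intro nn_integral_cong, subst emeasure_of_bool) (auto intro!: nn_integral_cong)
  also have "\<dots> = (\<integral>\<^sup>+s'. visit n s' (t - h) * ennreal (P s' s) \<partial>count_space S)"
    by (intro nn_integral_cong) (simp add: visit_transition)
  finally show "emeasure M {\<omega> \<in> space M. Y (Suc n) \<omega> = s \<and> elapsed (Suc n) \<omega> \<le> t - h} = \<dots>" .
qed

lemma visit_0:
  assumes s: "s \<in> S"
  shows "visit 0 s t = (\<integral>\<^sup>+h. ennreal (pmf \<pi> s) * of_bool (h \<le> t) \<partial>hold s)"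
  unfolding visit_eq[OF s]
proof (intro nn_integral_cong)
  fix h
  have "emeasure M {\<omega> \<in> space M. Y 0 \<omega> = s} = ennreal (pmf \<pi> s)"
    using emeasure_cylinder[of 0 "\<lambda>_. 0" "\<lambda>_. s"] by (simp add: cylinder_def)
  then show "emeasure M {\<omega> \<in> space M. Y 0 \<omega> = s \<and> elapsed 0 \<omega> \<le> t - h} = ennreal (pmf \<pi> s) * of_bool (h \<le> t)"
    by (simp add: elapsed_def)
qed

lemma measurable_visit [measurable]: "visit n s \<in> borel_measurable borel"
proof -
  have "visit n s t = (\<integral>\<^sup>+\<omega>. of_bool (Y n \<omega> = s \<and> elapsed (Suc n) \<omega> \<le> t) \<partial>M)" for t
    unfolding visit_def by (rule emeasure_of_bool) measurable
  then have "visit n s = (\<lambda>t. \<integral>\<^sup>+\<omega>. of_bool (Y n \<omega> = s \<and> elapsed (Suc n) \<omega> \<le> t) \<partial>M)" by auto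
  also have "\<dots> \<in> borel_measurable borel" by measurable
  finally show ?thesis .
qed

lemma measurable_state_sum:
  assumes "\<And>s. \<phi> s \<in> borel_measurable borel"
  shows "(\<lambda>u :: real. \<integral>\<^sup>+s'. \<phi> s' u * ennreal (P s' s) \<partial>count_space S) \<in> borel_measurable borel"
proof -
  interpret sigma_finite_measure "count_space S" by (rule sigma_finite_measure_count_space_countable[OF countable_S])
  have "(\<lambda>(s', u). \<phi> s' u * ennreal (P s' s)) \<in> borel_measurable (count_space S \<Otimes>\<^sub>M borel)"
    using assms by (intro measurable_pair_measure_countable1 countable_S) (simp add: case_prod_unfold)
  from measurable_pair_swap[OF this] show ?thesis
    by (intro borel_measurable_nn_integral) simp
qed

lemma measurable_renewal:
  assumes "\<And>s. \<phi> s \<in> borel_measurable borel"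
  shows "renewal \<phi> s \<in> borel_measurable borel"
proof -
  interpret h: prob_space "hold s" by (rule prob_space_hold)
  note measurable_state_sum[OF assms, measurable]
  show ?thesis unfolding renewal_def[abs_def] by measurable
qed

lemma renewal_add:
  assumes "\<And>s. \<phi> s \<in> borel_measurable borel" "\<And>s. \<psi> s \<in> borel_measurable borel"
  shows "renewal (\<lambda>s t. \<phi> s t + \<psi> s t) s t = renewal \<phi> s t + renewal \<psi> s t"
proof -
  note measurable_state_sum[OF assms(1), measurable] measurable_state_sum[OF assms(2), measurable]
  show ?thesis
    unfolding renewal_def by (simp add: distrib_right nn_integral_add)
qed

lemma renewal_sum:
  assumes "finite A" "\<And>i s. i \<in> A \<Longrightarrow> \<phi> i s \<in> borel_measurable borel"
  shows "renewal (\<lambda>s t. \<Sum>i\<in>A. \<phi> i s t) s t = (\<Sum>i\<in>A. renewal (\<phi> i) s t)"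
  using assms
proof (induction A)
  case empty
  then show ?case by (simp add: renewal_def)
next
  case (insert i A)
  have "renewal (\<lambda>s t. \<phi> i s t + (\<Sum>i\<in>A. \<phi> i s t)) s t = renewal (\<phi> i) s t + renewal (\<lambda>s t. \<Sum>i\<in>A. \<phi> i s t) s t"
    using insert by (intro renewal_add borel_measurable_sum) auto
  then show ?case using insert by simp
qed

lemma renewal_mono:
  assumes "\<And>s t. s \<in> S \<Longrightarrow> \<phi> s t \<le> \<psi> s t"
  shows "renewal \<phi> s t \<le> renewal \<psi> s t"
  unfolding renewal_def using assms by (intro nn_integral_mono mult_right_mono) auto

lemma renewal_cong:
  assumes "\<And>s t. s \<in> S \<Longrightarrow> \<phi> s t = \<psi> s t"
  shows "renewal \<phi> s t = renewal \<psi> s t"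
  unfolding renewal_def using assms by (intro nn_integral_cong) auto

lemma flow_balance:
  "(\<integral>\<^sup>+s'. ennreal (pmf \<pi> s' * exit_rate q s') * ennreal (P s' s) \<partial>count_space S) = ennreal (pmf \<pi> s * exit_rate q s)"
proof -
  have "ennreal (pmf \<pi> s' * exit_rate q s') * ennreal (P s' s) = ennreal (pmf \<pi> s' * q s' s)" for s'
    using exit_rate_pos[of s'] by (simp add: ennreal_mult[symmetric] P_nonneg)
  then have "(\<integral>\<^sup>+s'. ennreal (pmf \<pi> s' * exit_rate q s') * ennreal (P s' s) \<partial>count_space S) = (\<integral>\<^sup>+s'. ennreal (pmf \<pi> s' * q s' s) \<partial>count_space S)"
    by simp
  also have "\<dots> = (\<integral>\<^sup>+s'. ennreal (pmf \<pi> s' * q s' s) \<partial>count_space UNIV)"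
  proof (rule nn_integral_count_space_eq)
    fix s' assume "s' \<in> UNIV - S"
    then have "pmf \<pi> s' = 0" using support by (meson DiffD2 set_pmf_iff subsetD)
    then show "ennreal (pmf \<pi> s' * q s' s) = 0" by simp
  qed auto
  also have "\<dots> = ennreal (pmf \<pi> s * exit_rate q s)"
    using stationary by (simp add: stationary_pmf_iff)
  finally show ?thesis .
qed

lemma renewal_flow:
  assumes c: "\<And>u. 0 \<le> c u"
  shows "renewal (\<lambda>s t. ennreal (pmf \<pi> s * exit_rate q s) * ennreal (c t)) s t
    = (\<integral>\<^sup>+h. ennreal (pmf \<pi> s * exit_rate q s) * ennreal (c (t - h)) \<partial>hold s)"
  unfolding renewal_def
proof (intro nn_integral_cong)
  fix h
  have "(\<integral>\<^sup>+s'. ennreal (pmf \<pi> s' * exit_rate q s') * ennreal (c (t - h)) * ennreal (P s' s) \<partial>count_space S)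
     = (\<integral>\<^sup>+s'. ennreal (pmf \<pi> s' * exit_rate q s') * ennreal (P s' s) * ennreal (c (t - h)) \<partial>count_space S)"
    by (simp add: ac_simps)
  also have "\<dots> = ennreal (pmf \<pi> s * exit_rate q s) * ennreal (c (t - h))"
    by (subst nn_integral_multc) (simp_all add: flow_balance)
  finally show "(\<integral>\<^sup>+s'. ennreal (pmf \<pi> s' * exit_rate q s') * ennreal (c (t - h)) * ennreal (P s' s) \<partial>count_space S) = \<dots>" .
qed

text \<open>Iterates of the renewal operator on the claimed answer, the stationary flow times
  elapsed time; they measure what the first \<open>n\<close> visits miss.\<close>

primrec remainder :: "nat \<Rightarrow> 's \<Rightarrow> real \<Rightarrow> ennreal" where
  "remainder 0 = (\<lambda>s t. ennreal (pmf \<pi> s * exit_rate q s) * ennreal (max 0 t))"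
| "remainder (Suc n) = renewal (remainder n)"

lemma measurable_remainder [measurable]: "remainder n s \<in> borel_measurable borel"
  by (induction n arbitrary: s) (simp_all add: measurable_renewal)

text \<open>The linear flow is a fixed point: the first visit plus the renewal of the flow reproduce
  it, balance having already absorbed the sum over predecessors. For negative \<open>t\<close> both
  sides are zero.\<close>

lemma first_visit_plus_renewal:
  "(\<integral>\<^sup>+h. ennreal (pmf \<pi> s) * of_bool (h \<le> t) + ennreal (pmf \<pi> s * exit_rate q s) * ennreal (max 0 (t - h)) \<partial>hold s)
    = ennreal (pmf \<pi> s * exit_rate q s) * ennreal (max 0 t)"
proof -
  let ?e = "exit_rate q s"
  let ?g = "\<lambda>h. pmf \<pi> s * ((1 + ?e * (t - h)) * (?e * exp (- h * ?e)))"
  have "(\<integral>\<^sup>+h. ennreal (pmf \<pi> s) * of_bool (h \<le> t) + ennreal (pmf \<pi> s * ?e) * ennreal (max 0 (t - h)) \<partial>hold s)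
    = (\<integral>\<^sup>+h. ennreal (?g h) * indicator {0..t} h \<partial>lborel)"
  proof (subst nn_integral_hold, measurable, intro nn_integral_cong)
    fix h :: real
    show "ennreal (exponential_density ?e h) * (ennreal (pmf \<pi> s) * of_bool (h \<le> t) + ennreal (pmf \<pi> s * ?e) * ennreal (max 0 (t - h)))
      = ennreal (?g h) * indicator {0..t} h"
    proof (cases "0 \<le> h \<and> h \<le> t")
      case True
      then have "ennreal (exponential_density ?e h) * (ennreal (pmf \<pi> s) * of_bool (h \<le> t) + ennreal (pmf \<pi> s * ?e) * ennreal (max 0 (t - h)))
        = ennreal (?e * exp (- h * ?e) * (pmf \<pi> s + pmf \<pi> s * ?e * (t - h)))"
        by (simp add: exponential_density_def erlang_density_def ennreal_mult[symmetric] ennreal_plus[symmetric] del: ennreal_plus)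
      then show ?thesis using True by (simp add: algebra_simps)
    qed (auto simp: exponential_density_def erlang_density_def max_def ennreal_neg)
  qed
  also have "\<dots> = ennreal (pmf \<pi> s * ?e) * ennreal (max 0 t)"
  proof (cases "0 \<le> t")
    case True
    have "(\<integral>\<^sup>+h. ennreal (?g h) * indicator {0..t} h \<partial>lborel)
      = ennreal ((- pmf \<pi> s * ?e * (t - t) * exp (- t * ?e)) - (- pmf \<pi> s * ?e * (t - 0) * exp (- 0 * ?e)))"
    proof (rule nn_integral_FTC_Icc[where F="\<lambda>h. - pmf \<pi> s * ?e * (t - h) * exp (- h * ?e)"])
      show "DERIV (\<lambda>h. - pmf \<pi> s * ?e * (t - h) * exp (- h * ?e)) h :> ?g h" for h
        by (auto intro!: derivative_eq_intros simp: algebra_simps)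
      show "0 \<le> ?g h" if "h \<in> {0..t}" for h
        using that by (intro mult_nonneg_nonneg) auto
    qed (use True in auto)
    then show ?thesis using True by (simp add: ennreal_mult)
  qed simp
  finally show ?thesis .
qed

lemma sum_visit:
  assumes "s \<in> S"
  shows "(\<Sum>k<n. visit k s t) + remainder n s t = ennreal (pmf \<pi> s * exit_rate q s) * ennreal (max 0 t)"
  using assms
proof (induction n arbitrary: s t)
  case (Suc n)
  have "(\<Sum>k<n. visit (Suc k) s t) + remainder (Suc n) s t = (\<Sum>k<n. renewal (visit k) s t) + renewal (remainder n) s t"
    by (simp add: visit_Suc[OF Suc.prems])
  also have "\<dots> = renewal (\<lambda>s t. (\<Sum>k<n. visit k s t) + remainder n s t) s t"
    by (subst renewal_add) (auto simp: renewal_sum)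
  also have "\<dots> = renewal (\<lambda>s t. ennreal (pmf \<pi> s * exit_rate q s) * ennreal (max 0 t)) s t"
    by (rule renewal_cong) (rule Suc.IH)
  also have "\<dots> = (\<integral>\<^sup>+h. ennreal (pmf \<pi> s * exit_rate q s) * ennreal (max 0 (t - h)) \<partial>hold s)"
    by (rule renewal_flow) simp
  finally have "(\<Sum>k<Suc n. visit k s t) + remainder (Suc n) s t = visit 0 s t + \<dots>"
    by (simp add: sum.lessThan_Suc_shift add.assoc del: sum.lessThan_Suc)
  also have "\<dots> = (\<integral>\<^sup>+h. ennreal (pmf \<pi> s) * of_bool (h \<le> t) + ennreal (pmf \<pi> s * exit_rate q s) * ennreal (max 0 (t - h)) \<partial>hold s)"
    unfolding visit_0[OF Suc.prems] by (rule nn_integral_add[symmetric]) measurable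
  finally show ?case by (simp only: first_visit_plus_renewal)
qed simp

text \<open>Each renewal integrates once more over time against a density bounded by
  \<open>L\<close>, which produces the next term of an exponential series, while balance reproduces
  the stationary flow in the state variable.\<close>

lemma remainder_le:
  assumes "s \<in> S"
  shows "remainder n s t \<le> ennreal (pmf \<pi> s * exit_rate q s) * ennreal (L ^ n * max 0 t ^ Suc n / fact (Suc n))"
  using assms
proof (induction n arbitrary: s t)
  case (Suc n)
  let ?c = "\<lambda>n t. L ^ n * max 0 t ^ Suc n / fact (Suc n)" and ?e = "exit_rate q s"
  have L: "0 < L" by (rule L_pos)
  have c: "0 \<le> ?c n t" for n t using L by simp
  have "remainder (Suc n) s t \<le> renewal (\<lambda>s t. ennreal (pmf \<pi> s * exit_rate q s) * ennreal (?c n t)) s t"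
    unfolding remainder.simps by (rule renewal_mono) (rule Suc.IH)
  also have "\<dots> = (\<integral>\<^sup>+h. ennreal (pmf \<pi> s * ?e) * ennreal (?c n (t - h)) \<partial>hold s)"
    by (rule renewal_flow[OF c])
  also have "\<dots> = ennreal (pmf \<pi> s * ?e) * (\<integral>\<^sup>+h. ennreal (?c n (t - h)) \<partial>hold s)"
    by (rule nn_integral_cmult) measurable
  also have "(\<integral>\<^sup>+h. ennreal (?c n (t - h)) \<partial>hold s) = (\<integral>\<^sup>+h. ennreal (exponential_density ?e h) * ennreal (?c n (t - h)) \<partial>lborel)"
    by (rule nn_integral_hold) measurable
  also have "\<dots> \<le> (\<integral>\<^sup>+h. ennreal (L * ?c n (t - h)) * indicator {0..t} h \<partial>lborel)"
  proof (intro nn_integral_mono)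
    fix h :: real
    show "ennreal (exponential_density ?e h) * ennreal (?c n (t - h)) \<le> ennreal (L * ?c n (t - h)) * indicator {0..t} h"
    proof (cases "0 \<le> h \<and> h \<le> t")
      case True
      have "?e * exp (- h * ?e) \<le> L * 1"
        using exit_rate_le[of s] L True by (intro mult_mono) auto
      then have "exponential_density ?e h \<le> L" using L by (simp add: exponential_density_def erlang_density_def mult.commute)
      then have "exponential_density ?e h * ?c n (t - h) \<le> L * ?c n (t - h)" by (rule mult_right_mono[OF _ c])
      moreover have "ennreal (exponential_density ?e h) * ennreal (?c n (t - h)) = ennreal (exponential_density ?e h * ?c n (t - h))"
        by (rule ennreal_mult[symmetric, OF _ c]) (auto simp: exponential_density_def erlang_density_def)
      ultimately show ?thesis using True by (simp add: ennreal_leI del: times_divide_eq_right)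
    qed (auto simp: exponential_density_def erlang_density_def)
  qed
  also have "\<dots> = ennreal (?c (Suc n) t)"
  proof (cases "0 \<le> t")
    case True
    let ?F = "\<lambda>h. - (L ^ Suc n * (t - h) ^ Suc (Suc n) / fact (Suc (Suc n)))"
    have "(\<integral>\<^sup>+h. ennreal (L * ?c n (t - h)) * indicator {0..t} h \<partial>lborel)
       = (\<integral>\<^sup>+h. ennreal (L ^ Suc n * (t - h) ^ Suc n / fact (Suc n)) * indicator {0..t} h \<partial>lborel)"
      by (intro nn_integral_cong) (auto simp: indicator_def mult.assoc)
    also have "\<dots> = ennreal (?F t - ?F 0)"
    proof (rule nn_integral_FTC_Icc[where F="?F"])
      fix h
      have "DERIV ?F h :> - (L ^ Suc n * (real (Suc (Suc n)) * (t - h) ^ Suc n * (0 - 1)) / fact (Suc (Suc n)))"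
        by (rule derivative_eq_intros refl | simp)+
      also have "- (L ^ Suc n * (real (Suc (Suc n)) * (t - h) ^ Suc n * (0 - 1)) / fact (Suc (Suc n))) = L ^ Suc n * (t - h) ^ Suc n / fact (Suc n)"
        unfolding fact_Suc[of "Suc n"] by (simp del: fact_Suc power_Suc of_nat_Suc add: divide_simps)
      finally show "DERIV ?F h :> L ^ Suc n * (t - h) ^ Suc n / fact (Suc n)" .
      show "0 \<le> L ^ Suc n * (t - h) ^ Suc n / fact (Suc n)" if "h \<in> {0..t}"
        using that L by simp
    qed (use True in auto)
    finally show ?thesis using True by simp
  next
    case False
    then show ?thesis by (simp add: max_def)
  qed
  finally show ?case by (simp add: mult_left_mono)
qed simp

lemma remainder_tendsto_0:
  assumes "s \<in> S"
  shows "(\<lambda>n. remainder n s t) \<longlonglongrightarrow> 0"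
proof -
  let ?c = "\<lambda>n. L ^ n * max 0 t ^ Suc n / fact (Suc n)"
  have "(\<lambda>n. 1 / L * (inverse (fact (Suc n)) * (L * max 0 t) ^ Suc n)) \<longlonglongrightarrow> 1 / L * 0"
    by (intro tendsto_intros LIMSEQ_Suc[OF summable_LIMSEQ_zero[OF summable_exp]])
  moreover have "1 / L * (inverse (fact (Suc n)) * (L * max 0 t) ^ Suc n) = ?c n" for n
    using L_pos by (simp add: power_mult_distrib field_simps del: fact_Suc)
  ultimately have "?c \<longlonglongrightarrow> 0" by simp
  then have "(\<lambda>n. ennreal (pmf \<pi> s * exit_rate q s * ?c n)) \<longlonglongrightarrow> ennreal (pmf \<pi> s * exit_rate q s * 0)"
    by (intro tendsto_ennrealI tendsto_mult tendsto_const)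
  moreover have "ennreal (pmf \<pi> s * exit_rate q s * ?c n) = ennreal (pmf \<pi> s * exit_rate q s) * ennreal (?c n)" for n
    by (rule ennreal_mult) (use L_pos in auto)
  ultimately have "(\<lambda>n. ennreal (pmf \<pi> s * exit_rate q s) * ennreal (?c n)) \<longlonglongrightarrow> 0"
    by (simp only: mult_zero_right ennreal_0)
  then show ?thesis
    by (rule tendsto_sandwich[OF _ _ tendsto_const, rotated -1])
       (use remainder_le[OF assms] in \<open>auto intro!: always_eventually\<close>)
qed

lemma suminf_visit:
  assumes s: "s \<in> S" and t: "0 \<le> t"
  shows "(\<Sum>k. visit k s t) = ennreal (pmf \<pi> s * exit_rate q s * t)"
proof -
  have c: "ennreal (pmf \<pi> s * exit_rate q s) * ennreal (max 0 t) = ennreal (pmf \<pi> s * exit_rate q s * t)"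
    using t by (simp add: ennreal_mult)
  have "(\<lambda>n. (\<Sum>k<n. visit k s t) + remainder n s t) \<longlonglongrightarrow> (\<Sum>k. visit k s t) + 0"
    by (intro tendsto_add remainder_tendsto_0[OF s] summable_LIMSEQ summableI)
  then show ?thesis
    unfolding sum_visit[OF s] c by (simp add: LIMSEQ_const_iff)
qed

lemma suminf_transitions:
  assumes s: "s \<in> S" and t: "0 \<le> t"
  shows "(\<Sum>k. emeasure M {\<omega> \<in> space M. Y k \<omega> = s \<and> Y (Suc k) \<omega> = s' \<and> elapsed (Suc k) \<omega> \<le> t})
    = ennreal (pmf \<pi> s * q s s' * t)"
proof -
  have "(\<Sum>k. emeasure M {\<omega> \<in> space M. Y k \<omega> = s \<and> Y (Suc k) \<omega> = s' \<and> elapsed (Suc k) \<omega> \<le> t})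
    = ennreal (pmf \<pi> s * exit_rate q s * t) * ennreal (P s s')"
    unfolding visit_transition[OF s] by (simp add: suminf_visit[OF s t])
  also have "\<dots> = ennreal (pmf \<pi> s * q s s' * t)"
    using t exit_rate_pos[of s] by (simp add: ennreal_mult[symmetric] P_nonneg ac_simps)
  finally show ?thesis .
qed

end

section \<open>Packets along a path\<close>

definition served :: "'c node \<Rightarrow> (nat \<Rightarrow> 'c state) \<Rightarrow> nat \<Rightarrow> nat \<Rightarrow> nat" where
  "served v y k i = card {l \<in> {k<..<i}. start_at v y l}"

text \<open>Place in the queue while the path is in state \<open>y i\<close>, before jump
  \<open>i\<close>, counting the packet itself: \<open>1\<close> when it is next, \<open>0\<close>
  once it has left. Truncated subtraction keeps it at \<open>0\<close> through later starts.\<close>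

definition position :: "'c node \<Rightarrow> (nat \<Rightarrow> 'c state) \<Rightarrow> nat \<Rightarrow> nat \<Rightarrow> nat" where
  "position v y k i = fst (y (Suc k)) v - served v y k i"

text \<open>Also refers to state \<open>y i\<close>. The index of the completing jump is still
  included, because that jump ends the holding period of the last state with the packet in
  transmission.\<close>

definition transmitting :: "'c node \<Rightarrow> (nat \<Rightarrow> 'c state) \<Rightarrow> nat \<Rightarrow> nat \<Rightarrow> bool" where
  "transmitting v y k i \<longleftrightarrow> (\<exists>m<i. packet_start v y k m \<and> (\<forall>l. m < l \<longrightarrow> l < i \<longrightarrow> \<not> completion y l))"

lemma served_Suc:
  assumes "k < i"
  shows "served v y k (Suc i) = served v y k i + of_bool (start_at v y i)"
proof -
  have "{l \<in> {k<..<Suc i}. start_at v y l} = {l \<in> {k<..<i}. start_at v y l} \<union> (if start_at v y i then {i} else {})"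
    using assms by (auto simp: less_Suc_eq)
  then show ?thesis by (simp add: served_def)
qed

lemma served_first [simp]: "served v y k (Suc k) = 0"
  by (simp add: served_def)

lemma served_mono: "i \<le> i' \<Longrightarrow> served v y k i \<le> served v y k i'"
  unfolding served_def by (intro card_mono) auto

lemma position_first [simp]: "position v y k (Suc k) = fst (y (Suc k)) v"
  by (simp add: position_def)

lemma position_Suc: "k < i \<Longrightarrow> position v y k (Suc i) = position v y k i - of_bool (start_at v y i)"
  by (simp add: position_def served_Suc)

lemma position_antimono: "i \<le> i' \<Longrightarrow> position v y k i' \<le> position v y k i"
  unfolding position_def using served_mono by (intro diff_le_mono2)

lemma packet_start_iff:
  assumes "arrival_at v y k"
  shows "packet_start v y k m \<longleftrightarrow> k < m \<and> start_at v y m \<and> position v y k m = 1"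
proof (cases "k < m \<and> start_at v y m")
  case True
  have "card {l \<in> {k<..m}. start_at v y l} = served v y k (Suc m)"
    unfolding served_def by (rule arg_cong[where f=card]) auto
  also have "\<dots> = served v y k m + 1" using True by (simp add: served_Suc)
  finally show ?thesis
    using True assms unfolding packet_start_def position_def arrival_at_def by auto
qed (auto simp: packet_start_def)

lemma transmitting_first: "\<not> transmitting v y k (Suc k)"
  by (auto simp: transmitting_def packet_start_def)

lemma transmitting_Suc:
  "transmitting v y k (Suc i) \<longleftrightarrow> packet_start v y k i \<or> (transmitting v y k i \<and> \<not> completion y i)"
  unfolding transmitting_def by (auto simp: less_Suc_eq)

lemma jump_time_diff:
  assumes "k \<le> m"
  shows "jump_time h m - jump_time h k = (\<Sum>i\<in>{k<..m}. h i)"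
proof -
  have "{..m} = {..k} \<union> {k<..m}" using assms by auto
  moreover have "(\<Sum>i\<in>{..k} \<union> {k<..m}. h i) = (\<Sum>i\<in>{..k}. h i) + (\<Sum>i\<in>{k<..m}. h i)"
    by (rule sum.union_disjoint) auto
  ultimately have "jump_time h m = jump_time h k + (\<Sum>i\<in>{k<..m}. h i)"
    unfolding jump_time_def by simp
  then show ?thesis by simp
qed

text \<open>Writes the time between two jumps as a series over the age since arrival with an
  indicator, the form in which expectations are computed step by step.\<close>

lemma suminf_interval:
  assumes h: "\<And>i. 0 \<le> h i" and "k \<le> a"
    and Q: "\<And>i. k < i \<Longrightarrow> Q i \<longleftrightarrow> a < i \<and> i \<le> b"
  shows "(\<Sum>n. of_bool (Q (Suc k + n)) * ennreal (h (Suc k + n))) = ennreal (\<Sum>i\<in>{a<..b}. h i)"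
proof -
  have "(\<Sum>n. of_bool (Q (Suc k + n)) * ennreal (h (Suc k + n)))
    = (\<Sum>n\<in>{n. a < Suc k + n \<and> Suc k + n \<le> b}. of_bool (Q (Suc k + n)) * ennreal (h (Suc k + n)))"
    by (rule suminf_finite) (auto simp: Q intro: finite_subset[of _ "{..b}"])
  also have "\<dots> = (\<Sum>n\<in>{n. a < Suc k + n \<and> Suc k + n \<le> b}. ennreal (h (Suc k + n)))"
    by (intro sum.cong) (auto simp: Q)
  also have "\<dots> = (\<Sum>i\<in>{a<..b}. ennreal (h i))"
    using assms(2) by (intro sum.reindex_bij_witness[of _ "\<lambda>i. i - Suc k" "\<lambda>n. Suc k + n"]) auto
  also have "\<dots> = ennreal (\<Sum>i\<in>{a<..b}. h i)"
    by (rule sum_ennreal) (rule h)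
  finally show ?thesis .
qed

context
  fixes v :: "'c node" and y :: "nat \<Rightarrow> 'c state" and h :: "nat \<Rightarrow> real" and k :: nat
  assumes arrival: "arrival_at v y k" and h: "\<And>i. 0 \<le> h i"
    and leaves: "\<exists>i>k. position v y k i = 0"
begin

text \<open>The position drops by at most one per jump, so just before it first vanishes it equals
  \<open>1\<close> and a start happens; that start is the last index with positive position.\<close>

lemma ex_packet_start:
  "\<exists>m. packet_start v y k m \<and> (\<forall>m'. packet_start v y k m' \<longrightarrow> m' = m) \<and>
    (\<forall>i>k. 0 < position v y k i \<longleftrightarrow> i \<le> m)"
proof -
  define i where "i = (LEAST i. k < i \<and> position v y k i = 0)"
  have i: "k < i" "position v y k i = 0"
    using LeastI_ex[of "\<lambda>i. k < i \<and> position v y k i = 0"] leaves by (auto simp: i_def)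
  have least: "0 < position v y k i'" if "k < i'" "i' < i" for i'
    using not_less_Least[of i' "\<lambda>i. k < i \<and> position v y k i = 0"] that by (auto simp: i_def)
  have "position v y k (Suc k) \<noteq> 0"
    using arrival by (simp add: arrival_at_def)
  then have "i \<noteq> Suc k" using i by metis
  then obtain m where m: "i = Suc m" "k < m" using i(1) by (cases i) auto
  have pm: "0 < position v y k m" using least m by simp
  have *: "0 < position v y k i' \<longleftrightarrow> i' \<le> m" if "k < i'" for i'
  proof (cases "i' \<le> m")
    case True
    then show ?thesis using least m that by simp
  next
    case False
    then have "position v y k i' \<le> position v y k i" using m by (intro position_antimono) simp
    then show ?thesis using i False by simp
  qed
  have "position v y k m = of_bool (start_at v y m)"
    using pm i position_Suc[of k m v y] m by (cases "start_at v y m") auto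
  then have st: "packet_start v y k m"
    using pm m packet_start_iff[OF arrival, of m] by (cases "start_at v y m") auto
  have "m' = m" if "packet_start v y k m'" for m'
  proof -
    have m': "k < m'" "position v y k m' = 1" "start_at v y m'"
      using that packet_start_iff[OF arrival] by auto
    then have "position v y k (Suc m') = 0" by (simp add: position_Suc)
    then show ?thesis using *[of m'] *[of "Suc m'"] m' by auto
  qed
  then show ?thesis using st * by blast
qed

lemma waiting_time_eq:
  "waiting_time v y h k = (\<Sum>n. of_bool (0 < position v y k (Suc k + n)) * ennreal (h (Suc k + n)))"
proof -
  obtain m where m: "packet_start v y k m" "\<And>m'. packet_start v y k m' \<Longrightarrow> m' = m"
    "\<And>i. k < i \<Longrightarrow> 0 < position v y k i \<longleftrightarrow> i \<le> m" using ex_packet_start by blast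
  have "{m. packet_start v y k m} = {m}" using m(1,2) by blast
  then have "waiting_time v y h k = ennreal (\<Sum>i\<in>{k<..m}. h i)"
    using m(1) by (simp add: waiting_time_def jump_time_diff packet_start_def)
  also have "\<dots> = (\<Sum>n. of_bool (0 < position v y k (Suc k + n)) * ennreal (h (Suc k + n)))"
    by (rule suminf_interval[symmetric]) (auto simp: m(3) h)
  finally show ?thesis .
qed

text \<open>The infimum runs over all later completions, so the first one after the start bounds it;
  up to that jump the packet counts as transmitting.\<close>

lemma transmission_time_le:
  assumes ends: "\<And>i0. \<exists>i\<ge>i0. \<not> transmitting v y k i"
  shows "transmission_time v y h k \<le> (\<Sum>n. of_bool (transmitting v y k (Suc k + n)) * ennreal (h (Suc k + n)))"
proof -
  obtain m where m: "packet_start v y k m" "\<And>m'. packet_start v y k m' \<Longrightarrow> m' = m" using ex_packet_start by blast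
  have km: "k < m" using m(1) by (simp add: packet_start_def)
  obtain i where i: "Suc m \<le> i" "\<not> transmitting v y k i" using ends by blast
  then have "\<exists>l. m < l \<and> completion y l"
    using m(1) unfolding transmitting_def by (metis Suc_le_lessD)
  define e where "e = (LEAST l. m < l \<and> completion y l)"
  have e: "m < e" "completion y e"
    using LeastI_ex[of "\<lambda>l. m < l \<and> completion y l"] \<open>\<exists>l. m < l \<and> completion y l\<close> by (auto simp: e_def)
  have least: "\<not> completion y l" if "m < l" "l < e" for l
    using not_less_Least[of l "\<lambda>l. m < l \<and> completion y l"] that by (auto simp: e_def)
  have tr: "transmitting v y k i \<longleftrightarrow> m < i \<and> i \<le> e" for i
  proof
    assume "transmitting v y k i"
    then have "m < i" "\<forall>l. m < l \<longrightarrow> l < i \<longrightarrow> \<not> completion y l"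
      using m(2) unfolding transmitting_def by auto
    then show "m < i \<and> i \<le> e" using e by (meson not_le)
  next
    assume "m < i \<and> i \<le> e"
    then show "transmitting v y k i" using m(1) least unfolding transmitting_def by (metis less_le_trans)
  qed
  have "transmission_time v y h k \<le> ennreal (jump_time h e - jump_time h m)"
    unfolding transmission_time_def using m(1) e by (intro INF_lower2[of "(m, e)"]) auto
  also have "\<dots> = ennreal (\<Sum>i\<in>{m<..e}. h i)" using e by (simp add: jump_time_diff)
  also have "\<dots> = (\<Sum>n. of_bool (transmitting v y k (Suc k + n)) * ennreal (h (Suc k + n)))"
    using km by (intro suminf_interval[symmetric] h tr) simp
  finally show ?thesis .
qed

end

text \<open>This and the following congruences record that the status of a packet at step
  \<open>i\<close> depends only on the path up to \<open>i\<close>, seen through the queue of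
  \<open>v\<close> and the activity. Measurability of packet events rests on this.\<close>

lemma start_at_cong:
  "(\<And>l. l \<le> i \<Longrightarrow> fst (y l) v = fst (y' l) v) \<Longrightarrow> l < i \<Longrightarrow> start_at v y l = start_at v y' l"
  by (auto simp: start_at_def)

lemma served_cong:
  "(\<And>l. l \<le> i \<Longrightarrow> fst (y l) v = fst (y' l) v) \<Longrightarrow> served v y k i = served v y' k i"
  unfolding served_def using start_at_cong[of i y v y'] by (intro arg_cong[where f=card]) auto

lemma position_cong:
  "(\<And>l. l \<le> i \<Longrightarrow> fst (y l) v = fst (y' l) v) \<Longrightarrow> k < i \<Longrightarrow> position v y k i = position v y' k i"
  unfolding position_def using served_cong[of i y v y' k] by simp

lemma arrival_at_cong:
  "(\<And>l. l \<le> i \<Longrightarrow> fst (y l) v = fst (y' l) v) \<Longrightarrow> k < i \<Longrightarrow> arrival_at v y k = arrival_at v y' k"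
  by (auto simp: arrival_at_def)

lemma packet_start_cong:
  assumes "\<And>l. l \<le> i \<Longrightarrow> fst (y l) v = fst (y' l) v" "m < i"
  shows "packet_start v y k m = packet_start v y' k m"
proof (cases "k < m")
  case True
  have "{l \<in> {k<..m}. start_at v y l} = {l \<in> {k<..m}. start_at v y' l}"
    using assms by (intro Collect_cong) (auto simp: start_at_def)
  then show ?thesis using True assms by (simp add: packet_start_def start_at_def)
qed (simp add: packet_start_def)

lemma transmitting_cong:
  assumes "\<And>l. l \<le> i \<Longrightarrow> fst (y l) v = fst (y' l) v \<and> snd (y l) = snd (y' l)"
  shows "transmitting v y k i = transmitting v y' k i"
proof -
  have "packet_start v y k m = packet_start v y' k m" if "m < i" for m
    using assms that by (intro packet_start_cong[of i]) auto
  moreover have "completion y l = completion y' l" if "l < i" for l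
    using assms that by (simp add: completion_def)
  ultimately show ?thesis unfolding transmitting_def by auto
qed

section \<open>Transitions, packet events and their measurability\<close>

context network_rates
begin

lemma rate_cases:
  assumes "q (x, a) s' \<noteq> 0"
  obtains (arrival) u where "u \<in> nodes n" "s' = (x(u := x u + 1), a)"
  | (start) u where "u \<in> nodes n" "a = None" "0 < x u" "s' = (x(u := x u - 1), Some (fst u))"
  | (completion) c where "a = Some c" "s' = (x, None)"
proof (rule ccontr)
  assume no: "\<not> thesis"
  have "(\<Sum>v\<in>nodes n. arr v * indicator {(x(v := x v + 1), a)} s') = 0 \<and>
     (\<Sum>v\<in>nodes n. (if a = None \<and> 0 < x v then bk v else 0) * indicator {(x(v := x v - 1), Some (fst v))} s') = 0 \<and>
     (\<Sum>c\<in>UNIV. (if a = Some c then mu c else 0) * indicator {(x, None)} s') = 0"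
    using no that by (intro conjI sum.neutral) (auto simp: indicator_def)
  then show False using assms unfolding network_rate_eq by simp
qed

lemma network_states_closed:
  assumes "s \<in> network_states n" "q s s' \<noteq> 0"
  shows "s' \<in> network_states n"
proof -
  obtain x a where s: "s = (x, a)" by fastforce
  from assms(2)[unfolded s] show ?thesis
    using assms(1) by (cases rule: rate_cases) (auto simp: s network_states_def)
qed

lemma countable_network_states: "countable (network_states n)"
proof -
  let ?f = "\<lambda>(x, a). (\<lambda>v. if v \<in> nodes n then x v else 0 :: nat, a)"
  have "s \<in> ?f ` (Pi\<^sub>E (nodes n) (\<lambda>_. UNIV) \<times> UNIV)" if "s \<in> network_states n" for s
  proof -
    have "s = ?f (restrict (fst s) (nodes n), snd s)"
      using that by (cases s) (auto simp: network_states_def fun_eq_iff)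
    moreover have "(restrict (fst s) (nodes n), snd s) \<in> Pi\<^sub>E (nodes n) (\<lambda>_. UNIV) \<times> UNIV" by auto
    ultimately show ?thesis by (rule image_eqI)
  qed
  moreover have "countable (Pi\<^sub>E (nodes n) (\<lambda>_. UNIV :: nat set) \<times> (UNIV :: 'c option set))"
    by (intro countable_SIGMA countable_PiE) auto
  ultimately show ?thesis
    by (meson countable_image countable_subset subsetI)
qed

end

locale packet_process = stationary_network n lam mu nu \<pi>
  for n :: "'c::finite \<Rightarrow> nat" and lam mu nu :: "'c \<Rightarrow> real" and \<pi> :: "'c state pmf" +
  fixes M :: "'w measure" and Y :: "nat \<Rightarrow> 'w \<Rightarrow> 'c state" and H :: "nat \<Rightarrow> 'w \<Rightarrow> real" and v :: "'c node"
  assumes process: "markov_jump_process (network_rate n lam mu nu) \<pi> M Y H"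
    and v: "v \<in> nodes n"
begin

sublocale J: jump_process q total_rate \<pi> "network_states n" M Y H
  by unfold_locales
     (use stationary support process network_states_closed countable_network_states in auto)

abbreviation S :: "'c state set" where
  "S \<equiv> network_states n"

text \<open>The observed part of a path prefix is a list over a countable type, so its code
  \<open>Z\<close> is measurable, and then so is every predicate of it, whatever its logical
  form.\<close>

lemma pred_of_path:
  assumes Y: "\<And>l. l \<le> i \<Longrightarrow> Y l \<in> measurable N (count_space UNIV)"
    and cong: "\<And>y y'. (\<And>l. l \<le> i \<Longrightarrow> fst (y l) v = fst (y' l) v \<and> snd (y l) = snd (y' l)) \<Longrightarrow> \<Phi> y = \<Phi> y'"
  shows "Measurable.pred N (\<lambda>\<omega>. \<Phi> (\<lambda>l. Y l \<omega>))"
proof -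
  define Z where "Z \<omega> = map (\<lambda>l. (fst (Y l \<omega>) v, snd (Y l \<omega>))) [0..<Suc i]" for \<omega>
  have Zi: "Z \<omega> = zs \<longleftrightarrow> length zs = Suc i \<and> (\<forall>l\<le>i. (fst (Y l \<omega>) v, snd (Y l \<omega>)) = zs ! l)" for \<omega> zs
    by (auto simp: Z_def list_eq_iff_nth_eq less_Suc_eq_le simp del: upt_Suc)
  have Zm: "Z \<in> measurable N (count_space UNIV)"
    unfolding measurable_count_space_eq_countable[OF countableI_type]
  proof (intro conjI ballI)
    fix zs :: "(nat \<times> 'c option) list"
    have "Measurable.pred N (\<lambda>\<omega>. l \<le> i \<longrightarrow> (fst (Y l \<omega>) v, snd (Y l \<omega>)) = zs ! l)" for l
    proof (cases "l \<le> i")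
      case True
      have "Measurable.pred N (\<lambda>\<omega>. (fst (Y l \<omega>) v, snd (Y l \<omega>)) = zs ! l)"
        by (rule measurable_compose[OF Y[OF True]]) simp
      then show ?thesis by simp
    qed simp
    then have "Measurable.pred N (\<lambda>\<omega>. length zs = Suc i \<and> (\<forall>l\<le>i. (fst (Y l \<omega>) v, snd (Y l \<omega>)) = zs ! l))"
      by measurable
    then have "{\<omega> \<in> space N. Z \<omega> = zs} \<in> sets N" unfolding Zi pred_def .
    also have "{\<omega> \<in> space N. Z \<omega> = zs} = Z -` {zs} \<inter> space N" by auto
    finally show "Z -` {zs} \<inter> space N \<in> sets N" .
  qed simp
  have "\<Phi> (\<lambda>l. Y l \<omega>) = \<Phi> (\<lambda>l. (\<lambda>_. fst (Z \<omega> ! l), snd (Z \<omega> ! l)))" for \<omega>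
    by (rule cong) (simp add: Z_def del: upt_Suc)
  then show ?thesis
    using measurable_compose[OF Zm, of "\<lambda>zs. \<Phi> (\<lambda>l. (\<lambda>_. fst (zs ! l), snd (zs ! l)))" "count_space UNIV"] by simp
qed

definition packet :: "nat \<Rightarrow> 'w \<Rightarrow> bool" where
  "packet k \<omega> \<longleftrightarrow> arrival_at v (\<lambda>l. Y l \<omega>) k \<and> J.elapsed (Suc k) \<omega> \<le> 1"

abbreviation "pos \<equiv> \<lambda>k i \<omega>. position v (\<lambda>l. Y l \<omega>) k i"
abbreviation "sending \<equiv> \<lambda>k i \<omega>. transmitting v (\<lambda>l. Y l \<omega>) k i"

lemma packet_history:
  assumes "k < i"
  shows "Measurable.pred (J.history i) (packet k)"
proof -
  have "Measurable.pred (J.history i) (\<lambda>\<omega>. arrival_at v (\<lambda>l. Y l \<omega>) k)"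
    by (rule pred_of_path[where i=i]) (use assms in \<open>auto intro!: arrival_at_cong[of i]\<close>)
  moreover have "J.elapsed (Suc k) \<in> borel_measurable (J.history i)"
    unfolding J.elapsed_def[abs_def] using assms by (intro borel_measurable_sum J.measurable_H_history) auto
  ultimately show ?thesis unfolding packet_def[abs_def] by measurable
qed

lemma pos_history:
  assumes "k < i"
  shows "Measurable.pred (J.history i) (\<lambda>\<omega>. R (pos k i \<omega>))"
  by (rule pred_of_path[where i=i]) (use assms in \<open>auto intro!: arg_cong[where f=R] position_cong[of i]\<close>)

lemma trans_history: "Measurable.pred (J.history i) (\<lambda>\<omega>. sending k i \<omega>)"
  by (rule pred_of_path[where i=i]) (auto intro!: transmitting_cong[of i])

lemma packet_measurable [measurable]: "Measurable.pred M (packet k)"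
  by (rule J.measurable_from_history[OF packet_history[of k "Suc k"]]) simp

lemma pos_measurable [measurable]: "Measurable.pred M (\<lambda>\<omega>. R (pos k (Suc k + m) \<omega>))"
  by (rule J.measurable_from_history[OF pos_history]) simp

lemma trans_measurable [measurable]: "Measurable.pred M (\<lambda>\<omega>. sending k i \<omega>)"
  by (rule J.measurable_from_history[OF trans_history])

lemma AE_transitions: "AE \<omega> in M. \<forall>i. q (Y i \<omega>) (Y (Suc i) \<omega>) \<noteq> 0"
proof -
  have "AE \<omega> in M. \<forall>s\<in>S. \<forall>s'\<in>S. q s s' = 0 \<longrightarrow> \<not> (Y i \<omega> = s \<and> Y (Suc i) \<omega> = s')" for i
  proof (intro AE_ball_countable' countable_network_states)
    fix s s' assume s: "s \<in> S"
    show "AE \<omega> in M. q s s' = 0 \<longrightarrow> \<not> (Y i \<omega> = s \<and> Y (Suc i) \<omega> = s')"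
    proof (cases "q s s' = 0")
      case True
      then have "emeasure M {\<omega> \<in> space M. Y i \<omega> = s \<and> Y (Suc i) \<omega> = s'} = 0"
        using J.markov_transition[where n=i and Q="\<lambda>_. True" and s=s and s'=s'] s by simp
      then show ?thesis by (intro AE_I[where N="{\<omega> \<in> space M. Y i \<omega> = s \<and> Y (Suc i) \<omega> = s'}"]) auto
    qed simp
  qed
  then have "AE \<omega> in M. \<forall>i. \<forall>s\<in>S. \<forall>s'\<in>S. q s s' = 0 \<longrightarrow> \<not> (Y i \<omega> = s \<and> Y (Suc i) \<omega> = s')"
    by (simp add: AE_all_countable)
  then show ?thesis using J.AE_path by eventually_elim blast
qed

text \<open>Induction along the path: the start sets the activity to the class of \<open>v\<close>,
  arrivals preserve it, and any other transition from an active state is a completion, which ends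
  the transmission.\<close>

lemma AE_transmitting_class: "AE \<omega> in M. \<forall>k i. sending k i \<omega> \<longrightarrow> snd (Y i \<omega>) = Some (fst v)"
  using AE_transitions
proof eventually_elim
  case (elim \<omega>)
  have "snd (Y i \<omega>) = Some (fst v)" if "sending k i \<omega>" for k i
    using that
  proof (induction i)
    case 0
    then show ?case by (simp add: transmitting_def)
  next
    case (Suc i)
    obtain x a where s: "Y i \<omega> = (x, a)" by fastforce
    have qi: "q (x, a) (Y (Suc i) \<omega>) \<noteq> 0" using elim s by metis
    show ?case
    proof (cases "packet_start v (\<lambda>l. Y l \<omega>) k i")
      case True
      then have "x v = fst (Y (Suc i) \<omega>) v + 1" by (simp add: packet_start_def start_at_def s)
      with qi show ?thesis by (cases rule: rate_cases) (auto split: if_splits)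
    next
      case False
      then have t: "sending k i \<omega>" "\<not> completion (\<lambda>l. Y l \<omega>) i" using Suc.prems by (auto simp: transmitting_Suc)
      then have "a = Some (fst v)" using Suc.IH s by simp
      with qi t(2) show ?thesis by (cases rule: rate_cases) (auto simp: completion_def s)
    qed
  qed
  then show ?case by blast
qed

end

section \<open>Little's law\<close>

text \<open>Series are written as integrals so that Tonelli for counting measures covers exchanges
  with state sums and expectations uniformly.\<close>

abbreviation nat_sum :: "(nat \<Rightarrow> ennreal) \<Rightarrow> ennreal" where
  "nat_sum f \<equiv> (\<integral>\<^sup>+k. f k \<partial>count_space UNIV)"

lemma nat_sum_le:
  assumes "\<And>N. (\<Sum>n<N. f n) \<le> c"
  shows "nat_sum f \<le> c"
  unfolding nn_integral_count_space_nat suminf_eq_SUP using assms by (intro SUP_least)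

lemma nat_sum_split: "nat_sum f = f 0 + nat_sum (\<lambda>n. f (Suc n))"
proof -
  have "(\<lambda>N. f 0 + (\<Sum>n<N. f (Suc n))) \<longlonglongrightarrow> f 0 + (\<Sum>n. f (Suc n))"
    by (intro tendsto_intros summable_LIMSEQ summableI)
  then have "(\<lambda>N. \<Sum>n<Suc N. f n) \<longlonglongrightarrow> f 0 + (\<Sum>n. f (Suc n))"
    by (simp only: sum.lessThan_Suc_shift)
  then have "(\<lambda>N. \<Sum>n<N. f n) \<longlonglongrightarrow> f 0 + (\<Sum>n. f (Suc n))"
    by (rule LIMSEQ_imp_Suc)
  from LIMSEQ_unique[OF summable_LIMSEQ[OF summableI] this] show ?thesis
    unfolding nn_integral_count_space_nat .
qed

lemma finite_nat_sum_of_bool: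
  assumes "nat_sum (\<lambda>n. of_bool (Q n)) \<noteq> \<infinity>"
  shows "\<exists>n\<ge>n0. \<not> Q n"
proof -
  have "nat_sum (\<lambda>n. of_bool (Q n)) = (\<integral>\<^sup>+n. indicator {n. Q n} n \<partial>count_space UNIV)"
    by (intro nn_integral_cong) (simp add: indicator_def)
  also have "\<dots> = emeasure (count_space UNIV) {n. Q n}" by simp
  finally have "finite {n. Q n}"
    using assms by (metis emeasure_count_space_infinite infinity_ennreal_def subset_UNIV)
  then have "infinite (- {n. Q n})" by (simp add: Compl_eq_Diff_UNIV)
  then show ?thesis
    unfolding infinite_nat_iff_unbounded_le by auto
qed

lemma nat_sum_of_bool_less: "nat_sum (\<lambda>r. of_bool (Suc r \<le> m)) = of_nat m"
proof -
  have "nat_sum (\<lambda>r. of_bool (Suc r \<le> m)) = (\<integral>\<^sup>+r. indicator {..<m} r \<partial>count_space UNIV)"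
    by (intro nn_integral_cong) (simp add: indicator_def Suc_le_eq)
  also have "\<dots> = of_nat m" by simp
  finally show ?thesis .
qed

section \<open>Flow balance of waiting packets\<close>

context packet_process
begin

abbreviation state_sum :: "('c state \<Rightarrow> ennreal) \<Rightarrow> ennreal" where
  "state_sum f \<equiv> (\<integral>\<^sup>+s. f s \<partial>count_space S)"

abbreviation Pr :: "'c state \<Rightarrow> 'c state \<Rightarrow> ennreal" where
  "Pr s s' \<equiv> ennreal (q s s' / exit_rate q s)"

abbreviation flow :: "'c state \<Rightarrow> ennreal" where
  "flow s \<equiv> ennreal (pmf \<pi> s * exit_rate q s)"

definition arrives :: "'c state \<Rightarrow> 'c state \<Rightarrow> bool" where
  "arrives s s' \<longleftrightarrow> fst s' v = fst s v + 1"

definition starts :: "'c state \<Rightarrow> 'c state \<Rightarrow> bool" where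
  "starts s s' \<longleftrightarrow> fst s v = fst s' v + 1"

definition completes :: "'c state \<Rightarrow> 'c state \<Rightarrow> bool" where
  "completes s s' \<longleftrightarrow> snd s \<noteq> None \<and> snd s' = None"

lemma state_sum_swap: "state_sum (\<lambda>s. state_sum (\<lambda>s'. f s s')) = state_sum (\<lambda>s'. state_sum (\<lambda>s. f s s'))"
  by (rule nn_integral_count_space_nn_integral[OF countable_network_states]) simp

lemma nat_state_swap: "nat_sum (\<lambda>k. state_sum (\<lambda>s. f k s)) = state_sum (\<lambda>s. nat_sum (\<lambda>k. f k s))"
  by (rule nn_integral_count_space_nn_integral[OF countable_network_states]) simp

lemma nat_nat_swap: "nat_sum (\<lambda>k. nat_sum (\<lambda>m. f k m)) = nat_sum (\<lambda>m. nat_sum (\<lambda>k. f k m))"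
  by (rule nn_integral_count_space_nn_integral) simp_all

lemma nat_sum_integral:
  "(\<And>k. f k \<in> borel_measurable M) \<Longrightarrow> (\<integral>\<^sup>+\<omega>. nat_sum (\<lambda>k. f k \<omega>) \<partial>M) = nat_sum (\<lambda>k. \<integral>\<^sup>+\<omega>. f k \<omega> \<partial>M)"
  by (rule nn_integral_count_space_nn_integral) simp_all

lemma state_sum_pmf: "state_sum (\<lambda>s. ennreal (pmf \<pi> s) * f s) = (\<integral>\<^sup>+s. f s \<partial>measure_pmf \<pi>)"
  unfolding nn_integral_measure_pmf
proof (rule nn_integral_count_space_eq)
  fix s assume "s \<in> S - UNIV" then show "ennreal (pmf \<pi> s) * f s = 0" by simp
next
  fix s assume "s \<in> UNIV - S"
  then have "pmf \<pi> s = 0" using support by (meson DiffD2 set_pmf_iff subsetD)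
  then show "ennreal (pmf \<pi> s) * f s = 0" by simp
qed

lemma exit_rate_Pr: "ennreal (exit_rate q s) * Pr s s' = ennreal (q s s')"
  using exit_rate_pos[of s] by (simp add: ennreal_mult[symmetric] J.P_nonneg)

lemma flow_Pr: "flow s * Pr s s' = ennreal (pmf \<pi> s) * ennreal (q s s')"
  by (simp add: ennreal_mult exit_rate_Pr mult.assoc)

lemma rate_sum:
  assumes s: "s \<in> S"
  shows "state_sum (\<lambda>s'. ennreal (q s s') * F s') = kernel_sum F (\<lambda>r. (*) (ennreal r)) s"
  unfolding nn_integral_rate_mult[symmetric]
proof (rule nn_integral_count_space_eq)
  fix s' assume "s' \<in> UNIV - S"
  then have "q s s' = 0" using network_states_closed[OF s, of s'] by auto
  then show "ennreal (q s s') * F s' = 0" by simp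
qed auto

lemma rate_arrives: "s \<in> S \<Longrightarrow> state_sum (\<lambda>s'. ennreal (q s s') * of_bool (arrives s s')) = ennreal (arr v)"
proof -
  assume s: "s \<in> S"
  obtain x a where xa: "s = (x, a)" by fastforce
  have "(\<Sum>u\<in>nodes n. ennreal (arr u) * of_bool (arrives (x, a) (x(u := x u + 1), a))) = (\<Sum>u\<in>nodes n. if u = v then ennreal (arr v) else 0)"
    by (intro sum.cong) (auto simp: arrives_def)
  moreover have "(\<Sum>u\<in>nodes n. if a = None \<and> 0 < x u then ennreal (bk u) * of_bool (arrives (x, a) (x(u := x u - 1), Some (fst u))) else 0) = 0"
    by (intro sum.neutral) (auto simp: arrives_def)
  moreover have "(\<Sum>c\<in>UNIV. if a = Some c then ennreal (mu c) * of_bool (arrives (x, a) (x, None)) else 0) = 0"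
    by (intro sum.neutral) (auto simp: arrives_def)
  ultimately show ?thesis
    unfolding rate_sum[OF s] using v by (simp only: kernel_sum_def xa prod.case) simp
qed

lemma rate_starts:
  "s \<in> S \<Longrightarrow> state_sum (\<lambda>s'. ennreal (q s s') * of_bool (starts s s')) = ennreal (bk v) * of_bool (0 < fst s v \<and> snd s = None)"
proof -
  assume s: "s \<in> S"
  obtain x a where xa: "s = (x, a)" by fastforce
  have "(\<Sum>u\<in>nodes n. ennreal (arr u) * of_bool (starts (x, a) (x(u := x u + 1), a))) = 0"
    by (intro sum.neutral) (auto simp: starts_def)
  moreover have "(\<Sum>u\<in>nodes n. if a = None \<and> 0 < x u then ennreal (bk u) * of_bool (starts (x, a) (x(u := x u - 1), Some (fst u))) else 0)
     = (\<Sum>u\<in>nodes n. if u = v then ennreal (bk v) * of_bool (0 < x v \<and> a = None) else 0)"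
    by (intro sum.cong) (auto simp: starts_def)
  moreover have "(\<Sum>c\<in>UNIV. if a = Some c then ennreal (mu c) * of_bool (starts (x, a) (x, None)) else 0) = 0"
    by (intro sum.neutral) (auto simp: starts_def)
  ultimately show ?thesis
    unfolding rate_sum[OF s] using v by (simp only: kernel_sum_def xa prod.case) simp
qed

lemma rate_completes:
  assumes s: "s \<in> S" and c: "snd s = Some c"
  shows "state_sum (\<lambda>s'. ennreal (q s s') * of_bool (completes s s')) = ennreal (mu c)"
proof -
  obtain x where xa: "s = (x, Some c)" using c by (cases s) auto
  show ?thesis
    unfolding rate_sum[OF s] kernel_sum_def
    by (simp add: xa completes_def cong: if_cong)
qed

text \<open>After a transition at least \<open>r\<close> packets are queued if the arriving one has
  just become number \<open>r\<close>, or if at least \<open>r\<close> of the previous ones remain,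
  where a start uses up one. The two cases exclude each other.\<close>

lemma position_balance:
  assumes "q s s' \<noteq> 0" "1 \<le> r"
  shows "of_bool (arrives s s' \<and> fst s' v = r) + of_bool (r + of_bool (starts s s') \<le> fst s v) = (of_bool (r \<le> fst s' v) :: ennreal)"
proof -
  obtain x a where s: "s = (x, a)" by fastforce
  from assms(1)[unfolded s] have "fst s' v = x v \<or> fst s' v = x v + 1 \<or> x v = fst s' v + 1"
    by (cases rule: rate_cases) auto
  then show ?thesis using assms(2) by (auto simp: s arrives_def starts_def)
qed

text \<open>Packets are followed by age \<open>m\<close>, the number of jumps since arrival, which
  gives linear equations for the jump chain alone. The sum over \<open>k\<close> removes the arrival
  index, so that Campbell's formula supplies the initial value.\<close>

definition waiting_flow :: "nat \<Rightarrow> nat \<Rightarrow> 'c state \<Rightarrow> ennreal" where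
  "waiting_flow m r s = nat_sum (\<lambda>k. emeasure M {\<omega> \<in> space M. (packet k \<omega> \<and> pos k (Suc k + m) \<omega> = r) \<and> Y (Suc k + m) \<omega> = s})"

definition sending_flow :: "nat \<Rightarrow> 'c state \<Rightarrow> ennreal" where
  "sending_flow m s = nat_sum (\<lambda>k. emeasure M {\<omega> \<in> space M. (packet k \<omega> \<and> sending k (Suc k + m) \<omega>) \<and> Y (Suc k + m) \<omega> = s})"

lemma emeasure_split_state:
  assumes [measurable]: "Measurable.pred M Q"
  shows "emeasure M {\<omega> \<in> space M. Q \<omega>} = state_sum (\<lambda>s. emeasure M {\<omega> \<in> space M. Q \<omega> \<and> Y i \<omega> = s})"
proof -
  have "emeasure M {\<omega> \<in> space M. Q \<omega>} = state_sum (\<lambda>s. \<integral>\<^sup>+\<omega>. of_bool (Y i \<omega> = s) * of_bool (Q \<omega>) \<partial>M)"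
    unfolding J.emeasure_of_bool[OF assms] by (rule J.nn_integral_split_state) measurable
  also have "\<dots> = state_sum (\<lambda>s. emeasure M {\<omega> \<in> space M. Q \<omega> \<and> Y i \<omega> = s})"
    by (intro nn_integral_cong, subst J.emeasure_of_bool) (auto intro!: nn_integral_cong)
  finally show ?thesis .
qed

text \<open>One step of the Markov property for an event determined by the history and the next
  state. The family \<open>Q\<close> lets the past event depend on the previous state, as it must
  when a start shifts positions.\<close>

lemma emeasure_transition_split:
  assumes [measurable]: "Measurable.pred M R"
    and Q: "\<And>s. s \<in> S \<Longrightarrow> Measurable.pred (J.history i) (Q s)"
    and RQ: "\<And>\<omega>. Y (Suc i) \<omega> = s' \<Longrightarrow> R \<omega> \<longleftrightarrow> Q (Y i \<omega>) \<omega>"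
  shows "emeasure M {\<omega> \<in> space M. R \<omega> \<and> Y (Suc i) \<omega> = s'} = state_sum (\<lambda>s. emeasure M {\<omega> \<in> space M. Q s \<omega> \<and> Y i \<omega> = s} * Pr s s')"
proof -
  have "emeasure M {\<omega> \<in> space M. R \<omega> \<and> Y (Suc i) \<omega> = s'} = state_sum (\<lambda>s. emeasure M {\<omega> \<in> space M. (R \<omega> \<and> Y (Suc i) \<omega> = s') \<and> Y i \<omega> = s})"
    by (rule emeasure_split_state) measurable
  also have "\<dots> = state_sum (\<lambda>s. emeasure M {\<omega> \<in> space M. Q s \<omega> \<and> Y i \<omega> = s \<and> Y (Suc i) \<omega> = s'})"
    by (intro nn_integral_cong arg_cong[where f="emeasure M"]) (auto simp: RQ)
  also have "\<dots> = state_sum (\<lambda>s. emeasure M {\<omega> \<in> space M. Q s \<omega> \<and> Y i \<omega> = s} * Pr s s')"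
    by (intro nn_integral_cong J.markov_transition Q) simp_all
  finally show ?thesis .
qed

lemma packet_pos_history: "k < i \<Longrightarrow> Measurable.pred (J.history i) (\<lambda>\<omega>. packet k \<omega> \<and> R (pos k i \<omega>))"
  by (intro pred_intros_logic packet_history pos_history)

text \<open>Place \<open>r\<close> after a start was place \<open>Suc r\<close> before it. The
  inversion relies on \<open>1 \<le> r\<close>, since place \<open>0\<close> is reached from both
  \<open>0\<close> and \<open>1\<close>.\<close>

lemma waiting_flow_Suc:
  assumes r: "1 \<le> r"
  shows "waiting_flow (Suc m) r s' = state_sum (\<lambda>s. waiting_flow m (r + of_bool (starts s s')) s * Pr s s')"
proof -
  have "emeasure M {\<omega> \<in> space M. (packet k \<omega> \<and> pos k (Suc k + Suc m) \<omega> = r) \<and> Y (Suc k + Suc m) \<omega> = s'}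
    = state_sum (\<lambda>s. emeasure M {\<omega> \<in> space M. (packet k \<omega> \<and> pos k (Suc k + m) \<omega> = r + of_bool (starts s s')) \<and> Y (Suc k + m) \<omega> = s} * Pr s s')" for k
    unfolding add_Suc_right
  proof (rule emeasure_transition_split)
    have "Measurable.pred M (\<lambda>\<omega>. packet k \<omega> \<and> pos k (Suc k + Suc m) \<omega> = r)" by measurable
    then show "Measurable.pred M (\<lambda>\<omega>. packet k \<omega> \<and> pos k (Suc (Suc k + m)) \<omega> = r)" by simp
    show "Measurable.pred (J.history (Suc k + m)) (\<lambda>\<omega>. packet k \<omega> \<and> pos k (Suc k + m) \<omega> = r + of_bool (starts s s'))" for s
      by (rule packet_pos_history) simp
    fix \<omega> assume "Y (Suc (Suc k + m)) \<omega> = s'"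
    then have "start_at v (\<lambda>l. Y l \<omega>) (Suc k + m) = starts (Y (Suc k + m) \<omega>) s'"
      by (simp add: start_at_def starts_def)
    then show "(packet k \<omega> \<and> pos k (Suc (Suc k + m)) \<omega> = r) = (packet k \<omega> \<and> pos k (Suc k + m) \<omega> = r + of_bool (starts (Y (Suc k + m) \<omega>) s'))"
      using r by (subst position_Suc) auto
  qed
  then show ?thesis
    unfolding waiting_flow_def by (simp add: nat_state_swap nn_integral_multc)
qed

lemma packet_transition:
  assumes [measurable]: "Measurable.pred M R" and "\<And>\<omega>. Y k \<omega> = s \<Longrightarrow> Y (Suc k) \<omega> = s' \<Longrightarrow> R \<omega> = (packet k \<omega> \<and> C)"
  shows "emeasure M {\<omega> \<in> space M. R \<omega> \<and> Y k \<omega> = s \<and> Y (Suc k) \<omega> = s'}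
    = emeasure M {\<omega> \<in> space M. Y k \<omega> = s \<and> Y (Suc k) \<omega> = s' \<and> J.elapsed (Suc k) \<omega> \<le> 1} * of_bool (arrives s s' \<and> C)"
proof (cases "arrives s s' \<and> C")
  case True
  then have "{\<omega> \<in> space M. R \<omega> \<and> Y k \<omega> = s \<and> Y (Suc k) \<omega> = s'} = {\<omega> \<in> space M. Y k \<omega> = s \<and> Y (Suc k) \<omega> = s' \<and> J.elapsed (Suc k) \<omega> \<le> 1}"
    using assms(2) by (auto simp: packet_def arrival_at_def arrives_def)
  then show ?thesis using True by simp
next
  case False
  then have empty: "{\<omega> \<in> space M. R \<omega> \<and> Y k \<omega> = s \<and> Y (Suc k) \<omega> = s'} = {}"
    using assms(2) by (auto simp: packet_def arrival_at_def arrives_def)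
  show ?thesis unfolding empty using False by simp
qed

lemma nat_sum_transitions:
  assumes "s \<in> S"
  shows "nat_sum (\<lambda>k. emeasure M {\<omega> \<in> space M. Y k \<omega> = s \<and> Y (Suc k) \<omega> = s' \<and> J.elapsed (Suc k) \<omega> \<le> 1}) = flow s * Pr s s'"
  unfolding nn_integral_count_space_nat J.suminf_transitions[OF assms zero_le_one] flow_Pr
  by (simp add: ennreal_mult q_nonneg)

lemma waiting_flow_0:
  "waiting_flow 0 r s' = state_sum (\<lambda>s. flow s * Pr s s' * of_bool (arrives s s' \<and> fst s' v = r))"
proof -
  have "emeasure M {\<omega> \<in> space M. (packet k \<omega> \<and> pos k (Suc k + 0) \<omega> = r) \<and> Y (Suc k + 0) \<omega> = s'}
    = state_sum (\<lambda>s. emeasure M {\<omega> \<in> space M. Y k \<omega> = s \<and> Y (Suc k) \<omega> = s' \<and> J.elapsed (Suc k) \<omega> \<le> 1} * of_bool (arrives s s' \<and> fst s' v = r))" for k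
  proof -
    have "emeasure M {\<omega> \<in> space M. (packet k \<omega> \<and> pos k (Suc k + 0) \<omega> = r) \<and> Y (Suc k + 0) \<omega> = s'}
      = state_sum (\<lambda>s. emeasure M {\<omega> \<in> space M. ((packet k \<omega> \<and> pos k (Suc k + 0) \<omega> = r) \<and> Y (Suc k + 0) \<omega> = s') \<and> Y k \<omega> = s})"
      by (rule emeasure_split_state) measurable
    also have "\<dots> = state_sum (\<lambda>s. emeasure M {\<omega> \<in> space M. (packet k \<omega> \<and> pos k (Suc k + 0) \<omega> = r) \<and> Y k \<omega> = s \<and> Y (Suc k) \<omega> = s'})"
      by (intro nn_integral_cong arg_cong[where f="emeasure M"]) auto
    also have "\<dots> = state_sum (\<lambda>s. emeasure M {\<omega> \<in> space M. Y k \<omega> = s \<and> Y (Suc k) \<omega> = s' \<and> J.elapsed (Suc k) \<omega> \<le> 1} * of_bool (arrives s s' \<and> fst s' v = r))"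
    proof (intro nn_integral_cong packet_transition)
      show "Measurable.pred M (\<lambda>\<omega>. packet k \<omega> \<and> pos k (Suc k + 0) \<omega> = r)"
        by (intro pred_intros_logic packet_measurable pos_measurable)
    qed simp
    finally show ?thesis .
  qed
  then have "waiting_flow 0 r s' = state_sum (\<lambda>s. nat_sum (\<lambda>k. emeasure M {\<omega> \<in> space M. Y k \<omega> = s \<and> Y (Suc k) \<omega> = s' \<and> J.elapsed (Suc k) \<omega> \<le> 1} * of_bool (arrives s s' \<and> fst s' v = r)))"
    unfolding waiting_flow_def by (simp add: nat_state_swap)
  also have "\<dots> = state_sum (\<lambda>s. flow s * Pr s s' * of_bool (arrives s s' \<and> fst s' v = r))"
    by (intro nn_integral_cong) (simp add: nn_integral_multc nat_sum_transitions)
  finally show ?thesis .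
qed

text \<open>The pointwise identity \<open>position_balance\<close>, summed against the stationary
  flow, shows that its restriction to at least \<open>r\<close> queued packets solves the same
  equations, with the same source, as the waiting flow.\<close>

lemma flow_balance_position:
  assumes r: "1 \<le> r"
  shows "state_sum (\<lambda>s. flow s * Pr s s' * of_bool (arrives s s' \<and> fst s' v = r))
     + state_sum (\<lambda>s. flow s * of_bool (r + of_bool (starts s s') \<le> fst s v) * Pr s s') = flow s' * of_bool (r \<le> fst s' v)"
proof -
  have "state_sum (\<lambda>s. flow s * Pr s s' * of_bool (arrives s s' \<and> fst s' v = r))
     + state_sum (\<lambda>s. flow s * of_bool (r + of_bool (starts s s') \<le> fst s v) * Pr s s')
    = state_sum (\<lambda>s. flow s * Pr s s' * (of_bool (arrives s s' \<and> fst s' v = r) + of_bool (r + of_bool (starts s s') \<le> fst s v)))"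
    by (subst nn_integral_add[symmetric]) (auto simp: distrib_left mult_ac intro!: nn_integral_cong)
  also have "\<dots> = state_sum (\<lambda>s. flow s * Pr s s' * of_bool (r \<le> fst s' v))"
  proof (intro nn_integral_cong)
    fix s
    show "flow s * Pr s s' * (of_bool (arrives s s' \<and> fst s' v = r) + of_bool (r + of_bool (starts s s') \<le> fst s v)) = flow s * Pr s s' * of_bool (r \<le> fst s' v)"
      by (cases "q s s' = 0") (simp_all only: position_balance[OF _ r] div_0 ennreal_0 mult_zero_right mult_zero_left not_False_eq_True)
  qed
  also have "\<dots> = flow s' * of_bool (r \<le> fst s' v)"
    by (simp add: nn_integral_multc J.flow_balance)
  finally show ?thesis .
qed

text \<open>Minimality of the iterated solution: partial sums over ages start at zero and, by
  induction through the balance equation, never pass the other solution.\<close>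

lemma sum_waiting_flow_le:
  assumes "1 \<le> r"
  shows "(\<Sum>m<N. waiting_flow m r s) \<le> flow s * of_bool (r \<le> fst s v)"
  using assms
proof (induction N arbitrary: r s)
  case (Suc N)
  have "(\<Sum>m<Suc N. waiting_flow m r s) = waiting_flow 0 r s + state_sum (\<lambda>t. (\<Sum>m<N. waiting_flow m (r + of_bool (starts t s)) t) * Pr t s)"
    unfolding sum.lessThan_Suc_shift waiting_flow_Suc[OF Suc.prems] sum_distrib_right
    by (subst nn_integral_sum) auto
  also have "\<dots> \<le> waiting_flow 0 r s + state_sum (\<lambda>t. flow t * of_bool (r + of_bool (starts t s) \<le> fst t v) * Pr t s)"
    using Suc.prems by (intro add_left_mono nn_integral_mono mult_right_mono Suc.IH) auto
  also have "\<dots> = flow s * of_bool (r \<le> fst s v)"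
    unfolding waiting_flow_0 by (rule flow_balance_position[OF Suc.prems])
  finally show ?case .
qed simp

definition total_waiting_flow :: "nat \<Rightarrow> 'c state \<Rightarrow> ennreal" where
  "total_waiting_flow r s = nat_sum (\<lambda>m. waiting_flow m r s)"

lemma total_waiting_flow_le: "1 \<le> r \<Longrightarrow> total_waiting_flow r s \<le> flow s * of_bool (r \<le> fst s v)"
  unfolding total_waiting_flow_def by (intro nat_sum_le sum_waiting_flow_le)

definition defect :: "nat \<Rightarrow> 'c state \<Rightarrow> ennreal" where
  "defect r s = flow s * of_bool (r \<le> fst s v) - total_waiting_flow r s"

lemma defect_plus: "1 \<le> r \<Longrightarrow> total_waiting_flow r s + defect r s = flow s * of_bool (r \<le> fst s v)"
  unfolding defect_def using total_waiting_flow_le by (simp add: ennreal_add_diff_cancel_right add_diff_inverse_ennreal)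

lemma defect_le: "defect r s \<le> flow s * of_bool (r \<le> fst s v)"
  unfolding defect_def by (rule diff_le_self_ennreal)

lemma total_waiting_flow_eq:
  assumes r: "1 \<le> r"
  shows "total_waiting_flow r s' = waiting_flow 0 r s' + state_sum (\<lambda>s. total_waiting_flow (r + of_bool (starts s s')) s * Pr s s')"
proof -
  have "total_waiting_flow r s' = waiting_flow 0 r s' + nat_sum (\<lambda>m. waiting_flow (Suc m) r s')"
    unfolding total_waiting_flow_def by (rule nat_sum_split)
  also have "nat_sum (\<lambda>m. waiting_flow (Suc m) r s') = state_sum (\<lambda>s. total_waiting_flow (r + of_bool (starts s s')) s * Pr s s')"
    unfolding waiting_flow_Suc[OF r] total_waiting_flow_def by (simp add: nat_state_swap nn_integral_multc)
  finally show ?thesis .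
qed

lemma defect_eq:
  assumes r: "1 \<le> r"
  shows "defect r s' = state_sum (\<lambda>s. defect (r + of_bool (starts s s')) s * Pr s s')"
proof -
  let ?W = "state_sum (\<lambda>s. total_waiting_flow (r + of_bool (starts s s')) s * Pr s s')"
  let ?D = "state_sum (\<lambda>s. defect (r + of_bool (starts s s')) s * Pr s s')"
  have fin: "total_waiting_flow r s' < \<top>"
    using total_waiting_flow_le[OF r, of s'] by (rule le_less_trans) (simp add: ennreal_mult_less_top of_bool_def)
  have "total_waiting_flow r s' + defect r s' = flow s' * of_bool (r \<le> fst s' v)"
    by (rule defect_plus[OF r])
  also have "\<dots> = waiting_flow 0 r s' + state_sum (\<lambda>s. flow s * of_bool (r + of_bool (starts s s') \<le> fst s v) * Pr s s')"
    unfolding waiting_flow_0 by (rule flow_balance_position[OF r, symmetric])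
  also have "state_sum (\<lambda>s. flow s * of_bool (r + of_bool (starts s s') \<le> fst s v) * Pr s s') = ?W + ?D"
    using r by (subst nn_integral_add[symmetric]) (auto simp: distrib_right[symmetric] defect_plus intro!: nn_integral_cong)
  also have "waiting_flow 0 r s' + (?W + ?D) = total_waiting_flow r s' + ?D"
    unfolding total_waiting_flow_eq[OF r] by (simp add: add.assoc)
  finally show ?thesis using fin by (auto simp: ennreal_add_left_cancel)
qed

lemma queue_flow_finite: "state_sum (\<lambda>s. flow s * of_nat (fst s v)) < \<top>"
proof -
  have "state_sum (\<lambda>s. flow s * of_nat (fst s v)) \<le> state_sum (\<lambda>s. ennreal total_rate * (ennreal (pmf \<pi> s) * of_nat (fst s v)))"
  proof (intro nn_integral_mono)
    fix s
    have "flow s \<le> ennreal total_rate * ennreal (pmf \<pi> s)"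
      using exit_rate_le[of s] L_pos by (simp add: ennreal_mult[symmetric] mult.commute mult_left_mono)
    then show "flow s * of_nat (fst s v) \<le> ennreal total_rate * (ennreal (pmf \<pi> s) * of_nat (fst s v))"
      by (simp add: mult.assoc[symmetric] mult_right_mono)
  qed
  also have "\<dots> = ennreal total_rate * mean_queue v"
    by (simp add: nn_integral_cmult state_sum_pmf mean_queue_eq ennreal_of_nat_eq_real_of_nat)
  also have "\<dots> < \<top>" using mean_queue_finite[OF v] by (simp add: ennreal_mult_less_top)
  finally show ?thesis .
qed

text \<open>Summed over places and states, the homogeneous equations reproduce the total defect
  except for the part in first place that is started. The total is finite because the mean queue is,
  so nothing can be lost: the defect in first place vanishes wherever a start at \<open>v\<close> is
  possible.\<close>

lemma defect_start_eq_0: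
  assumes s: "s \<in> S" "s' \<in> S" "starts s s'" "0 < q s s'"
  shows "defect 1 s = 0"
proof -
  let ?col = "\<lambda>s. nat_sum (\<lambda>r. defect (Suc r) s)"
  have T: "state_sum ?col < \<top>"
  proof -
    have "?col s \<le> flow s * of_nat (fst s v)" for s
    proof -
      have "?col s \<le> nat_sum (\<lambda>r. flow s * of_bool (Suc r \<le> fst s v))"
        by (intro nn_integral_mono defect_le)
      also have "\<dots> = flow s * of_nat (fst s v)"
        by (subst nn_integral_cmult) (simp_all add: nat_sum_of_bool_less del: Suc_le_eq)
      finally show ?thesis .
    qed
    then have "state_sum ?col \<le> state_sum (\<lambda>s. flow s * of_nat (fst s v))"
      by (intro nn_integral_mono)
    then show ?thesis using queue_flow_finite by (rule le_less_trans)
  qed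
  \<comment> \<open>A start shifts places by one, so the shifted sum over \<open>r\<close> misses
    exactly the term of place \<open>1\<close>.\<close>
  have inner: "nat_sum (\<lambda>r. defect (Suc r + of_bool (starts s s')) s) + of_bool (starts s s') * defect 1 s = ?col s" for s s'
    using nat_sum_split[of "\<lambda>r. defect (Suc r) s"] by (cases "starts s s'") (simp_all add: add.commute)
  let ?e = "state_sum (\<lambda>s'. state_sum (\<lambda>s. of_bool (starts s s') * defect 1 s * Pr s s'))"
  have "state_sum ?col = state_sum (\<lambda>s'. state_sum (\<lambda>s. nat_sum (\<lambda>r. defect (Suc r + of_bool (starts s s')) s) * Pr s s'))"
  proof (intro nn_integral_cong)
    fix s'
    have "?col s' = nat_sum (\<lambda>r. state_sum (\<lambda>s. defect (Suc r + of_bool (starts s s')) s * Pr s s'))"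
      by (subst defect_eq) simp_all
    then show "?col s' = state_sum (\<lambda>s. nat_sum (\<lambda>r. defect (Suc r + of_bool (starts s s')) s) * Pr s s')"
      by (simp add: nat_state_swap nn_integral_multc)
  qed
  then have "state_sum ?col + ?e = state_sum (\<lambda>s'. state_sum (\<lambda>s. nat_sum (\<lambda>r. defect (Suc r + of_bool (starts s s')) s) * Pr s s'))
     + ?e" by simp
  also have "\<dots> = state_sum (\<lambda>s'. state_sum (\<lambda>s. ?col s * Pr s s'))"
    by (subst nn_integral_add[symmetric], simp, simp, intro nn_integral_cong, subst nn_integral_add[symmetric], simp, simp)
       (intro nn_integral_cong, simp only: inner distrib_right[symmetric])
  also have "\<dots> = state_sum (\<lambda>s. state_sum (\<lambda>s'. ?col s * Pr s s'))"
    by (rule state_sum_swap)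
  also have "\<dots> = state_sum ?col"
    by (intro nn_integral_cong) (simp add: nn_integral_cmult J.sum_P)
  finally have "state_sum ?col = \<top> \<or> ?e = 0"
    using ennreal_add_left_cancel[of "state_sum ?col" ?e 0] by simp
  then have "?e = 0" using T by (metis less_irrefl)
  then have "\<forall>s'\<in>S. \<forall>s\<in>S. of_bool (starts s s') * defect 1 s * Pr s s' = 0"
    by (simp add: nn_integral_0_iff_AE AE_count_space)
  then have "of_bool (starts s s') * defect 1 s * Pr s s' = 0" using s by blast
  moreover have "Pr s s' \<noteq> 0" using s exit_rate_pos[of s] by (simp add: ennreal_eq_0_iff not_le)
  ultimately show ?thesis using s by simp
qed

text \<open>All terms of a vanishing sum vanish, so absence of defect passes from a state to its
  predecessors, one place further back when the transition is a start.\<close>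

lemma defect_successor:
  assumes "1 \<le> r" "s \<in> S" "s' \<in> S" "0 < q s s'" "defect r s' = 0"
  shows "defect (r + of_bool (starts s s')) s = 0"
proof -
  have "\<forall>s\<in>S. defect (r + of_bool (starts s s')) s * Pr s s' = 0"
    using assms(5) unfolding defect_eq[OF assms(1)] by (simp add: nn_integral_0_iff_AE AE_count_space)
  then have "defect (r + of_bool (starts s s')) s * Pr s s' = 0" using assms(2) by blast
  moreover have "Pr s s' \<noteq> 0" using assms(4) exit_rate_pos[of s] by (simp add: ennreal_eq_0_iff not_le)
  ultimately show ?thesis by simp
qed

text \<open>Induction on the place. An idle state with \<open>v\<close> nonempty can start at
  \<open>v\<close>, which moves the packet one place forward into a case already settled; an active
  state can complete into an idle one; with \<open>v\<close> empty there is no flow to miss.\<close>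

lemma defect_eq_0:
  assumes "1 \<le> r" "s \<in> S"
  shows "defect r s = 0"
proof -
  have start_in: "(x(v := x v - 1), Some (fst v)) \<in> S" if "(x, None) \<in> S" for x
    using that v by (auto simp: network_states_def)
  have idle_all: "defect r s = 0" if idle: "\<And>x. (x, None) \<in> S \<Longrightarrow> defect r (x, None) = 0" and "s \<in> S" "1 \<le> r" for r s
  proof -
    obtain x a where s: "s = (x, a)" by fastforce
    show ?thesis
    proof (cases a)
      case None
      then show ?thesis using idle that s by simp
    next
      case (Some d)
      have "(x, None) \<in> S" using that(2) by (simp add: s network_states_def)
      moreover from this have "defect r (x, None) = 0" by (rule idle)
      ultimately show ?thesis
        using defect_successor[of r s "(x, None)"] that rate_completion[of x d] by (simp add: s Some starts_def)
    qed
  qed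
  have empty: "defect r (x, None) = 0" if "x v < r" for r x
    using defect_le[of r "(x, None)"] that by simp
  show ?thesis using assms
  proof (induction r arbitrary: s rule: dec_induct)
    case base
    have "defect 1 (x, None) = 0" if "(x, None) \<in> S" for x
    proof (cases "0 < x v")
      case True
      show ?thesis
        by (rule defect_start_eq_0[OF that start_in[OF that] _ rate_start[of v x, OF v True]]) (use True in \<open>simp add: starts_def\<close>)
    qed (simp add: empty)
    then show ?case using idle_all base by simp
  next
    case (step r)
    have "defect (Suc r) (x, None) = 0" if x: "(x, None) \<in> S" for x
    proof (cases "0 < x v")
      case True
      have "starts (x, None) (x(v := x v - 1), Some (fst v))" using True by (simp add: starts_def)
      then show ?thesis
        using defect_successor[OF step(1) x start_in[OF x] rate_start[of v x, OF v True]] step.IH[OF start_in[OF x]] by simp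
    qed (simp add: empty)
    then show ?case using idle_all step by simp
  qed
qed

lemma total_waiting_flow:
  assumes "s \<in> S"
  shows "total_waiting_flow (Suc r) s = flow s * of_bool (Suc r \<le> fst s v)"
  using defect_plus[of "Suc r" s] defect_eq_0[of "Suc r" s] assms by simp

lemma emeasure_pos_split:
  "emeasure M {\<omega> \<in> space M. (packet k \<omega> \<and> 0 < pos k (Suc k + m) \<omega>) \<and> Y (Suc k + m) \<omega> = s}
    = nat_sum (\<lambda>r. emeasure M {\<omega> \<in> space M. (packet k \<omega> \<and> pos k (Suc k + m) \<omega> = Suc r) \<and> Y (Suc k + m) \<omega> = s})"
proof -
  have eq: "{\<omega> \<in> space M. (packet k \<omega> \<and> 0 < pos k (Suc k + m) \<omega>) \<and> Y (Suc k + m) \<omega> = s}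
    = (\<Union>r. {\<omega> \<in> space M. (packet k \<omega> \<and> pos k (Suc k + m) \<omega> = Suc r) \<and> Y (Suc k + m) \<omega> = s})"
    by (auto simp: gr0_conv_Suc)
  have sets: "{\<omega> \<in> space M. (packet k \<omega> \<and> pos k (Suc k + m) \<omega> = Suc r) \<and> Y (Suc k + m) \<omega> = s} \<in> sets M" for r
    by measurable
  show ?thesis
    unfolding eq by (rule emeasure_UN_countable[OF sets]) (auto simp: disjoint_family_on_def)
qed

text \<open>The weight \<open>c\<close> is kept general: \<open>1 / exit_rate q s\<close> yields
  waiting time, the constant one yields the number of steps, which is used for almost sure
  termination.\<close>

lemma waiting_total:
  "nat_sum (\<lambda>k. nat_sum (\<lambda>m. state_sum (\<lambda>s. emeasure M {\<omega> \<in> space M. (packet k \<omega> \<and> 0 < pos k (Suc k + m) \<omega>) \<and> Y (Suc k + m) \<omega> = s} * c s)))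
    = state_sum (\<lambda>s. flow s * of_nat (fst s v) * c s)"
proof -
  let ?e = "\<lambda>k m s r. emeasure M {\<omega> \<in> space M. (packet k \<omega> \<and> pos k (Suc k + m) \<omega> = Suc r) \<and> Y (Suc k + m) \<omega> = s}"
  have "nat_sum (\<lambda>k. nat_sum (\<lambda>m. state_sum (\<lambda>s. nat_sum (\<lambda>r. ?e k m s r) * c s)))
     = nat_sum (\<lambda>m. nat_sum (\<lambda>k. state_sum (\<lambda>s. nat_sum (\<lambda>r. ?e k m s r) * c s)))"
    by (rule nat_nat_swap)
  also have "\<dots> = state_sum (\<lambda>s. nat_sum (\<lambda>m. nat_sum (\<lambda>k. nat_sum (\<lambda>r. ?e k m s r))) * c s)"
    by (simp add: nat_state_swap nn_integral_multc)
  also have "\<dots> = state_sum (\<lambda>s. flow s * of_nat (fst s v) * c s)"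
  proof (intro nn_integral_cong arg_cong2[where f="(*)"] refl)
    fix s assume "s \<in> space (count_space S)"
    then have s: "s \<in> S" by simp
    have "nat_sum (\<lambda>m. nat_sum (\<lambda>k. nat_sum (\<lambda>r. ?e k m s r))) = nat_sum (\<lambda>m. nat_sum (\<lambda>r. waiting_flow m (Suc r) s))"
      unfolding waiting_flow_def by (intro nn_integral_cong nat_nat_swap)
    also have "\<dots> = nat_sum (\<lambda>r. total_waiting_flow (Suc r) s)"
      unfolding total_waiting_flow_def by (rule nat_nat_swap)
    also have "\<dots> = flow s * of_nat (fst s v)"
      by (simp add: total_waiting_flow[OF s] nn_integral_cmult nat_sum_of_bool_less del: Suc_le_eq)
    finally show "nat_sum (\<lambda>m. nat_sum (\<lambda>k. nat_sum (\<lambda>r. ?e k m s r))) = \<dots>" .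
  qed
  finally show ?thesis unfolding emeasure_pos_split .
qed

end

section \<open>Transmissions, and Little's law for waiting and sojourn times\<close>

context packet_process
begin

lemma sending_flow_0: "sending_flow 0 s = 0"
  by (simp add: sending_flow_def transmitting_first)

text \<open>A transmitting packet was either started by the last jump from first place, or already
  transmitting and not completed by it. An upper bound is enough, so the two cases are joined by
  subadditivity.\<close>

lemma sending_flow_Suc_le:
  "sending_flow (Suc m) s' \<le> state_sum (\<lambda>s. (waiting_flow m 1 s * of_bool (starts s s') + sending_flow m s * of_bool (\<not> completes s s')) * Pr s s')"
proof -
  let ?w = "\<lambda>k s. emeasure M {\<omega> \<in> space M. (packet k \<omega> \<and> pos k (Suc k + m) \<omega> = 1) \<and> Y (Suc k + m) \<omega> = s}"
  let ?x = "\<lambda>k s. emeasure M {\<omega> \<in> space M. (packet k \<omega> \<and> sending k (Suc k + m) \<omega>) \<and> Y (Suc k + m) \<omega> = s}"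
  have "emeasure M {\<omega> \<in> space M. (packet k \<omega> \<and> sending k (Suc k + Suc m) \<omega>) \<and> Y (Suc k + Suc m) \<omega> = s'}
    \<le> state_sum (\<lambda>s. (?w k s * of_bool (starts s s') + ?x k s * of_bool (\<not> completes s s')) * Pr s s')" for k
  proof -
    let ?i = "Suc k + m"
    let ?Q = "\<lambda>s \<omega>. packet k \<omega> \<and> (pos k ?i \<omega> = 1 \<and> starts s s' \<or> sending k ?i \<omega> \<and> \<not> completes s s')"
    have "emeasure M {\<omega> \<in> space M. (packet k \<omega> \<and> sending k (Suc ?i) \<omega>) \<and> Y (Suc ?i) \<omega> = s'}
      = state_sum (\<lambda>s. emeasure M {\<omega> \<in> space M. ?Q s \<omega> \<and> Y ?i \<omega> = s} * Pr s s')"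
    proof (rule emeasure_transition_split)
      show "Measurable.pred M (\<lambda>\<omega>. packet k \<omega> \<and> sending k (Suc ?i) \<omega>)"
        by (intro pred_intros_logic packet_measurable trans_measurable)
      show "Measurable.pred (J.history ?i) (?Q s)" for s
      proof -
        have k: "k < ?i" by simp
        show ?thesis
          by (intro pred_intros_logic packet_history[OF k] pos_history[OF k, where R="\<lambda>r. r = 1"] trans_history) simp_all
      qed
      fix \<omega> assume y: "Y (Suc ?i) \<omega> = s'"
      have "packet k \<omega> \<Longrightarrow> packet_start v (\<lambda>l. Y l \<omega>) k ?i \<longleftrightarrow> pos k ?i \<omega> = 1 \<and> starts (Y ?i \<omega>) s'"
        using y by (subst packet_start_iff) (auto simp: packet_def start_at_def starts_def)
      moreover have "completion (\<lambda>l. Y l \<omega>) ?i \<longleftrightarrow> completes (Y ?i \<omega>) s'"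
        using y by (simp add: completion_def completes_def)
      ultimately show "(packet k \<omega> \<and> sending k (Suc ?i) \<omega>) = ?Q (Y ?i \<omega>) \<omega>"
        unfolding transmitting_Suc by blast
    qed
    also have "\<dots> \<le> state_sum (\<lambda>s. (?w k s * of_bool (starts s s') + ?x k s * of_bool (\<not> completes s s')) * Pr s s')"
    proof (intro nn_integral_mono mult_right_mono)
      fix s
      have sets: "{\<omega> \<in> space M. (packet k \<omega> \<and> pos k ?i \<omega> = 1) \<and> Y ?i \<omega> = s \<and> starts s s'} \<in> sets M"
        "{\<omega> \<in> space M. (packet k \<omega> \<and> sending k ?i \<omega>) \<and> Y ?i \<omega> = s \<and> \<not> completes s s'} \<in> sets M"
        by measurable
      have "{\<omega> \<in> space M. ?Q s \<omega> \<and> Y ?i \<omega> = s} = {\<omega> \<in> space M. (packet k \<omega> \<and> pos k ?i \<omega> = 1) \<and> Y ?i \<omega> = s \<and> starts s s'}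
        \<union> {\<omega> \<in> space M. (packet k \<omega> \<and> sending k ?i \<omega>) \<and> Y ?i \<omega> = s \<and> \<not> completes s s'}" by blast
      then have "emeasure M {\<omega> \<in> space M. ?Q s \<omega> \<and> Y ?i \<omega> = s}
        \<le> emeasure M {\<omega> \<in> space M. (packet k \<omega> \<and> pos k ?i \<omega> = 1) \<and> Y ?i \<omega> = s \<and> starts s s'}
        + emeasure M {\<omega> \<in> space M. (packet k \<omega> \<and> sending k ?i \<omega>) \<and> Y ?i \<omega> = s \<and> \<not> completes s s'}"
        using emeasure_subadditive[OF sets] by simp
      also have "\<dots> = ?w k s * of_bool (starts s s') + ?x k s * of_bool (\<not> completes s s')"
        by (cases "starts s s'"; cases "completes s s'") simp_all
      finally show "emeasure M {\<omega> \<in> space M. ?Q s \<omega> \<and> Y ?i \<omega> = s} \<le> \<dots>" .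
    qed simp
    finally show ?thesis by simp
  qed
  then have "sending_flow (Suc m) s' \<le> nat_sum (\<lambda>k. state_sum (\<lambda>s. (?w k s * of_bool (starts s s') + ?x k s * of_bool (\<not> completes s s')) * Pr s s'))"
    unfolding sending_flow_def by (intro nn_integral_mono)
  also have "\<dots> = state_sum (\<lambda>s. (waiting_flow m 1 s * of_bool (starts s s') + sending_flow m s * of_bool (\<not> completes s s')) * Pr s s')"
    unfolding nat_state_swap waiting_flow_def sending_flow_def
    by (intro nn_integral_cong) (simp add: nn_integral_multc nn_integral_add)
  finally show ?thesis .
qed

lemma sending_flow_class:
  assumes "snd s \<noteq> Some (fst v)"
  shows "sending_flow m s = 0"
proof -
  have "emeasure M {\<omega> \<in> space M. (packet k \<omega> \<and> sending k (Suc k + m) \<omega>) \<and> Y (Suc k + m) \<omega> = s} = 0" for k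
  proof (rule emeasure_eq_0_AE)
    show "AE \<omega> in M. \<not> ((packet k \<omega> \<and> sending k (Suc k + m) \<omega>) \<and> Y (Suc k + m) \<omega> = s)"
      using AE_transmitting_class by eventually_elim (use assms in blast)
  qed
  then show ?thesis by (simp add: sending_flow_def)
qed

lemma Pr_eq: "Pr s s' = ennreal (1 / exit_rate q s) * ennreal (q s s')"
  by (simp add: ennreal_mult[symmetric] q_nonneg)

text \<open>Packets leave first place at the throughput of the node, which equals its arrival rate
  by \<open>expectation_nonempty_idle\<close>.\<close>

lemma start_inflow:
  "state_sum (\<lambda>s. flow s * of_bool (1 \<le> fst s v) * state_sum (\<lambda>s'. of_bool (starts s s') * Pr s s')) = ennreal (arr v)"
proof -
  have "state_sum (\<lambda>s. flow s * of_bool (1 \<le> fst s v) * state_sum (\<lambda>s'. of_bool (starts s s') * Pr s s'))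
    = state_sum (\<lambda>s. ennreal (pmf \<pi> s) * (ennreal (bk v) * of_bool (0 < fst s v \<and> snd s = None)))"
  proof (intro nn_integral_cong)
    fix s assume "s \<in> space (count_space S)"
    then have s: "s \<in> S" by simp
    have "flow s * state_sum (\<lambda>s'. of_bool (starts s s') * Pr s s') = state_sum (\<lambda>s'. ennreal (pmf \<pi> s) * (ennreal (q s s') * of_bool (starts s s')))"
    proof (subst nn_integral_cmult[symmetric], simp, intro nn_integral_cong)
      fix s'
      have "flow s * (of_bool (starts s s') * Pr s s') = (flow s * Pr s s') * of_bool (starts s s')"
        by (simp only: mult_ac)
      then show "flow s * (of_bool (starts s s') * Pr s s') = ennreal (pmf \<pi> s) * (ennreal (q s s') * of_bool (starts s s'))"
        unfolding flow_Pr by (simp only: mult_ac)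
    qed
    also have "\<dots> = ennreal (pmf \<pi> s) * (ennreal (bk v) * of_bool (0 < fst s v \<and> snd s = None))"
      by (subst nn_integral_cmult) (simp_all add: rate_starts[OF s])
    finally show "flow s * of_bool (1 \<le> fst s v) * state_sum (\<lambda>s'. of_bool (starts s s') * Pr s s')
      = ennreal (pmf \<pi> s) * (ennreal (bk v) * of_bool (0 < fst s v \<and> snd s = None))"
      by (cases "fst s v = 0") auto
  qed
  also have "\<dots> = (\<integral>\<^sup>+s. ennreal (bk v * of_bool (0 < fst s v \<and> snd s = None)) \<partial>measure_pmf \<pi>)"
    unfolding state_sum_pmf by (intro nn_integral_cong) simp
  also have "\<dots> = ennreal (E (\<lambda>s. bk v * of_bool (0 < fst s v \<and> snd s = None)))"
    by (intro nn_integral_eq_integral) (auto simp: rates_ge_0)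
  also have "E (\<lambda>s. bk v * of_bool (0 < fst s v \<and> snd s = None)) = arr v"
    using expectation_nonempty_idle[OF v] nu_pos[of "fst v"] by (simp add: arr_def bk_def)
  finally show ?thesis .
qed

lemma completes_prob:
  assumes "s \<in> S" "snd s = Some (fst v)"
  shows "state_sum (\<lambda>s'. of_bool (\<not> completes s s') * Pr s s') + ennreal (mu (fst v) / exit_rate q s) = 1"
proof -
  have "state_sum (\<lambda>s'. of_bool (completes s s') * Pr s s') = state_sum (\<lambda>s'. ennreal (1 / exit_rate q s) * (ennreal (q s s') * of_bool (completes s s')))"
    by (intro nn_integral_cong) (simp only: Pr_eq mult_ac)
  also have "\<dots> = ennreal (1 / exit_rate q s) * ennreal (mu (fst v))"
    by (subst nn_integral_cmult) (simp_all add: rate_completes[OF assms])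
  also have "\<dots> = ennreal (mu (fst v) / exit_rate q s)"
    by (simp add: ennreal_mult[symmetric] rates_ge_0)
  finally have "ennreal (mu (fst v) / exit_rate q s) = state_sum (\<lambda>s'. of_bool (completes s s') * Pr s s')" by simp
  then have "state_sum (\<lambda>s'. of_bool (\<not> completes s s') * Pr s s') + ennreal (mu (fst v) / exit_rate q s)
    = state_sum (\<lambda>s'. of_bool (\<not> completes s s') * Pr s s' + of_bool (completes s s') * Pr s s')"
    by (simp add: nn_integral_add)
  also have "\<dots> = state_sum (\<lambda>s'. Pr s s')"
    by (intro nn_integral_cong) (simp add: of_bool_def)
  finally show ?thesis by (simp add: J.sum_P[OF assms(1)])
qed

text \<open>Mass balance of transmitting packets: \<open>A\<close> is the flow that stays,
  \<open>B\<close> the flow that completes. The inflow is at most \<open>arr v\<close> and the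
  totals increase with \<open>N\<close>, so \<open>B\<close> is at most \<open>arr v\<close>; as
  completions occur at rate \<open>mu (fst v)\<close>, this bounds the time.\<close>

lemma sum_sending_flow_le:
  "state_sum (\<lambda>s. (\<Sum>m<N. sending_flow m s) * ennreal (1 / exit_rate q s)) \<le> ennreal (arr v / mu (fst v))"
proof -
  define \<tau> where "\<tau> N s = (\<Sum>m<N. sending_flow m s)" for N s
  define A where "A N = state_sum (\<lambda>s. \<tau> N s * state_sum (\<lambda>s'. of_bool (\<not> completes s s') * Pr s s'))" for N
  define B where "B N = state_sum (\<lambda>s. \<tau> N s * ennreal (mu (fst v) / exit_rate q s))" for N
  have AB: "A N + B N = state_sum (\<tau> N)" for N
  proof -
    have "A N + B N = state_sum (\<lambda>s. \<tau> N s * (state_sum (\<lambda>s'. of_bool (\<not> completes s s') * Pr s s') + ennreal (mu (fst v) / exit_rate q s)))"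
      unfolding A_def B_def by (subst nn_integral_add[symmetric]) (simp_all add: distrib_left)
    also have "\<dots> = state_sum (\<tau> N)"
    proof (intro nn_integral_cong)
      fix s assume "s \<in> space (count_space S)"
      then have s: "s \<in> S" by simp
      show "\<tau> N s * (state_sum (\<lambda>s'. of_bool (\<not> completes s s') * Pr s s') + ennreal (mu (fst v) / exit_rate q s)) = \<tau> N s"
      proof (cases "snd s = Some (fst v)")
        case True
        then show ?thesis using completes_prob[OF s] by simp
      qed (simp add: \<tau>_def sending_flow_class)
    qed
    finally show ?thesis .
  qed
  have step: "state_sum (\<tau> (Suc N)) \<le> ennreal (arr v) + A N" for N
  proof -
    have "\<tau> (Suc N) s' \<le> state_sum (\<lambda>s. (flow s * of_bool (1 \<le> fst s v) * (of_bool (starts s s') * Pr s s')) + \<tau> N s * (of_bool (\<not> completes s s') * Pr s s'))" for s'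
    proof -
      have "\<tau> (Suc N) s' = (\<Sum>m<N. sending_flow (Suc m) s')"
        unfolding \<tau>_def sum.lessThan_Suc_shift by (simp add: sending_flow_0)
      also have "\<dots> \<le> (\<Sum>m<N. state_sum (\<lambda>s. (waiting_flow m 1 s * of_bool (starts s s') + sending_flow m s * of_bool (\<not> completes s s')) * Pr s s'))"
        by (intro sum_mono sending_flow_Suc_le)
      also have "\<dots> = state_sum (\<lambda>s. \<Sum>m<N. (waiting_flow m 1 s * of_bool (starts s s') + sending_flow m s * of_bool (\<not> completes s s')) * Pr s s')"
        by (subst nn_integral_sum) simp_all
      also have "\<dots> = state_sum (\<lambda>s. (\<Sum>m<N. waiting_flow m 1 s) * (of_bool (starts s s') * Pr s s') + \<tau> N s * (of_bool (\<not> completes s s') * Pr s s'))"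
        by (intro nn_integral_cong) (simp add: \<tau>_def sum.distrib sum_distrib_right distrib_right mult.assoc)
      also have "\<dots> \<le> state_sum (\<lambda>s. (flow s * of_bool (1 \<le> fst s v) * (of_bool (starts s s') * Pr s s')) + \<tau> N s * (of_bool (\<not> completes s s') * Pr s s'))"
        by (intro nn_integral_mono add_mono mult_right_mono sum_waiting_flow_le) simp_all
      finally show ?thesis .
    qed
    then have "state_sum (\<tau> (Suc N)) \<le> state_sum (\<lambda>s'. state_sum (\<lambda>s. (flow s * of_bool (1 \<le> fst s v) * (of_bool (starts s s') * Pr s s')) + \<tau> N s * (of_bool (\<not> completes s s') * Pr s s')))"
      by (intro nn_integral_mono)
    also have "\<dots> = state_sum (\<lambda>s. state_sum (\<lambda>s'. (flow s * of_bool (1 \<le> fst s v) * (of_bool (starts s s') * Pr s s')) + \<tau> N s * (of_bool (\<not> completes s s') * Pr s s')))"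
      by (rule state_sum_swap)
    also have "\<dots> = state_sum (\<lambda>s. flow s * of_bool (1 \<le> fst s v) * state_sum (\<lambda>s'. of_bool (starts s s') * Pr s s')
        + \<tau> N s * state_sum (\<lambda>s'. of_bool (\<not> completes s s') * Pr s s'))"
      by (intro nn_integral_cong, subst nn_integral_add) (simp_all add: nn_integral_cmult)
    also have "\<dots> = ennreal (arr v) + A N"
      unfolding A_def by (subst nn_integral_add) (simp_all only: start_inflow borel_measurable_count_space)
    finally show ?thesis .
  qed
  have fin: "state_sum (\<tau> N) < \<top>" for N
  proof (induction N)
    case (Suc N)
    have "state_sum (\<tau> (Suc N)) \<le> ennreal (arr v) + state_sum (\<tau> N)"
      using step[of N] AB[of N] by (metis add_left_mono le_iff_add order_trans)
    also have "\<dots> < \<top>" using Suc by (simp add: ennreal_add_eq_top less_top)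
    finally show ?case .
  qed (simp add: \<tau>_def)
  have "A N + B N \<le> A N + ennreal (arr v)" for N
  proof -
    have "state_sum (\<tau> N) \<le> state_sum (\<tau> (Suc N))"
      by (intro nn_integral_mono) (simp add: \<tau>_def)
    then show ?thesis using step[of N] AB[of N] by (simp add: add.commute)
  qed
  \<comment> \<open>Cancelling \<open>A N\<close> in \<open>ennreal\<close> requires finiteness,
    which follows inductively because each further age adds at most \<open>arr v\<close> to the
    total.\<close>
  moreover have "A N \<noteq> \<top>" for N
    using fin[of N] AB[of N] by (metis ennreal_add_eq_top less_irrefl)
  ultimately have B: "B N \<le> ennreal (arr v)" for N
    using ennreal_add_left_cancel_le[of "A N" "B N" "ennreal (arr v)"] by (simp add: top_unique)
  have "ennreal (1 / mu (fst v)) * B N = state_sum (\<lambda>s. \<tau> N s * ennreal (1 / exit_rate q s))"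
    unfolding B_def
  proof (subst nn_integral_cmult[symmetric], simp, intro nn_integral_cong)
    fix s
    have "ennreal (1 / mu (fst v)) * ennreal (mu (fst v) / exit_rate q s) = ennreal (1 / exit_rate q s)"
      using mu_pos[of "fst v"] by (simp add: ennreal_mult[symmetric])
    then show "ennreal (1 / mu (fst v)) * (\<tau> N s * ennreal (mu (fst v) / exit_rate q s)) = \<tau> N s * ennreal (1 / exit_rate q s)"
      by (simp add: mult.left_commute)
  qed
  then have "state_sum (\<lambda>s. \<tau> N s * ennreal (1 / exit_rate q s)) \<le> ennreal (1 / mu (fst v)) * ennreal (arr v)"
    using B[of N] by (metis mult_left_mono zero_le)
  also have "\<dots> = ennreal (arr v / mu (fst v))"
    by (simp add: ennreal_mult[symmetric] rates_ge_0)
  finally show ?thesis by (simp add: \<tau>_def)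
qed

lemma sending_total:
  "nat_sum (\<lambda>k. nat_sum (\<lambda>m. state_sum (\<lambda>s. emeasure M {\<omega> \<in> space M. (packet k \<omega> \<and> sending k (Suc k + m) \<omega>) \<and> Y (Suc k + m) \<omega> = s} * c s)))
    = nat_sum (\<lambda>m. state_sum (\<lambda>s. sending_flow m s * c s))"
  by (subst nat_nat_swap) (simp add: sending_flow_def nat_state_swap nn_integral_multc)

lemma sending_time_le: "nat_sum (\<lambda>m. state_sum (\<lambda>s. sending_flow m s * ennreal (1 / exit_rate q s))) \<le> ennreal (arr v / mu (fst v))"
proof (rule nat_sum_le)
  fix N
  have "(\<Sum>m<N. state_sum (\<lambda>s. sending_flow m s * ennreal (1 / exit_rate q s))) = state_sum (\<lambda>s. (\<Sum>m<N. sending_flow m s) * ennreal (1 / exit_rate q s))"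
    unfolding sum_distrib_right by (subst nn_integral_sum) simp_all
  then show "(\<Sum>m<N. state_sum (\<lambda>s. sending_flow m s * ennreal (1 / exit_rate q s))) \<le> ennreal (arr v / mu (fst v))"
    using sum_sending_flow_le[of N] by simp
qed

lemma sending_steps_finite: "nat_sum (\<lambda>m. state_sum (\<lambda>s. sending_flow m s * 1)) < \<top>"
proof -
  have "1 \<le> ennreal total_rate * ennreal (1 / exit_rate q s)" for s
    using exit_rate_pos[of s] exit_rate_le[of s] L_pos by (simp add: ennreal_mult[symmetric] ennreal_leI[of 1, simplified])
  then have "sending_flow m s * 1 \<le> ennreal total_rate * (sending_flow m s * ennreal (1 / exit_rate q s))" for m s
    using mult_left_mono[of 1 "ennreal total_rate * ennreal (1 / exit_rate q s)" "sending_flow m s"] by (simp add: mult_ac)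
  then have "nat_sum (\<lambda>m. state_sum (\<lambda>s. sending_flow m s * 1))
    \<le> nat_sum (\<lambda>m. state_sum (\<lambda>s. ennreal total_rate * (sending_flow m s * ennreal (1 / exit_rate q s))))"
    by (intro nn_integral_mono)
  also have "\<dots> = ennreal total_rate * nat_sum (\<lambda>m. state_sum (\<lambda>s. sending_flow m s * ennreal (1 / exit_rate q s)))"
    by (simp add: nn_integral_cmult)
  also have "\<dots> \<le> ennreal total_rate * ennreal (arr v / mu (fst v))"
    by (intro mult_left_mono sending_time_le) simp
  also have "\<dots> < \<top>" by (simp add: ennreal_mult_less_top)
  finally show ?thesis .
qed

text \<open>The stage of a packet at step \<open>i\<close> is decided before \<open>H i\<close>, so
  the holding time contributes its mean given the state.\<close>

lemma stage_time:
  assumes R: "Measurable.pred (J.history i) R"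
  shows "(\<integral>\<^sup>+\<omega>. of_bool (R \<omega>) * ennreal (H i \<omega>) \<partial>M) = state_sum (\<lambda>s. emeasure M {\<omega> \<in> space M. R \<omega> \<and> Y i \<omega> = s} * ennreal (1 / exit_rate q s))"
proof -
  have [measurable]: "Measurable.pred M R" by (rule J.measurable_from_history[OF R])
  have "(\<integral>\<^sup>+\<omega>. of_bool (R \<omega>) * ennreal (H i \<omega>) \<partial>M) = state_sum (\<lambda>s. \<integral>\<^sup>+\<omega>. of_bool (Y i \<omega> = s) * (of_bool (R \<omega>) * ennreal (H i \<omega>)) \<partial>M)"
    by (rule J.nn_integral_split_state) measurable
  also have "\<dots> = state_sum (\<lambda>s. \<integral>\<^sup>+\<omega>. of_bool (R \<omega> \<and> Y i \<omega> = s) * ennreal (H i \<omega>) \<partial>M)"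
    by (intro nn_integral_cong) simp
  also have "\<dots> = state_sum (\<lambda>s. emeasure M {\<omega> \<in> space M. R \<omega> \<and> Y i \<omega> = s} * ennreal (1 / exit_rate q s))"
    by (intro nn_integral_cong J.expected_hold[OF R]) simp
  finally show ?thesis .
qed

definition waiting_part :: "nat \<Rightarrow> 'w \<Rightarrow> ennreal" where
  "waiting_part k \<omega> = nat_sum (\<lambda>m. of_bool (packet k \<omega> \<and> 0 < pos k (Suc k + m) \<omega>) * ennreal (H (Suc k + m) \<omega>))"

definition sending_part :: "nat \<Rightarrow> 'w \<Rightarrow> ennreal" where
  "sending_part k \<omega> = nat_sum (\<lambda>m. of_bool (packet k \<omega> \<and> sending k (Suc k + m) \<omega>) * ennreal (H (Suc k + m) \<omega>))"

lemma measurable_parts [measurable]: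
  "waiting_part k \<in> borel_measurable M" "sending_part k \<in> borel_measurable M"
  unfolding waiting_part_def[abs_def] sending_part_def[abs_def] nn_integral_count_space_nat by measurable

lemma integral_waiting_part: "(\<integral>\<^sup>+\<omega>. nat_sum (\<lambda>k. waiting_part k \<omega>) \<partial>M) = mean_queue v"
proof -
  have "(\<integral>\<^sup>+\<omega>. nat_sum (\<lambda>k. waiting_part k \<omega>) \<partial>M)
    = nat_sum (\<lambda>k. nat_sum (\<lambda>m. \<integral>\<^sup>+\<omega>. of_bool (packet k \<omega> \<and> 0 < pos k (Suc k + m) \<omega>) * ennreal (H (Suc k + m) \<omega>) \<partial>M))"
    unfolding nat_sum_integral[OF measurable_parts(1)] unfolding waiting_part_def
    by (intro nn_integral_cong nat_sum_integral) measurable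
  also have "\<dots> = nat_sum (\<lambda>k. nat_sum (\<lambda>m. state_sum (\<lambda>s. emeasure M {\<omega> \<in> space M. (packet k \<omega> \<and> 0 < pos k (Suc k + m) \<omega>) \<and> Y (Suc k + m) \<omega> = s} * ennreal (1 / exit_rate q s))))"
    by (intro nn_integral_cong stage_time packet_pos_history[where R="\<lambda>r. 0 < r"]) simp
  also have "\<dots> = state_sum (\<lambda>s. flow s * of_nat (fst s v) * ennreal (1 / exit_rate q s))"
    by (rule waiting_total)
  also have "\<dots> = state_sum (\<lambda>s. ennreal (pmf \<pi> s) * ennreal (real (fst s v)))"
  proof (intro nn_integral_cong)
    fix s
    have "flow s * ennreal (1 / exit_rate q s) = ennreal (pmf \<pi> s)"
      using exit_rate_pos[of s] by (simp add: ennreal_mult[symmetric] del: ennreal_mult')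
    moreover have "flow s * of_nat (fst s v) * ennreal (1 / exit_rate q s) = flow s * ennreal (1 / exit_rate q s) * of_nat (fst s v)"
      by (simp only: mult_ac)
    ultimately show "flow s * of_nat (fst s v) * ennreal (1 / exit_rate q s) = ennreal (pmf \<pi> s) * ennreal (real (fst s v))"
      by (simp only: ennreal_of_nat_eq_real_of_nat)
  qed
  also have "\<dots> = mean_queue v" by (simp only: state_sum_pmf mean_queue_eq)
  finally show ?thesis .
qed

lemma integral_sending_part: "(\<integral>\<^sup>+\<omega>. nat_sum (\<lambda>k. sending_part k \<omega>) \<partial>M) \<le> ennreal (arr v / mu (fst v))"
proof -
  have "(\<integral>\<^sup>+\<omega>. nat_sum (\<lambda>k. sending_part k \<omega>) \<partial>M)
    = nat_sum (\<lambda>k. nat_sum (\<lambda>m. \<integral>\<^sup>+\<omega>. of_bool (packet k \<omega> \<and> sending k (Suc k + m) \<omega>) * ennreal (H (Suc k + m) \<omega>) \<partial>M))"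
    unfolding nat_sum_integral[OF measurable_parts(2)] unfolding sending_part_def
    by (intro nn_integral_cong nat_sum_integral) measurable
  also have "\<dots> = nat_sum (\<lambda>k. nat_sum (\<lambda>m. state_sum (\<lambda>s. emeasure M {\<omega> \<in> space M. (packet k \<omega> \<and> sending k (Suc k + m) \<omega>) \<and> Y (Suc k + m) \<omega> = s} * ennreal (1 / exit_rate q s))))"
    by (intro nn_integral_cong stage_time pred_intros_logic packet_history trans_history) simp
  finally show ?thesis unfolding sending_total using sending_time_le by simp
qed

text \<open>Borel-Cantelli: a finite expected number of steps in a stage means almost surely
  finitely many, so every packet eventually leaves the stage.\<close>

lemma AE_finite_stages:
  assumes Q: "\<And>k m. Measurable.pred M (\<lambda>\<omega>. Q k m \<omega>)"
    and fin: "nat_sum (\<lambda>k. nat_sum (\<lambda>m. emeasure M {\<omega> \<in> space M. Q k m \<omega>})) < \<top>"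
  shows "AE \<omega> in M. \<forall>k n0. \<exists>m\<ge>n0. \<not> Q k m \<omega>"
proof -
  let ?f = "\<lambda>\<omega>. nat_sum (\<lambda>k. nat_sum (\<lambda>m. of_bool (Q k m \<omega>)))"
  note Q [measurable]
  have m: "(\<lambda>\<omega>. nat_sum (\<lambda>m. of_bool (Q k m \<omega>))) \<in> borel_measurable M" for k
    unfolding nn_integral_count_space_nat by measurable
  have "?f \<in> borel_measurable M"
    unfolding nn_integral_count_space_nat by measurable
  moreover have "integral\<^sup>N M ?f = nat_sum (\<lambda>k. nat_sum (\<lambda>m. emeasure M {\<omega> \<in> space M. Q k m \<omega>}))"
    unfolding nat_sum_integral[OF m] by (intro nn_integral_cong, subst nat_sum_integral) (simp_all add: J.emeasure_of_bool)
  ultimately have "AE \<omega> in M. ?f \<omega> \<noteq> \<infinity>"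
    using fin by (intro nn_integral_PInf_AE) auto
  then show ?thesis
  proof eventually_elim
    case (elim \<omega>)
    have "nat_sum (\<lambda>m. of_bool (Q k m \<omega>)) \<noteq> \<infinity>" for k
      using nn_integral_ge_point[of k UNIV "\<lambda>k. nat_sum (\<lambda>m. of_bool (Q k m \<omega>))"] elim by (auto simp: top_unique)
    from finite_nat_sum_of_bool[OF this] show ?case by blast
  qed
qed

lemma AE_leaves: "AE \<omega> in M. \<forall>k n0. \<exists>m\<ge>n0. \<not> (packet k \<omega> \<and> 0 < pos k (Suc k + m) \<omega>)"
proof (rule AE_finite_stages)
  have "nat_sum (\<lambda>k. nat_sum (\<lambda>m. emeasure M {\<omega> \<in> space M. packet k \<omega> \<and> 0 < pos k (Suc k + m) \<omega>}))
    = nat_sum (\<lambda>k. nat_sum (\<lambda>m. state_sum (\<lambda>s. emeasure M {\<omega> \<in> space M. (packet k \<omega> \<and> 0 < pos k (Suc k + m) \<omega>) \<and> Y (Suc k + m) \<omega> = s} * 1)))"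
    unfolding mult_1_right by (intro nn_integral_cong emeasure_split_state) measurable
  then show "nat_sum (\<lambda>k. nat_sum (\<lambda>m. emeasure M {\<omega> \<in> space M. packet k \<omega> \<and> 0 < pos k (Suc k + m) \<omega>})) < \<top>"
    unfolding waiting_total using queue_flow_finite by simp
qed measurable

lemma AE_ends: "AE \<omega> in M. \<forall>k n0. \<exists>m\<ge>n0. \<not> (packet k \<omega> \<and> sending k (Suc k + m) \<omega>)"
proof (rule AE_finite_stages)
  have "nat_sum (\<lambda>k. nat_sum (\<lambda>m. emeasure M {\<omega> \<in> space M. packet k \<omega> \<and> sending k (Suc k + m) \<omega>}))
    = nat_sum (\<lambda>k. nat_sum (\<lambda>m. state_sum (\<lambda>s. emeasure M {\<omega> \<in> space M. (packet k \<omega> \<and> sending k (Suc k + m) \<omega>) \<and> Y (Suc k + m) \<omega> = s} * 1)))"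
    unfolding mult_1_right by (intro nn_integral_cong emeasure_split_state) measurable
  then show "nat_sum (\<lambda>k. nat_sum (\<lambda>m. emeasure M {\<omega> \<in> space M. packet k \<omega> \<and> sending k (Suc k + m) \<omega>})) < \<top>"
    unfolding sending_total using sending_steps_finite by simp
qed measurable

text \<open>Almost surely every counted packet starts and completes, so the infima in the
  definitions are not taken over empty sets and the series over the stages apply.\<close>

lemma AE_packet_times:
  "AE \<omega> in M. \<forall>k. packet k \<omega> \<longrightarrow>
     waiting_time v (\<lambda>i. Y i \<omega>) (\<lambda>i. H i \<omega>) k = waiting_part k \<omega> \<and>
     transmission_time v (\<lambda>i. Y i \<omega>) (\<lambda>i. H i \<omega>) k \<le> sending_part k \<omega>"
  using AE_leaves AE_ends J.AE_path
proof eventually_elim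
  case (elim \<omega>)
  show ?case
  proof (intro allI impI)
    fix k assume p: "packet k \<omega>"
    then have arr: "arrival_at v (\<lambda>i. Y i \<omega>) k" by (simp add: packet_def)
    have h: "0 \<le> H i \<omega>" for i using elim(3) by (simp add: less_imp_le)
    obtain m where "\<not> 0 < pos k (Suc k + m) \<omega>" using elim(1) p by blast
    then have leaves: "\<exists>i>k. pos k i \<omega> = 0" by (intro exI[of _ "Suc k + m"]) simp
    have ends: "\<exists>i\<ge>i0. \<not> sending k i \<omega>" for i0
    proof -
      obtain m where "i0 \<le> m" "\<not> sending k (Suc k + m) \<omega>" using elim(2) p by blast
      then show ?thesis by (intro exI[of _ "Suc k + m"]) simp
    qed
    show "waiting_time v (\<lambda>i. Y i \<omega>) (\<lambda>i. H i \<omega>) k = waiting_part k \<omega> \<and>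
      transmission_time v (\<lambda>i. Y i \<omega>) (\<lambda>i. H i \<omega>) k \<le> sending_part k \<omega>"
      using waiting_time_eq[of v "\<lambda>i. Y i \<omega>" k "\<lambda>i. H i \<omega>", OF arr h leaves]
        transmission_time_le[of v "\<lambda>i. Y i \<omega>" k "\<lambda>i. H i \<omega>", OF arr h leaves ends] p
      by (simp add: waiting_part_def sending_part_def nn_integral_count_space_nat)
  qed
qed

lemma packet_iff: "arrival_at v (\<lambda>i. Y i \<omega>) k \<and> jump_time (\<lambda>i. H i \<omega>) k \<le> 1 \<longleftrightarrow> packet k \<omega>"
  by (simp add: packet_def jump_time_def J.elapsed_def lessThan_Suc_atMost)

text \<open>Campbell's formula over a unit of time, summed over all transitions that are arrivals at
  \<open>v\<close>, gives the denominator of the Palm expectation.\<close>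

lemma expected_packets: "(\<integral>\<^sup>+\<omega>. (\<Sum>k. if packet k \<omega> then 1 else 0) \<partial>M) = ennreal (arr v)"
proof -
  have "(\<integral>\<^sup>+\<omega>. (\<Sum>k. if packet k \<omega> then 1 else 0) \<partial>M) = (\<integral>\<^sup>+\<omega>. nat_sum (\<lambda>k. of_bool (packet k \<omega>)) \<partial>M)"
    unfolding nn_integral_count_space_nat of_bool_def ..
  also have "\<dots> = nat_sum (\<lambda>k. emeasure M {\<omega> \<in> space M. packet k \<omega>})"
    by (subst nat_sum_integral) (simp_all add: J.emeasure_of_bool)
  also have "\<dots> = nat_sum (\<lambda>k. state_sum (\<lambda>s. state_sum (\<lambda>s'. emeasure M {\<omega> \<in> space M. packet k \<omega> \<and> Y k \<omega> = s \<and> Y (Suc k) \<omega> = s'})))"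
  proof (intro nn_integral_cong)
    fix k
    have "emeasure M {\<omega> \<in> space M. packet k \<omega>} = state_sum (\<lambda>s. emeasure M {\<omega> \<in> space M. packet k \<omega> \<and> Y k \<omega> = s})"
      by (rule emeasure_split_state) measurable
    also have "\<dots> = state_sum (\<lambda>s. state_sum (\<lambda>s'. emeasure M {\<omega> \<in> space M. (packet k \<omega> \<and> Y k \<omega> = s) \<and> Y (Suc k) \<omega> = s'}))"
      by (intro nn_integral_cong emeasure_split_state) measurable
    finally show "emeasure M {\<omega> \<in> space M. packet k \<omega>} = state_sum (\<lambda>s. state_sum (\<lambda>s'. emeasure M {\<omega> \<in> space M. packet k \<omega> \<and> Y k \<omega> = s \<and> Y (Suc k) \<omega> = s'}))"
      by (simp only: conj_assoc)
  qed
  also have "\<dots> = nat_sum (\<lambda>k. state_sum (\<lambda>s. state_sum (\<lambda>s'. emeasure M {\<omega> \<in> space M. Y k \<omega> = s \<and> Y (Suc k) \<omega> = s' \<and> J.elapsed (Suc k) \<omega> \<le> 1} * of_bool (arrives s s'))))"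
    using packet_transition[where R="packet _" and C=True]
    by (intro nn_integral_cong) simp
  also have "\<dots> = state_sum (\<lambda>s. state_sum (\<lambda>s'. flow s * Pr s s' * of_bool (arrives s s')))"
    unfolding nat_state_swap by (intro nn_integral_cong) (simp add: nn_integral_multc nat_sum_transitions)
  also have "\<dots> = state_sum (\<lambda>s. ennreal (pmf \<pi> s) * ennreal (arr v))"
    unfolding flow_Pr by (intro nn_integral_cong) (simp add: mult.assoc nn_integral_cmult rate_arrives)
  also have "\<dots> = ennreal (arr v)"
    unfolding state_sum_pmf by simp
  finally show ?thesis .
qed

lemma packet_expectation_eq:
  "packet_expectation M Y H v f = (\<integral>\<^sup>+\<omega>. (\<Sum>k. if packet k \<omega> then f v (\<lambda>i. Y i \<omega>) (\<lambda>i. H i \<omega>) k else 0) \<partial>M) / ennreal (arr v)"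
  unfolding packet_expectation_def packet_iff expected_packets ..

lemma arr_packet_expectation:
  "ennreal (arr v) * packet_expectation M Y H v f = (\<integral>\<^sup>+\<omega>. (\<Sum>k. if packet k \<omega> then f v (\<lambda>i. Y i \<omega>) (\<lambda>i. H i \<omega>) k else 0) \<partial>M)"
  unfolding packet_expectation_eq ennreal_times_divide
  using arr_pos[of v] by (subst mult.commute, intro ennreal_mult_divide_eq) auto

theorem little_waiting: "ennreal (arr v) * packet_expectation M Y H v waiting_time = mean_queue v"
  unfolding arr_packet_expectation integral_waiting_part[symmetric]
proof (rule nn_integral_cong_AE)
  show "AE \<omega> in M. (\<Sum>k. if packet k \<omega> then waiting_time v (\<lambda>i. Y i \<omega>) (\<lambda>i. H i \<omega>) k else 0) = nat_sum (\<lambda>k. waiting_part k \<omega>)"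
    using AE_packet_times
  proof eventually_elim
    case (elim \<omega>)
    then show ?case
      unfolding nn_integral_count_space_nat by (intro arg_cong[where f=suminf] ext) (simp add: waiting_part_def)
  qed
qed

text \<open>The lower bound drops the transmission, the upper one uses its expected total. Their gap
  \<open>arr v / mu (fst v)\<close> is small because \<open>arr v\<close> is a class rate divided by
  the class size.\<close>

theorem little_sojourn:
  "mean_queue v \<le> ennreal (arr v) * packet_expectation M Y H v sojourn_time"
  "ennreal (arr v) * packet_expectation M Y H v sojourn_time \<le> mean_queue v + ennreal (arr v / mu (fst v))"
proof -
  show "mean_queue v \<le> ennreal (arr v) * packet_expectation M Y H v sojourn_time"
    unfolding little_waiting[symmetric] arr_packet_expectation
    by (intro nn_integral_mono suminf_le summableI) (simp add: sojourn_time_def)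
  have "ennreal (arr v) * packet_expectation M Y H v sojourn_time
    \<le> (\<integral>\<^sup>+\<omega>. nat_sum (\<lambda>k. waiting_part k \<omega>) + nat_sum (\<lambda>k. sending_part k \<omega>) \<partial>M)"
    unfolding arr_packet_expectation
  proof (rule nn_integral_mono_AE)
    show "AE \<omega> in M. (\<Sum>k. if packet k \<omega> then sojourn_time v (\<lambda>i. Y i \<omega>) (\<lambda>i. H i \<omega>) k else 0)
        \<le> nat_sum (\<lambda>k. waiting_part k \<omega>) + nat_sum (\<lambda>k. sending_part k \<omega>)"
      using AE_packet_times
    proof eventually_elim
      case (elim \<omega>)
      have "(\<Sum>k. if packet k \<omega> then sojourn_time v (\<lambda>i. Y i \<omega>) (\<lambda>i. H i \<omega>) k else 0) \<le> (\<Sum>k. waiting_part k \<omega> + sending_part k \<omega>)"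
        using elim by (intro suminf_le summableI) (auto simp: sojourn_time_def intro: add_mono)
      then show ?case
        unfolding nn_integral_count_space_nat by (simp add: suminf_add[symmetric] summableI)
    qed
  qed
  also have "\<dots> = (\<integral>\<^sup>+\<omega>. nat_sum (\<lambda>k. waiting_part k \<omega>) \<partial>M) + (\<integral>\<^sup>+\<omega>. nat_sum (\<lambda>k. sending_part k \<omega>) \<partial>M)"
    unfolding nn_integral_count_space_nat by (intro nn_integral_add) measurable
  also have "\<dots> \<le> mean_queue v + ennreal (arr v / mu (fst v))"
    unfolding integral_waiting_part by (intro add_left_mono integral_sending_part)
  finally show "ennreal (arr v) * packet_expectation M Y H v sojourn_time \<le> mean_queue v + ennreal (arr v / mu (fst v))" .
qed

end

section \<open>Convergence of the means\<close>

text \<open>\<open>geometric_pmf\<close> counts failures from zero, so success probability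
  \<open>1 - xi c\<close> is the limit law of the queue, with mean
  \<open>xi c / (1 - xi c)\<close>.\<close>

lemma nn_integral_geometric:
  assumes "0 < p" "p \<le> 1"
  shows "(\<integral>\<^sup>+k. of_nat k \<partial>measure_pmf (geometric_pmf p)) = ennreal ((1 - p) / p)"
  unfolding ennreal_of_nat_eq_real_of_nat
  using expectation_geometric_pmf[of p] integrable_real_geometric_pmf[of p] assms
  by (subst nn_integral_eq_integral) auto

lemma nn_integral_exponential:
  assumes "0 < l"
  shows "(\<integral>\<^sup>+x. ennreal x \<partial>density lborel (\<lambda>x. ennreal (exponential_density l x))) = ennreal (1 / l)"
proof -
  have "ennreal (exponential_density l x) * ennreal x = ennreal (exponential_density l x * x)" for x
    by (rule ennreal_mult'[symmetric]) (use assms in \<open>simp add: exponential_density_nonneg\<close>)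
  then show ?thesis
    using nn_integral_erlang_ith_moment[OF assms, of 0 1] by (simp add: nn_integral_density)
qed

theorem theorem3p5:
  fixes lam mu nu p xi :: "'c::finite \<Rightarrow> real"
    and n :: "nat \<Rightarrow> 'c \<Rightarrow> nat"
    and \<pi> :: "nat \<Rightarrow> 'c state pmf"
    and M :: "nat \<Rightarrow> 'w measure"
    and Y :: "nat \<Rightarrow> nat \<Rightarrow> 'w \<Rightarrow> 'c state"
    and H :: "nat \<Rightarrow> nat \<Rightarrow> 'w \<Rightarrow> real"
    and c :: 'c and j :: "nat \<Rightarrow> nat"
  assumes rates_pos: "\<And>d. 0 < lam d" "\<And>d. 0 < mu d" "\<And>d. 0 < nu d"
    and sizes: "\<And>N d. CARD('c) \<le> N \<Longrightarrow> 1 \<le> n N d"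
    and total: "\<And>N. CARD('c) \<le> N \<Longrightarrow> (\<Sum>d\<in>UNIV. n N d) = N"
    and stability: "Max (range (\<lambda>d. lam d / nu d)) < 1 - (\<Sum>d\<in>UNIV. lam d / mu d)"
    and fractions: "\<And>d. (\<lambda>N. real (n N d) / real N) \<longlonglongrightarrow> p d" "\<And>d. 0 < p d"
    and xi: "\<And>d. xi d = lam d / (nu d * (1 - (\<Sum>d'\<in>UNIV. lam d' / mu d')))"
    and stationary: "\<And>N. CARD('c) \<le> N \<Longrightarrow> set_pmf (\<pi> N) \<subseteq> network_states (n N)"
      "\<And>N. CARD('c) \<le> N \<Longrightarrow> stationary_pmf (network_rate (n N) lam mu nu) (\<pi> N)"
    and process: "\<And>N. CARD('c) \<le> N \<Longrightarrow>
      markov_jump_process (network_rate (n N) lam mu nu) (\<pi> N) (M N) (Y N) (H N)"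
    and node: "\<And>N. CARD('c) \<le> N \<Longrightarrow> (c, j N) \<in> nodes (n N)"
  shows "((\<lambda>N. \<integral>\<^sup>+k. of_nat k \<partial>measure_pmf (queue_law (\<pi> N) (c, j N)))
            \<longlonglongrightarrow> (\<integral>\<^sup>+k. of_nat k \<partial>measure_pmf (geometric_pmf (1 - xi c)))) \<and>
         ((\<lambda>N. ennreal (lam c / real (n N c)) *
              packet_expectation (M N) (Y N) (H N) (c, j N) waiting_time)
            \<longlonglongrightarrow> (\<integral>\<^sup>+x. ennreal x
                   \<partial>density lborel (\<lambda>x. ennreal (exponential_density ((1 - xi c) / xi c) x)))) \<and>
         ((\<lambda>N. ennreal (lam c / real (n N c)) *
              packet_expectation (M N) (Y N) (H N) (c, j N) sojourn_time)
            \<longlonglongrightarrow> (\<integral>\<^sup>+x. ennreal x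
                   \<partial>density lborel (\<lambda>x. ennreal (exponential_density ((1 - xi c) / xi c) x))))"
proof -
  have net: "stationary_network (n N) lam mu nu (\<pi> N)" if "CARD('c) \<le> N" for N
    using rates_pos sizes[OF that] stationary[OF that] stability by unfold_locales
  interpret seq: network_sequence lam mu nu p n \<pi>
    using net total fractions by (rule network_sequence.intro)
  have rho: "seq.rho = (\<Sum>d\<in>UNIV. lam d / mu d)"
    by (rule stationary_network.rho_def[OF seq.first_network])
  have x: "xi c = stationary_network.xi lam mu nu c"
    unfolding stationary_network.xi_def[OF seq.first_network] rho by (rule xi)
  have x01: "0 < xi c" "xi c < 1" unfolding x by (rule seq.xi_pos seq.xi_less_1)+
  \<comment> \<open>The geometric and the exponential limit laws share this mean, so the limit of
    the mean queue lengths serves for all three claims.\<close>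
  let ?m = "ennreal (xi c / (1 - xi c))"
  have m: "(\<lambda>N. seq.mean N (c, j N)) \<longlonglongrightarrow> ?m"
    unfolding x by (rule seq.mean_queue_tendsto) (rule node)
  have pp: "packet_process (n N) lam mu nu (\<pi> N) (M N) (Y N) (H N) (c, j N)" if "CARD('c) \<le> N" for N
    using net[OF that] process[OF that] node[OF that]
    by (simp add: packet_process_def packet_process_axioms_def)
  have q: "seq.mean N (c, j N) = (\<integral>\<^sup>+k. of_nat k \<partial>measure_pmf (queue_law (\<pi> N) (c, j N)))" if "CARD('c) \<le> N" for N
    by (rule stationary_network.mean_queue_def[OF net[OF that]])
  have arr: "network_rates.arr (n N) lam (c, j N) = lam c / real (n N c)" if "CARD('c) \<le> N" for N
    using network_rates.arr_def[of "n N" lam mu nu "(c, j N)"] net[OF that] by (simp add: stationary_network_def)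
  have 1: "(\<lambda>N. \<integral>\<^sup>+k. of_nat k \<partial>measure_pmf (queue_law (\<pi> N) (c, j N))) \<longlonglongrightarrow> ?m"
    by (rule Lim_transform_eventually[OF m]) (use q in \<open>auto intro!: eventually_sequentiallyI[of "CARD('c)"]\<close>)
  have 2: "(\<lambda>N. ennreal (lam c / real (n N c)) * packet_expectation (M N) (Y N) (H N) (c, j N) waiting_time) \<longlonglongrightarrow> ?m"
    by (rule Lim_transform_eventually[OF m])
       (use packet_process.little_waiting[OF pp] arr in \<open>auto intro!: eventually_sequentiallyI[of "CARD('c)"]\<close>)
  have "(\<lambda>N. ennreal (lam c / mu c / real (n N c))) \<longlonglongrightarrow> ennreal 0"
    by (intro tendsto_ennrealI seq.div_class_size)
  with m have m': "(\<lambda>N. seq.mean N (c, j N) + ennreal (lam c / mu c / real (n N c))) \<longlonglongrightarrow> ?m + ennreal 0"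
    by (rule tendsto_add)
  have 3: "(\<lambda>N. ennreal (lam c / real (n N c)) * packet_expectation (M N) (Y N) (H N) (c, j N) sojourn_time) \<longlonglongrightarrow> ?m"
  \<comment> \<open>The gap of the sandwich is the mean transmission time multiplied by the
    vanishing arrival rate of a single node.\<close>
  proof (rule tendsto_sandwich[OF _ _ m])
    show "\<forall>\<^sub>F N in sequentially. seq.mean N (c, j N) \<le> ennreal (lam c / real (n N c)) * packet_expectation (M N) (Y N) (H N) (c, j N) sojourn_time"
      using packet_process.little_sojourn(1)[OF pp] arr by (auto intro!: eventually_sequentiallyI[of "CARD('c)"])
    show "\<forall>\<^sub>F N in sequentially. ennreal (lam c / real (n N c)) * packet_expectation (M N) (Y N) (H N) (c, j N) sojourn_time
      \<le> seq.mean N (c, j N) + ennreal (lam c / mu c / real (n N c))"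
      using packet_process.little_sojourn(2)[OF pp] arr by (auto intro!: eventually_sequentiallyI[of "CARD('c)"] simp: mult.commute)
    show "(\<lambda>N. seq.mean N (c, j N) + ennreal (lam c / mu c / real (n N c))) \<longlonglongrightarrow> ?m"
      using m' by simp
  qed
  have "(\<integral>\<^sup>+k. of_nat k \<partial>measure_pmf (geometric_pmf (1 - xi c))) = ?m"
    using nn_integral_geometric[of "1 - xi c"] x01 by simp
  moreover have "(\<integral>\<^sup>+x. ennreal x \<partial>density lborel (\<lambda>x. ennreal (exponential_density ((1 - xi c) / xi c) x))) = ?m"
    using nn_integral_exponential[of "(1 - xi c) / xi c"] x01 by simp
  ultimately show ?thesis using 1 2 3 by simp
qed

end
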